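(* Let $\Theta=\tilde p/p$ be a rational inner function on $\mathbb{D}^2$ of degree $(m,n)$, let $\mathcal{K}_\Theta=\mathcal{S}_1\oplus\mathcal{S}_2$ be an orthogonal decomposition into closed subspaces with $\mathcal{S}_1$ invariant under $M_{z_1}$ and $\mathcal{S}_2$ invariant under $M_{z_2}$, and let $S^1_\Theta=P_{\mathcal{S}_2}M_{z_1}|_{\mathcal{S}_2}$. Let $\{q_1/p,\dots,q_m/p\}$ be an orthonormal basis of $\mathcal{S}_2\ominus z_2\mathcal{S}_2$ with each $q_i$ a polynomial, and let $\mathcal{U}:H^2_2(\mathbb{D})^m\to\mathcal{S}_2$ be the unitary $\mathcal{U}(f_1,\dots,f_m)=\sum_{i=1}^m\frac{q_i}{p}f_i$. Then there exists an $m\times m$ matrix-valued function $M_\Theta$, whose entries are rational functions of $\bar z_2$ and continuous on $\overline{\mathbb{D}}$, such that \[S^1_\Theta=\mathcal{U}\,T_{M_\Theta}\,\mathcal{U}^*.\]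
   Context: $\mathbb{D}$ is the open unit disk, $\mathbb{T}$ the unit circle, $H^2(\mathbb{D}^2)$ the Hardy space of the bidisk. A rational inner function on $\mathbb{D}^2$ is a rational function holomorphic on $\mathbb{D}^2$ with $|\Theta|=1$ a.e. on $\mathbb{T}^2$; its degree $(m,n)$ is defined by writing $\Theta=q/p$ in lowest terms, $m$ (resp. $n$) being the highest power of $z_1$ (resp. $z_2$) appearing in $p$ or $q$. One may write $\Theta=\tilde p/p$ with $p$ a polynomial with no zeros on $\mathbb{D}^2$, $\tilde p(z)=z_1^mz_2^n\overline{p(1/\bar z_1,1/\bar z_2)}$, $p,\tilde p$ coprime. $\mathcal{K}_\Theta=H^2(\mathbb{D}^2)\ominus\Theta H^2(\mathbb{D}^2)$. The space $\mathcal{S}_2\ominus z_2\mathcal{S}_2$ has dimension $m$ and has an orthonormal basis of the stated form, and the map $\mathcal{U}$ so defined is unitary. $H^2_2(\mathbb{D})$ is the one-variable Hardy space in the variable $z_2$, $H^2_2(\mathbb{D})^m$ its $m$-fold direct sum, $L^2_2(\mathbb{T})^m$ likewise. For a bounded $m\times m$ matrix function $F$ on $\mathbb{T}$, the $z_2$-matrix-valued Toeplitz operator is $T_F:H^2_2(\mathbb{D})^m\to H^2_2(\mathbb{D})^m$, $T_F\vec f=P_{H^2_2(\mathbb{D})^m}(F\vec f)$, where $P_{H^2_2(\mathbb{D})^m}$ is the orthogonal projection of $L^2_2(\mathbb{T})^m$ onto $H^2_2(\mathbb{D})^m$. *)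

theory Defs
  imports "HOL-Analysis.Analysis" "HOL-Computational_Algebra.Polynomial"
begin

section \<open>Two-variable polynomials, represented as polynomials in z2 with coefficients in C[z1]\<close>

definition eval2 :: "complex poly poly \<Rightarrow> complex \<Rightarrow> complex \<Rightarrow> complex" where
  "eval2 p z1 z2 = poly (map_poly (\<lambda>c. poly c z1) p) z2"

definition coeff2 :: "complex poly poly \<Rightarrow> nat \<Rightarrow> nat \<Rightarrow> complex" where
  "coeff2 p j k = coeff (coeff p k) j"

definition deg1 :: "complex poly poly \<Rightarrow> nat" where
  "deg1 p = Max (insert 0 (degree ` set (coeffs p)))"

definition deg2 :: "complex poly poly \<Rightarrow> nat" where
  "deg2 p = degree p"

text \<open>reflection: ptilde(z) = z1^m z2^n conj(p(1/conj z1, 1/conj z2))\<close>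
definition ptilde :: "nat \<Rightarrow> nat \<Rightarrow> complex poly poly \<Rightarrow> complex poly poly" where
  "ptilde m n p = (\<Sum>k\<le>n. monom (\<Sum>j\<le>m. monom (cnj (coeff2 p (m - j) (n - k))) j) k)"

definition bidisk :: "(complex \<times> complex) set" where
  "bidisk = ball 0 1 \<times> ball 0 1"

text \<open>Elements of H2 are functions on the bidisk, extended by 0 outside.\<close>
definition restr2 :: "(complex \<times> complex \<Rightarrow> complex) \<Rightarrow> complex \<times> complex \<Rightarrow> complex" where
  "restr2 f = (\<lambda>z. if z \<in> bidisk then f z else 0)"

definition H2rep :: "(complex \<times> complex \<Rightarrow> complex) \<Rightarrow> (nat \<times> nat \<Rightarrow> complex) \<Rightarrow> bool" where
  "H2rep f a \<longleftrightarrow> (\<lambda>jk. (norm (a jk))\<^sup>2) summable_on UNIV \<and>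
     (\<forall>z1 z2. (z1, z2) \<in> bidisk \<longrightarrow>
        ((\<lambda>(j, k). a (j, k) * z1 ^ j * z2 ^ k) has_sum f (z1, z2)) UNIV)"

definition H2 :: "(complex \<times> complex \<Rightarrow> complex) set" where
  "H2 = {f. (\<exists>a. H2rep f a) \<and> (\<forall>z. z \<notin> bidisk \<longrightarrow> f z = 0)}"

definition h2coef :: "(complex \<times> complex \<Rightarrow> complex) \<Rightarrow> nat \<times> nat \<Rightarrow> complex" where
  "h2coef f = (SOME a. H2rep f a)"

definition h2inner :: "(complex \<times> complex \<Rightarrow> complex) \<Rightarrow> (complex \<times> complex \<Rightarrow> complex) \<Rightarrow> complex" where
  "h2inner f g = (\<Sum>\<^sub>\<infinity>jk. h2coef f jk * cnj (h2coef g jk))"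

definition h2norm :: "(complex \<times> complex \<Rightarrow> complex) \<Rightarrow> real" where
  "h2norm f = sqrt (Re (h2inner f f))"

definition closed_subspace :: "(complex \<times> complex \<Rightarrow> complex) set \<Rightarrow> bool" where
  "closed_subspace S \<longleftrightarrow> S \<subseteq> H2 \<and> (\<lambda>_. 0) \<in> S \<and>
     (\<forall>f\<in>S. \<forall>g\<in>S. (\<lambda>z. f z + g z) \<in> S) \<and> (\<forall>c. \<forall>f\<in>S. (\<lambda>z. c * f z) \<in> S) \<and>
     (\<forall>s f. (\<forall>k. s k \<in> S) \<and> f \<in> H2 \<and> (\<lambda>k. h2norm (\<lambda>z. s k z - f z)) \<longlonglongrightarrow> 0 \<longrightarrow> f \<in> S)"

definition Mz1 :: "(complex \<times> complex \<Rightarrow> complex) \<Rightarrow> complex \<times> complex \<Rightarrow> complex" where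
  "Mz1 f = (\<lambda>z. fst z * f z)"

definition Mz2 :: "(complex \<times> complex \<Rightarrow> complex) \<Rightarrow> complex \<times> complex \<Rightarrow> complex" where
  "Mz2 f = (\<lambda>z. snd z * f z)"

definition invariant :: "((complex \<times> complex \<Rightarrow> complex) \<Rightarrow> (complex \<times> complex \<Rightarrow> complex))
   \<Rightarrow> (complex \<times> complex \<Rightarrow> complex) set \<Rightarrow> bool" where
  "invariant T S \<longleftrightarrow> (\<forall>f\<in>S. T f \<in> S)"

definition ominus :: "(complex \<times> complex \<Rightarrow> complex) set \<Rightarrow> (complex \<times> complex \<Rightarrow> complex) set
   \<Rightarrow> (complex \<times> complex \<Rightarrow> complex) set" where
  "ominus B A = {f\<in>B. \<forall>g\<in>A. h2inner f g = 0}"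

definition proj :: "(complex \<times> complex \<Rightarrow> complex) set \<Rightarrow> (complex \<times> complex \<Rightarrow> complex)
   \<Rightarrow> (complex \<times> complex \<Rightarrow> complex)" where
  "proj S f = (THE g. g \<in> S \<and> (\<forall>h\<in>S. h2inner (\<lambda>z. f z - g z) h = 0))"

definition Kspace :: "nat \<Rightarrow> nat \<Rightarrow> complex poly poly \<Rightarrow> (complex \<times> complex \<Rightarrow> complex) set" where
  "Kspace m n p = ominus H2
     ((\<lambda>g. restr2 (\<lambda>(z1, z2). eval2 (ptilde m n p) z1 z2 / eval2 p z1 z2 * g (z1, z2))) ` H2)"

definition H2rep1 :: "(complex \<Rightarrow> complex) \<Rightarrow> (nat \<Rightarrow> complex) \<Rightarrow> bool" where
  "H2rep1 f a \<longleftrightarrow> (\<lambda>k. (norm (a k))\<^sup>2) summable_on UNIV \<and>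
     (\<forall>z \<in> ball 0 1. ((\<lambda>k. a k * z ^ k) has_sum f z) UNIV)"

definition H2one :: "(complex \<Rightarrow> complex) set" where
  "H2one = {f. (\<exists>a. H2rep1 f a) \<and> (\<forall>z. z \<notin> ball 0 1 \<longrightarrow> f z = 0)}"

definition h2coef1 :: "(complex \<Rightarrow> complex) \<Rightarrow> nat \<Rightarrow> complex" where
  "h2coef1 f = (SOME a. H2rep1 f a)"

definition h2inner1 :: "(complex \<Rightarrow> complex) \<Rightarrow> (complex \<Rightarrow> complex) \<Rightarrow> complex" where
  "h2inner1 f g = (\<Sum>\<^sub>\<infinity>k. h2coef1 f k * cnj (h2coef1 g k))"

definition H2vec :: "nat \<Rightarrow> (nat \<Rightarrow> complex \<Rightarrow> complex) set" where
  "H2vec m = {F. (\<forall>i<m. F i \<in> H2one) \<and> (\<forall>i\<ge>m. F i = (\<lambda>_. 0))}"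

definition vinner :: "nat \<Rightarrow> (nat \<Rightarrow> complex \<Rightarrow> complex) \<Rightarrow> (nat \<Rightarrow> complex \<Rightarrow> complex) \<Rightarrow> complex" where
  "vinner m F G = (\<Sum>i<m. h2inner1 (F i) (G i))"

definition bv :: "(complex \<Rightarrow> complex) \<Rightarrow> complex \<Rightarrow> complex" where
  "bv f \<zeta> = Lim (at_left 1) (\<lambda>r::real. f (complex_of_real r * \<zeta>))"

definition fourier :: "(complex \<Rightarrow> complex) \<Rightarrow> int \<Rightarrow> complex" where
  "fourier h k = integral\<^sup>L (lebesgue_on {0..2*pi}) (\<lambda>t. h (cis t) * cis (- (of_int k * t))) / (2 * pi)"

text \<open>orthogonal projection L^2(T) -> H^2: keep the nonnegative Fourier coefficients\<close>
definition PH2 :: "(complex \<Rightarrow> complex) \<Rightarrow> complex \<Rightarrow> complex" where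
  "PH2 h = (\<lambda>z. if z \<in> ball 0 1 then (\<Sum>k. fourier h (int k) * z ^ k) else 0)"

definition toeplitz :: "nat \<Rightarrow> (complex \<Rightarrow> nat \<Rightarrow> nat \<Rightarrow> complex) \<Rightarrow> (nat \<Rightarrow> complex \<Rightarrow> complex)
   \<Rightarrow> (nat \<Rightarrow> complex \<Rightarrow> complex)" where
  "toeplitz m F G = (\<lambda>i. if i < m then PH2 (\<lambda>\<zeta>. \<Sum>l<m. F \<zeta> i l * bv (G l) \<zeta>) else (\<lambda>_. 0))"

definition Umap :: "nat \<Rightarrow> complex poly poly \<Rightarrow> (nat \<Rightarrow> complex poly poly) \<Rightarrow> (nat \<Rightarrow> complex \<Rightarrow> complex)
   \<Rightarrow> complex \<times> complex \<Rightarrow> complex" where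
  "Umap m p q F = restr2 (\<lambda>(z1, z2). \<Sum>i<m. eval2 (q i) z1 z2 / eval2 p z1 z2 * F i z2)"

definition Uadj :: "nat \<Rightarrow> complex poly poly \<Rightarrow> (nat \<Rightarrow> complex poly poly) \<Rightarrow> (complex \<times> complex \<Rightarrow> complex)
   \<Rightarrow> (nat \<Rightarrow> complex \<Rightarrow> complex)" where
  "Uadj m p q g = (THE F. F \<in> H2vec m \<and> (\<forall>G\<in>H2vec m. h2inner (Umap m p q G) g = vinner m G F))"

end

theory Submission
  imports Defs "HOL-Complex_Analysis.Complex_Analysis"
begin

text \<open>
  Since \<open>\<K>\<^sub>\<Theta>\<close> is invariant under the backward shift in \<open>z\<^sub>1\<close> and \<open>S\<^sub>1\<close> is invariant under \<open>M\<^sub>z\<^sub>1\<close>, the space \<open>S\<^sub>2\<close>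
  is invariant under the backward shift \<open>L\<close> in \<open>z\<^sub>1\<close>, which restricts to the adjoint of the compression.
  By the Wold decomposition the vectors \<open>z\<^sub>2\<^sup>k q\<^sub>i/p\<close> form an orthonormal basis of \<open>S\<^sub>2\<close>, and \<open>L\<close> commutes with
  \<open>M\<^sub>z\<^sub>2\<close>; hence \<open>L\<close> acts on \<open>H\<^sup>2\<^sub>2(D)\<^sup>m\<close> as multiplication by the matrix \<open>\<Phi>\<close> defined by
  \<open>L(q\<^sub>i/p) = \<Sum>\<^sub>l (q\<^sub>l/p) \<Phi>\<^sub>l\<^sub>i(z\<^sub>2)\<close>, and the symbol is the adjoint of \<open>\<Phi>\<close>. Comparing coefficients of powers of \<open>z\<^sub>1\<close>
  gives a linear system for \<open>\<Phi>\<^sub>l\<^sub>i\<close> over the polynomials in \<open>z\<^sub>2\<close> with linearly independent columns, so \<open>\<Phi>\<^sub>l\<^sub>i\<close> is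
  rational; being in \<open>H\<^sup>2\<close> it has no poles on the closed disk. The Toeplitz operator is defined through
  radial limits, whose existence almost everywhere is Fatou's theorem, obtained from a weak-type
  inequality for the radial maximal function.
\<close>

section \<open>Square-summable families\<close>

text \<open>The functions in the statement carry their Hilbert space structure only through
  \<open>h2coef\<close>, a \<open>SOME\<close>-choice of Taylor coefficients. Everything is
  therefore transported to coefficient space: \<open>fn2\<close> and \<open>fn1\<close> turn
  square-summable families into Hardy functions, are injective, and carry \<open>ip\<close> to the
  Hardy inner products. Backward-shift invariance of the model space rests on \<Theta> mapping H^2
  into itself, for the pairing with \<Theta> g has its intended meaning only if \<Theta> g lies in
  H^2 again. The polynomial p is free of zeros on the open bidisk only, so 1/p may be unbounded
  there, and the bound for multiplication by \<Theta> is obtained from dilations p(rz) with r < 1.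
  The symbol is the conjugate of functions continuous up to the boundary, but the vectors on which
  it acts have radial limits only almost everywhere. The Fourier coefficients in
  \<open>toeplitz\<close> are therefore computed at radius r < 1 and carried to r = 1 by uniform
  convergence of the symbol and L^1 convergence of the vectors.\<close>

typedef 'i ell2 = "{a :: 'i \<Rightarrow> complex. (\<lambda>i. (norm (a i))\<^sup>2) summable_on UNIV}"
  morphisms ell2_coef Abs_ell2
  by (rule exI[of _ "\<lambda>_. 0"]) simp

setup_lifting type_definition_ell2

lemma square_summable_mult:
  fixes a b :: "'i \<Rightarrow> complex"
  assumes "(\<lambda>i. (norm (a i))\<^sup>2) summable_on UNIV" "(\<lambda>i. (norm (b i))\<^sup>2) summable_on UNIV"
  shows "(\<lambda>i. norm (a i * b i)) summable_on UNIV"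
  using abs_summable_product[of a UNIV b] assms by (simp add: norm_mult power2_eq_square)

lemma square_summable_add:
  fixes a b :: "'i \<Rightarrow> complex"
  assumes "(\<lambda>i. (norm (a i))\<^sup>2) summable_on UNIV" "(\<lambda>i. (norm (b i))\<^sup>2) summable_on UNIV"
  shows "(\<lambda>i. (norm (a i + b i))\<^sup>2) summable_on UNIV"
proof (rule summable_on_comparison_test)
  show "(\<lambda>i. 2 * (norm (a i))\<^sup>2 + 2 * (norm (b i))\<^sup>2) summable_on UNIV"
    by (intro summable_on_add summable_on_cmult_right assms)
  fix i
  have "(norm (a i + b i))\<^sup>2 \<le> (norm (a i) + norm (b i))\<^sup>2"
    by (intro power_mono norm_triangle_ineq) auto
  also have "\<dots> \<le> 2 * (norm (a i))\<^sup>2 + 2 * (norm (b i))\<^sup>2"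
    using sum_squares_bound[of "norm (a i)" "norm (b i)"] by (simp add: power2_sum)
  finally show "(norm (a i + b i))\<^sup>2 \<le> 2 * (norm (a i))\<^sup>2 + 2 * (norm (b i))\<^sup>2" .
qed auto

lemma square_summable_cmult:
  fixes a :: "'i \<Rightarrow> complex"
  assumes "(\<lambda>i. (norm (a i))\<^sup>2) summable_on UNIV"
  shows "(\<lambda>i. (norm (c * a i))\<^sup>2) summable_on UNIV"
  using assms by (simp add: norm_mult power_mult_distrib summable_on_cmult_right)

definition ip :: "'i ell2 \<Rightarrow> 'i ell2 \<Rightarrow> complex" where
  "ip x y = (\<Sum>\<^sub>\<infinity>i. ell2_coef x i * cnj (ell2_coef y i))"

lemma ell2_square_summable: "(\<lambda>i. (norm (ell2_coef x i))\<^sup>2) summable_on UNIV"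
  using ell2_coef[of x] by simp

lemma ell2_ip_abs_summable: "(\<lambda>i. norm (ell2_coef x i * cnj (ell2_coef y i))) summable_on UNIV"
  by (rule square_summable_mult) (simp_all add: ell2_square_summable)

lemma ell2_ip_summable: "(\<lambda>i. ell2_coef x i * cnj (ell2_coef y i)) summable_on UNIV"
  by (rule abs_summable_summable[OF ell2_ip_abs_summable])

text \<open>The type classes supply a real vector space; \<open>sc\<close> is the complex scalar
  multiplication, kept as a separate operation beside \<open>scaleR\<close>.\<close>

lift_definition sc :: "complex \<Rightarrow> 'i ell2 \<Rightarrow> 'i ell2" is "\<lambda>c a i. c * a i"
  by (rule square_summable_cmult)

instantiation ell2 :: (type) real_vector
begin
lift_definition zero_ell2 :: "'a ell2" is "\<lambda>_. 0" by simp
lift_definition plus_ell2 :: "'a ell2 \<Rightarrow> 'a ell2 \<Rightarrow> 'a ell2" is "\<lambda>a b i. a i + b i"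
  by (rule square_summable_add)
lift_definition uminus_ell2 :: "'a ell2 \<Rightarrow> 'a ell2" is "\<lambda>a i. - a i" by simp
lift_definition minus_ell2 :: "'a ell2 \<Rightarrow> 'a ell2 \<Rightarrow> 'a ell2" is "\<lambda>a b i. a i - b i"
proof -
  fix a b :: "'a \<Rightarrow> complex"
  assume "(\<lambda>i. (norm (a i))\<^sup>2) summable_on UNIV" "(\<lambda>i. (norm (b i))\<^sup>2) summable_on UNIV"
  then show "(\<lambda>i. (norm (a i - b i))\<^sup>2) summable_on UNIV"
    using square_summable_add[of a "\<lambda>i. - b i"] by simp
qed
lift_definition scaleR_ell2 :: "real \<Rightarrow> 'a ell2 \<Rightarrow> 'a ell2" is "\<lambda>r a i. of_real r * a i"
  by (rule square_summable_cmult)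
instance
  by standard (transfer; simp add: algebra_simps)+
end

lemma ell2_coef_simps [simp]:
  "ell2_coef 0 i = 0" "ell2_coef (x + y) i = ell2_coef x i + ell2_coef y i"
  "ell2_coef (- x) i = - ell2_coef x i" "ell2_coef (x - y) i = ell2_coef x i - ell2_coef y i"
  "ell2_coef (r *\<^sub>R x) i = of_real r * ell2_coef x i" "ell2_coef (sc c x) i = c * ell2_coef x i"
  by (transfer; simp)+

lemma ell2_eqI: "(\<And>i. ell2_coef x i = ell2_coef y i) \<Longrightarrow> x = y"
  by (metis ell2_coef_inject ext)

lemma ip_commute: "ip x y = cnj (ip y x)"
  unfolding ip_def infsum_cnj[symmetric] by (simp add: mult.commute)

lemma ip_add_left: "ip (x + y) z = ip x z + ip y z"
  unfolding ip_def by (simp add: distrib_right infsum_add ell2_ip_summable)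

lemma ip_sc_left: "ip (sc c x) y = c * ip x y"
  unfolding ip_def by (simp add: mult.assoc infsum_cmult_right')

lemma scaleR_eq_sc: "r *\<^sub>R x = sc (of_real r) x"
  by (rule ell2_eqI) simp

lemma ip_self: "ip x x = of_real (\<Sum>\<^sub>\<infinity>i. (norm (ell2_coef x i))\<^sup>2)"
proof -
  have "ip x x = (\<Sum>\<^sub>\<infinity>i. of_real ((norm (ell2_coef x i))\<^sup>2))"
    unfolding ip_def by (simp only: complex_norm_square)
  also have "\<dots> = of_real (\<Sum>\<^sub>\<infinity>i. (norm (ell2_coef x i))\<^sup>2)"
    using ell2_square_summable[of x] by (metis has_sum_infsum has_sum_of_real infsumI)
  finally show ?thesis .
qed

text \<open>The real inner product is the real part of \<open>ip\<close>. It induces the same norm,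
  so Cauchy-Schwarz, the parallelogram law and the topology become available, while complex
  orthogonality continues to be expressed by \<open>ip\<close>.\<close>

instantiation ell2 :: (type) real_inner
begin
definition inner_ell2 :: "'a ell2 \<Rightarrow> 'a ell2 \<Rightarrow> real" where "inner_ell2 x y = Re (ip x y)"
definition norm_ell2 :: "'a ell2 \<Rightarrow> real" where "norm_ell2 x = sqrt (inner x x)"
definition sgn_ell2 :: "'a ell2 \<Rightarrow> 'a ell2" where "sgn_ell2 x = x /\<^sub>R norm x"
definition dist_ell2 :: "'a ell2 \<Rightarrow> 'a ell2 \<Rightarrow> real" where "dist_ell2 x y = norm (x - y)"
definition uniformity_ell2 :: "('a ell2 \<times> 'a ell2) filter" where
  "uniformity_ell2 = (INF e\<in>{0<..}. principal {(x, y). dist x y < e})"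
definition open_ell2 :: "'a ell2 set \<Rightarrow> bool" where
  "open_ell2 U \<longleftrightarrow> (\<forall>x\<in>U. \<forall>\<^sub>F (x', y) in uniformity. x' = x \<longrightarrow> y \<in> U)"
instance
proof
  fix x y z :: "'a ell2" and r :: real
  show "inner x y = inner y x"
    unfolding inner_ell2_def using ip_commute[of x y] by simp
  show "inner (x + y) z = inner x z + inner y z"
    unfolding inner_ell2_def by (simp add: ip_add_left)
  show "inner (r *\<^sub>R x) y = r * inner x y"
    unfolding inner_ell2_def by (simp add: scaleR_eq_sc ip_sc_left)
  show "0 \<le> inner x x"
    unfolding inner_ell2_def by (simp add: ip_self infsum_nonneg)
  show "inner x x = 0 \<longleftrightarrow> x = 0"
  proof
    assume "inner x x = 0"
    then have "infsum (\<lambda>i. (norm (ell2_coef x i))\<^sup>2) UNIV \<le> 0"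
      unfolding inner_ell2_def by (simp add: ip_self)
    then have "(norm (ell2_coef x i))\<^sup>2 = 0" for i
      by (rule nonneg_infsum_le_0D[OF _ ell2_square_summable]) auto
    then show "x = 0" by (intro ell2_eqI) simp
  qed (simp add: inner_ell2_def ip_self)
qed (simp_all add: norm_ell2_def sgn_ell2_def dist_ell2_def uniformity_ell2_def open_ell2_def)
end

lemma norm_ell2_square: "(norm x)\<^sup>2 = (\<Sum>\<^sub>\<infinity>i. (norm (ell2_coef x i))\<^sup>2)"
  unfolding norm_ell2_def inner_ell2_def by (simp add: ip_self infsum_nonneg)

lemma ip_self_norm: "ip x x = of_real ((norm x)\<^sup>2)"
  by (simp add: ip_self norm_ell2_square)

lemma ip_add_right: "ip z (x + y) = ip z x + ip z y"
  by (metis ip_add_left ip_commute complex_cnj_add)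

lemma ip_sc_right: "ip x (sc c y) = cnj c * ip x y"
  by (metis ip_sc_left ip_commute complex_cnj_mult)

lemma ip_scaleR_left: "ip (r *\<^sub>R x) y = of_real r * ip x y"
  by (simp add: scaleR_eq_sc ip_sc_left)

lemma ip_scaleR_right: "ip x (r *\<^sub>R y) = of_real r * ip x y"
  by (simp add: scaleR_eq_sc ip_sc_right)

lemma norm_sc [simp]: "norm (sc c x) = norm c * norm x"
proof -
  have "ip (sc c x) (sc c x) = of_real ((norm c * norm x)\<^sup>2)"
    unfolding ip_sc_left ip_sc_right power_mult_distrib of_real_mult complex_norm_square[of c]
    by (simp only: ip_self_norm mult_ac)
  then have "(norm (sc c x))\<^sup>2 = (norm c * norm x)\<^sup>2"
    by (metis ip_self_norm of_real_eq_iff)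
  then show ?thesis by (simp add: power2_eq_iff_nonneg)
qed

lemma norm_ip_le: "norm (ip x y) \<le> norm x * norm y"
proof (cases "ip x y = 0")
  case False
  \<comment> \<open>A unimodular factor rotates \<open>ip x y\<close> onto the positive real axis,
    where the real Cauchy-Schwarz inequality gives the complex one.\<close>
  define u where "u = cnj (ip x y) / norm (ip x y)"
  have "ip (sc u x) y = of_real (norm (ip x y))"
    using False unfolding u_def ip_sc_left
    by (simp add: mult.commute[of "cnj _"] complex_norm_square[symmetric] power2_eq_square)
  then have "norm (ip x y) = inner (sc u x) y"
    by (simp add: inner_ell2_def)
  also have "\<dots> \<le> norm (sc u x) * norm y"
    using Cauchy_Schwarz_ineq2[of "sc u x" y] by linarith
  also have "norm (sc u x) = norm x"
    using False by (simp add: u_def norm_divide)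
  finally show ?thesis .
qed simp

lemma bounded_linear_ip_right: "bounded_linear (ip x)"
  by (rule bounded_linear_intro[where K = "norm x"])
    (simp_all add: ip_add_right ip_scaleR_right scaleR_conv_of_real mult.commute[of _ "norm x"] norm_ip_le)

lemma bounded_linear_ip_left: "bounded_linear (\<lambda>x. ip x y)"
  by (rule bounded_linear_intro[where K = "norm y"])
    (simp_all add: ip_add_left ip_scaleR_left scaleR_conv_of_real norm_ip_le)

lemma ip_diff_left: "ip (x - y) z = ip x z - ip y z"
  using linear_diff[OF bounded_linear.linear[OF bounded_linear_ip_left]] .

lemma ip_diff_right: "ip z (x - y) = ip z x - ip z y"
  using linear_diff[OF bounded_linear.linear[OF bounded_linear_ip_right]] .

lemma ip_zero [simp]: "ip 0 x = 0" "ip x 0 = 0"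
  by (simp_all add: ip_def)

lemma ip_sum_left: "ip (\<Sum>i\<in>A. f i) y = (\<Sum>i\<in>A. ip (f i) y)"
  using linear_sum[OF bounded_linear.linear[OF bounded_linear_ip_left]] .

lemma ip_sum_right: "ip y (\<Sum>i\<in>A. f i) = (\<Sum>i\<in>A. ip y (f i))"
  using linear_sum[OF bounded_linear.linear[OF bounded_linear_ip_right]] .

lemma sum_coef_le_norm_ell2:
  assumes "finite A"
  shows "(\<Sum>i\<in>A. (norm (ell2_coef x i))\<^sup>2) \<le> (norm x)\<^sup>2"
  unfolding norm_ell2_square
  by (rule finite_sum_le_infsum[OF ell2_square_summable]) (use assms in auto)

lemma norm_coef_le_norm_ell2: "norm (ell2_coef x i) \<le> norm x"
proof -
  have "(norm (ell2_coef x i))\<^sup>2 \<le> (norm x)\<^sup>2"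
    using sum_coef_le_norm_ell2[of "{i}" x] by simp
  then show ?thesis by (rule power2_le_imp_le) simp
qed

lemma bounded_linear_ell2_coef: "bounded_linear (\<lambda>x. ell2_coef x i)"
  by (rule bounded_linear_intro[where K = 1])
    (simp_all add: scaleR_conv_of_real norm_coef_le_norm_ell2)

text \<open>The coordinates of a Cauchy sequence converge, and bounds on finite partial sums of
  squared differences survive the coordinatewise limit. Taking all finite index sets together yields
  both square-summability of the limit and convergence in norm.\<close>

instance ell2 :: (type) complete_space
proof
  fix X :: "nat \<Rightarrow> 'a ell2"
  assume "Cauchy X"
  have "Cauchy (\<lambda>n. ell2_coef (X n) i)" for i
    using bounded_linear.Cauchy[OF bounded_linear_ell2_coef \<open>Cauchy X\<close>] .
  then have "\<forall>i. \<exists>l. (\<lambda>n. ell2_coef (X n) i) \<longlonglongrightarrow> l"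
    using Cauchy_convergent convergent_def by blast
  then obtain L where L: "\<And>i. (\<lambda>n. ell2_coef (X n) i) \<longlonglongrightarrow> L i" by metis
  have bound: "\<exists>N. \<forall>n\<ge>N. \<forall>A. finite A \<longrightarrow> (\<Sum>i\<in>A. (norm (ell2_coef (X n) i - L i))\<^sup>2) \<le> e\<^sup>2"
    if "e > 0" for e :: real
  proof -
    obtain N where N: "\<And>k n. k \<ge> N \<Longrightarrow> n \<ge> N \<Longrightarrow> norm (X k - X n) < e"
      using CauchyD[OF \<open>Cauchy X\<close> \<open>e > 0\<close>] by blast
    have "(\<Sum>i\<in>A. (norm (ell2_coef (X n) i - L i))\<^sup>2) \<le> e\<^sup>2" if "n \<ge> N" "finite A" for n A
    proof (rule LIMSEQ_le_const2)
      show "(\<lambda>k. \<Sum>i\<in>A. (norm (ell2_coef (X n) i - ell2_coef (X k) i))\<^sup>2)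
          \<longlonglongrightarrow> (\<Sum>i\<in>A. (norm (ell2_coef (X n) i - L i))\<^sup>2)"
        by (intro tendsto_intros L)
      have "(\<Sum>i\<in>A. (norm (ell2_coef (X n) i - ell2_coef (X k) i))\<^sup>2) \<le> e\<^sup>2" if "k \<ge> N" for k
      proof -
        have "(\<Sum>i\<in>A. (norm (ell2_coef (X n - X k) i))\<^sup>2) \<le> (norm (X n - X k))\<^sup>2"
          by (rule sum_coef_le_norm_ell2) fact
        also have "\<dots> \<le> e\<^sup>2"
          using N[OF \<open>n \<ge> N\<close> \<open>k \<ge> N\<close>] by (intro power_mono) auto
        finally show ?thesis by simp
      qed
      then show "\<exists>N. \<forall>k\<ge>N. (\<Sum>i\<in>A. (norm (ell2_coef (X n) i - ell2_coef (X k) i))\<^sup>2) \<le> e\<^sup>2"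
        by blast
    qed
    then show ?thesis by blast
  qed
  have summ: "(\<lambda>i. (norm (ell2_coef (X n) i - L i))\<^sup>2) summable_on UNIV \<and>
      (\<Sum>\<^sub>\<infinity>i. (norm (ell2_coef (X n) i - L i))\<^sup>2) \<le> e\<^sup>2"
    if "\<forall>A. finite A \<longrightarrow> (\<Sum>i\<in>A. (norm (ell2_coef (X n) i - L i))\<^sup>2) \<le> e\<^sup>2" for n e
  proof
    show "(\<lambda>i. (norm (ell2_coef (X n) i - L i))\<^sup>2) summable_on UNIV"
      by (rule nonneg_bdd_above_summable_on) (use that in \<open>auto simp: bdd_above_def\<close>)
    then show "(\<Sum>\<^sub>\<infinity>i. (norm (ell2_coef (X n) i - L i))\<^sup>2) \<le> e\<^sup>2"
      using that by (intro infsum_le_finite_sums) auto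
  qed
  obtain N where "\<forall>A. finite A \<longrightarrow> (\<Sum>i\<in>A. (norm (ell2_coef (X N) i - L i))\<^sup>2) \<le> 1\<^sup>2"
    using bound[of 1] by auto
  then have "(\<lambda>i. (norm (ell2_coef (X N) i - L i))\<^sup>2) summable_on UNIV"
    using summ by blast
  from square_summable_add[OF ell2_square_summable[of "X N"] square_summable_cmult[OF this, of "-1"]]
  have "(\<lambda>i. (norm (L i))\<^sup>2) summable_on UNIV" by simp
  then obtain l where l: "ell2_coef l = L"
    by (metis Abs_ell2_inverse mem_Collect_eq)
  have "X \<longlonglongrightarrow> l"
  proof (rule LIMSEQ_I)
    fix e :: real assume "e > 0"
    then obtain N where N: "\<forall>n\<ge>N. \<forall>A. finite A \<longrightarrow>
        (\<Sum>i\<in>A. (norm (ell2_coef (X n) i - L i))\<^sup>2) \<le> (e/2)\<^sup>2"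
      using bound[of "e/2"] by auto
    have "norm (X n - l) < e" if "n \<ge> N" for n
    proof -
      have "(norm (X n - l))\<^sup>2 \<le> (e/2)\<^sup>2"
        unfolding norm_ell2_square using summ N that by (simp add: l)
      then have "norm (X n - l) \<le> e/2"
        by (rule power2_le_imp_le) (use \<open>e > 0\<close> in auto)
      then show ?thesis using \<open>e > 0\<close> by simp
    qed
    then show "\<exists>N. \<forall>n\<ge>N. norm (X n - l) < e" by blast
  qed
  then show "convergent X" by (auto simp: convergent_def)
qed

instance ell2 :: (type) banach ..

section \<open>Complex subspaces and orthogonal projection\<close>

definition csubspace :: "'i ell2 set \<Rightarrow> bool" where
  "csubspace V \<longleftrightarrow> 0 \<in> V \<and> (\<forall>x\<in>V. \<forall>y\<in>V. x + y \<in> V) \<and> (\<forall>c. \<forall>x\<in>V. sc c x \<in> V)"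

lemma csubspace_imp_subspace: "csubspace V \<Longrightarrow> subspace V"
  by (auto simp: csubspace_def subspace_def scaleR_eq_sc)

text \<open>The minimising sequence is Cauchy by the parallelogram law.\<close>
lemma orthogonal_projection_exists:
  fixes x :: "'i ell2"
  assumes "csubspace V" "closed V"
  obtains v where "v \<in> V" "\<And>w. w \<in> V \<Longrightarrow> ip (x - v) w = 0"
proof -
  note sub = csubspace_imp_subspace[OF assms(1)]
  have "0 \<in> V" using sub by (rule subspace_0)
  define d where "d = infdist x V"
  have d_le: "d \<le> norm (x - v)" if "v \<in> V" for v
    unfolding d_def using infdist_le[OF that, of x] by (simp add: dist_norm)
  have d0: "d \<ge> 0" unfolding d_def by (rule infdist_nonneg)
  have "\<exists>v\<in>V. norm (x - v) < d + inverse (real (Suc n))" for n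
  proof (rule ccontr)
    assume "\<not> ?thesis"
    then have "d + inverse (real (Suc n)) \<le> infdist x V"
      using \<open>0 \<in> V\<close> by (subst infdist_notempty) (auto simp: dist_norm not_less intro!: cINF_greatest)
    then show False by (simp add: d_def)
  qed
  then obtain v where v: "\<And>n. v n \<in> V" "\<And>n. norm (x - v n) < d + inverse (real (Suc n))"
    by metis
  have lim: "(\<lambda>n. d + inverse (real (Suc n))) \<longlonglongrightarrow> d"
    using tendsto_add[OF tendsto_const LIMSEQ_inverse_real_of_nat, of d] by simp
  have para: "(norm (v n - v k))\<^sup>2 \<le> 2 * (norm (x - v n))\<^sup>2 + 2 * (norm (x - v k))\<^sup>2 - 4 * d\<^sup>2" for n k
  proof -
    define a b where "a = x - v n" and "b = x - v k"
    have "(norm (a + b))\<^sup>2 + (norm (a - b))\<^sup>2 = 2 * (norm a)\<^sup>2 + 2 * (norm b)\<^sup>2"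
      by (simp add: power2_norm_eq_inner inner_add_left inner_add_right inner_diff_left inner_diff_right inner_commute)
    moreover have "a + b = 2 *\<^sub>R (x - (1/2) *\<^sub>R (v n + v k))"
      by (simp add: a_def b_def scaleR_diff_right scaleR_2)
    moreover have "d \<le> norm (x - (1/2) *\<^sub>R (v n + v k))"
      by (intro d_le subspace_scale[OF sub] subspace_add[OF sub] v)
    then have "d\<^sup>2 \<le> (norm (x - (1/2) *\<^sub>R (v n + v k)))\<^sup>2"
      using d0 by (intro power_mono) auto
    moreover have "norm (a - b) = norm (v n - v k)"
      by (simp add: a_def b_def norm_minus_commute)
    ultimately show ?thesis
      by (simp add: power_mult_distrib a_def[symmetric] b_def[symmetric])
  qed
  have "Cauchy v"
  proof (rule CauchyI)
    fix e :: real assume "e > 0"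
    have "(\<lambda>n. (d + inverse (real (Suc n)))\<^sup>2) \<longlonglongrightarrow> d\<^sup>2"
      by (intro tendsto_intros lim)
    then have "\<forall>\<^sub>F n in sequentially. (d + inverse (real (Suc n)))\<^sup>2 < d\<^sup>2 + e\<^sup>2 / 4"
      using \<open>e > 0\<close> by (intro order_tendstoD(2)) auto
    then obtain N where N: "\<And>n. n \<ge> N \<Longrightarrow> (d + inverse (real (Suc n)))\<^sup>2 < d\<^sup>2 + e\<^sup>2 / 4"
      by (auto simp: eventually_sequentially)
    have near: "(norm (x - v n))\<^sup>2 < d\<^sup>2 + e\<^sup>2 / 4" if "n \<ge> N" for n
    proof -
      have "(norm (x - v n))\<^sup>2 \<le> (d + inverse (real (Suc n)))\<^sup>2"
        using v(2)[of n] by (intro power_mono) auto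
      then show ?thesis using N[OF that] by linarith
    qed
    have "norm (v n - v k) < e" if "n \<ge> N" "k \<ge> N" for n k
    proof -
      have "(norm (v n - v k))\<^sup>2 < e\<^sup>2"
        using para[of n k] near[OF that(1)] near[OF that(2)] by (simp add: field_simps)
      then show ?thesis
        by (rule power2_less_imp_less) (use \<open>e > 0\<close> in auto)
    qed
    then show "\<exists>M. \<forall>n\<ge>M. \<forall>k\<ge>M. norm (v n - v k) < e" by blast
  qed
  then obtain u where u: "v \<longlonglongrightarrow> u"
    using Cauchy_convergent convergent_def by blast
  have "u \<in> V" using closed_sequentially[OF assms(2) _ u] v(1) by blast
  have "norm (x - u) \<le> d"
  proof (rule LIMSEQ_le)
    show "(\<lambda>n. norm (x - v n)) \<longlonglongrightarrow> norm (x - u)" by (intro tendsto_intros u)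
  qed (use lim v(2) less_imp_le in auto)
  have "ip (x - u) w = 0" if "w \<in> V" for w
  proof (cases "w = 0")
    case False
    \<comment> \<open>\<open>sc c w\<close> is the component of \<open>x - u\<close> along
      \<open>w\<close>; adding it to \<open>u\<close> would lower the squared distance to
      \<open>x\<close> by |<x - u, w>|^2 / |w|^2, which minimality forbids unless the inner product
      vanishes.\<close>
    define c where "c = ip (x - u) w / of_real ((norm w)\<^sup>2)"
    have "u + sc c w \<in> V" using assms(1) \<open>u \<in> V\<close> that by (auto simp: csubspace_def)
    have "x - (u + sc c w) = (x - u) - sc c w" by simp
    have nw: "norm w > 0" using False by simp
    have ww: "ip w w = of_real ((norm w)\<^sup>2)" by (rule ip_self_norm)
    have w0: "(of_real ((norm w)\<^sup>2) :: complex) \<noteq> 0" using nw by simp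
    have wu: "ip w (x - u) = cnj (ip (x - u) w)" by (rule ip_commute)
    have "ip (x - u - sc c w) (x - u - sc c w)
        = ip (x - u) (x - u) - ip (x - u) w * cnj (ip (x - u) w) / of_real ((norm w)\<^sup>2)"
      unfolding ip_diff_left[of "x-u" "sc c w"] ip_diff_right[of _ "x-u" "sc c w"] ip_sc_left ip_sc_right wu ww
      using w0 by (simp add: c_def field_simps)
    also have "\<dots> = of_real ((norm (x - u))\<^sup>2 - (norm (ip (x - u) w))\<^sup>2 / (norm w)\<^sup>2)"
      by (simp only: ip_self_norm complex_norm_square of_real_diff of_real_divide)
    finally have "(norm (x - u - sc c w))\<^sup>2 = (norm (x - u))\<^sup>2 - (norm (ip (x - u) w))\<^sup>2 / (norm w)\<^sup>2"
      unfolding ip_self_norm of_real_eq_iff .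
    moreover have "(norm (x - u))\<^sup>2 \<le> (norm (x - u - sc c w))\<^sup>2"
      using \<open>norm (x - u) \<le> d\<close> d_le[OF \<open>u + sc c w \<in> V\<close>]
      by (intro power_mono) (auto simp: diff_diff_eq)
    ultimately have "(norm (ip (x - u) w))\<^sup>2 / (norm w)\<^sup>2 \<le> 0" by linarith
    then show ?thesis using nw by (simp add: divide_le_0_iff)
  qed simp
  then show ?thesis using that \<open>u \<in> V\<close> by blast
qed

section \<open>Orthonormal series and the Wold decomposition\<close>

lemma norm_orthonormal_sum:
  assumes "\<And>k l. ip (x k) (x l) = (if k = l then 1 else 0)"
  shows "(norm (\<Sum>k\<in>A. sc (c k) (x k)))\<^sup>2 = (\<Sum>k\<in>A. (norm (c k))\<^sup>2)"
proof (cases "finite A")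
  case True
  have "ip (\<Sum>k\<in>A. sc (c k) (x k)) (\<Sum>k\<in>A. sc (c k) (x k)) = (\<Sum>k\<in>A. c k * cnj (c k))"
    using True by (simp add: ip_sum_left ip_sum_right ip_sc_left ip_sc_right assms if_distrib sum.delta mult.commute cong: if_cong)
  also have "\<dots> = of_real (\<Sum>k\<in>A. (norm (c k))\<^sup>2)"
    by (simp only: of_real_sum complex_norm_square)
  finally show ?thesis unfolding ip_self_norm of_real_eq_iff .
qed simp

lemma orthonormal_series_summable:
  fixes x :: "nat \<Rightarrow> 'i ell2"
  assumes on: "\<And>k l. ip (x k) (x l) = (if k = l then 1 else 0)"
    and c: "summable (\<lambda>k. (norm (c k))\<^sup>2)"
  shows "summable (\<lambda>k. sc (c k) (x k))"
  unfolding summable_Cauchy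
proof (intro allI impI)
  fix e :: real assume "e > 0"
  then obtain N where N: "\<And>m n. m \<ge> N \<Longrightarrow> norm (sum (\<lambda>k. (norm (c k))\<^sup>2) {m..<n}) < e\<^sup>2"
    using c unfolding summable_Cauchy by (meson zero_less_power)
  have "norm (sum (\<lambda>k. sc (c k) (x k)) {m..<n}) < e" if "m \<ge> N" for m n
  proof -
    have "(norm (sum (\<lambda>k. sc (c k) (x k)) {m..<n}))\<^sup>2 < e\<^sup>2"
      using N[OF that, of n] by (simp add: norm_orthonormal_sum[OF on] sum_nonneg)
    then show ?thesis by (rule power2_less_imp_less) (use \<open>e > 0\<close> in auto)
  qed
  then show "\<exists>N. \<forall>m\<ge>N. \<forall>n. norm (sum (\<lambda>k. sc (c k) (x k)) {m..<n}) < e" by blast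
qed

text \<open>Pythagoras: for a partial sum \<open>s\<close> of the expansion both <s, y> and <y, s>
  equal |s|^2, so |y - s|^2 = |y|^2 - |s|^2 and the partial sums stay below |y|^2.\<close>

lemma bessel_summable:
  fixes x :: "nat \<Rightarrow> 'i ell2"
  assumes on: "\<And>k l. ip (x k) (x l) = (if k = l then 1 else 0)"
  shows "summable (\<lambda>k. (norm (ip y (x k)))\<^sup>2)"
proof (rule summableI_nonneg_bounded)
  fix n
  define s where "s = (\<Sum>k<n. sc (ip y (x k)) (x k))"
  have yx: "ip (x k) y = cnj (ip y (x k))" for k by (rule ip_commute)
  have s2: "(norm s)\<^sup>2 = (\<Sum>k<n. (norm (ip y (x k)))\<^sup>2)"
    unfolding s_def by (rule norm_orthonormal_sum[OF on])
  have "ip s y = of_real ((norm s)\<^sup>2)"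
    unfolding s2 unfolding s_def ip_sum_left ip_sc_left yx by (simp only: of_real_sum complex_norm_square)
  moreover then have "ip y s = of_real ((norm s)\<^sup>2)"
    using ip_commute[of y s] by simp
  ultimately have "ip (y - s) (y - s) = of_real ((norm y)\<^sup>2 - (norm s)\<^sup>2)"
    unfolding ip_diff_left ip_diff_right by (simp add: ip_self_norm)
  then have "(norm (y - s))\<^sup>2 = (norm y)\<^sup>2 - (norm s)\<^sup>2"
    unfolding ip_self_norm of_real_eq_iff .
  then show "(\<Sum>k<n. (norm (ip y (x k)))\<^sup>2) \<le> (norm y)\<^sup>2"
    unfolding s2[symmetric] using zero_le_power2[of "norm (y - s)"] by linarith
qed auto

text \<open>In the application \<open>e i k\<close> is z_2^k q_i/p: finitely many rows i < m, one
  for each generator, and in each row an ordinary series over k.\<close>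

definition onseries :: "nat \<Rightarrow> (nat \<Rightarrow> nat \<Rightarrow> 'i ell2) \<Rightarrow> (nat \<Rightarrow> nat \<Rightarrow> complex) \<Rightarrow> 'i ell2" where
  "onseries m e c = (\<Sum>i<m. \<Sum>k. sc (c i k) (e i k))"

definition onfamily :: "nat \<Rightarrow> (nat \<Rightarrow> nat \<Rightarrow> 'i ell2) \<Rightarrow> bool" where
  "onfamily m e \<longleftrightarrow> (\<forall>i<m. \<forall>j<m. \<forall>k l. ip (e i k) (e j l) = (if i = j \<and> k = l then 1 else 0))"

lemma onfamily_row: "onfamily m e \<Longrightarrow> i < m \<Longrightarrow> ip (e i k) (e i l) = (if k = l then 1 else 0)"
  by (simp add: onfamily_def)

lemma onfamily_summable:
  assumes "onfamily m e" "i < m" "summable (\<lambda>k. (norm (c k))\<^sup>2)"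
  shows "summable (\<lambda>k. sc (c k) (e i k))"
  by (rule orthonormal_series_summable) (use assms in \<open>auto simp: onfamily_row\<close>)

lemma ip_onseries_right_sums:
  assumes "onfamily m e" "\<And>i. i < m \<Longrightarrow> summable (\<lambda>k. (norm (c i k))\<^sup>2)" "i < m"
  shows "(\<lambda>k. cnj (c i k) * ip y (e i k)) sums ip y (\<Sum>k. sc (c i k) (e i k))"
  using bounded_linear.sums[OF bounded_linear_ip_right summable_sums[OF onfamily_summable[OF assms(1,3) assms(2)[OF assms(3)]]]]
  by (simp add: ip_sc_right)

lemma ip_onseries_right:
  assumes "onfamily m e" "\<And>i. i < m \<Longrightarrow> summable (\<lambda>k. (norm (c i k))\<^sup>2)"
  shows "ip y (onseries m e c) = (\<Sum>i<m. \<Sum>k. cnj (c i k) * ip y (e i k))"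
  unfolding onseries_def ip_sum_right
  by (intro sum.cong refl sums_unique ip_onseries_right_sums) (use assms in auto)

lemma ip_onseries_basis:
  assumes on: "onfamily m e" and c: "\<And>i. i < m \<Longrightarrow> summable (\<lambda>k. (norm (c i k))\<^sup>2)" and "j < m"
  shows "ip (onseries m e c) (e j l) = c j l"
proof -
  have "ip (e j l) (onseries m e c) = (\<Sum>i<m. \<Sum>k. cnj (c i k) * ip (e j l) (e i k))"
    by (rule ip_onseries_right[OF on c])
  also have "\<dots> = (\<Sum>i<m. if i = j then cnj (c j l) else 0)"
  proof (intro sum.cong refl)
    fix i assume "i \<in> {..<m}"
    then have "(\<Sum>k. cnj (c i k) * ip (e j l) (e i k)) = (\<Sum>k. if k = l then (if i = j then cnj (c j l) else 0) else 0)"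
      using on \<open>j < m\<close> by (intro suminf_cong) (auto simp: onfamily_def)
    also have "\<dots> = (if i = j then cnj (c j l) else 0)"
      using sums_unique[OF sums_single[of l "\<lambda>_. if i = j then cnj (c j l) else 0"]] by simp
    finally show "(\<Sum>k. cnj (c i k) * ip (e j l) (e i k)) = (if i = j then cnj (c j l) else 0)" .
  qed
  also have "\<dots> = cnj (c j l)" using \<open>j < m\<close> by simp
  finally show ?thesis using ip_commute[of "onseries m e c" "e j l"] by simp
qed

lemma csubspace_sum:
  assumes "csubspace V" "\<And>i. i \<in> A \<Longrightarrow> f i \<in> V"
  shows "sum f A \<in> V"
  using csubspace_imp_subspace[OF assms(1)] assms(2) by (rule subspace_sum)

lemma onseries_mem:
  assumes on: "onfamily m e" and c: "\<And>i. i < m \<Longrightarrow> summable (\<lambda>k. (norm (c i k))\<^sup>2)"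
    and V: "csubspace V" "closed V" and e: "\<And>i k. i < m \<Longrightarrow> e i k \<in> V"
  shows "onseries m e c \<in> V"
  unfolding onseries_def
proof (rule csubspace_sum[OF V(1)])
  fix i assume "i \<in> {..<m}"
  then have "(\<lambda>k. sc (c i k) (e i k)) sums (\<Sum>k. sc (c i k) (e i k))"
    using onfamily_summable[OF on _ c] by (auto intro: summable_sums)
  then have "(\<lambda>n. \<Sum>k<n. sc (c i k) (e i k)) \<longlonglongrightarrow> (\<Sum>k. sc (c i k) (e i k))"
    by (simp add: sums_def)
  moreover have "(\<Sum>k<n. sc (c i k) (e i k)) \<in> V" for n
    using \<open>i \<in> {..<m}\<close> e V(1) by (intro csubspace_sum[OF V(1)]) (auto simp: csubspace_def)
  ultimately show "(\<Sum>k. sc (c i k) (e i k)) \<in> V"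
    using closed_sequentially[OF V(2)] by (metis (no_types, lifting))
qed

text \<open>A vector of \<open>V\<close> orthogonal to all \<open>Z\<^sup>k w\<^sub>i\<close> lies in \<open>Z\<^sup>k V\<close> for every \<open>k\<close>.\<close>
lemma wold_decomposition:
  fixes Z :: "'i ell2 \<Rightarrow> 'i ell2" and w :: "nat \<Rightarrow> 'i ell2"
  assumes V: "csubspace V" "closed V" "\<And>x. x \<in> V \<Longrightarrow> Z x \<in> V"
    and Z_add: "\<And>x y. Z (x + y) = Z x + Z y" and Z_sc: "\<And>c x. Z (sc c x) = sc c (Z x)"
    and Z_ip: "\<And>x y. ip (Z x) (Z y) = ip x y"
    and pure: "\<And>x. (\<And>k. \<exists>y. x = (Z ^^ k) y) \<Longrightarrow> x = 0"
    and w: "\<And>i. i < m \<Longrightarrow> w i \<in> V" "\<And>i x. i < m \<Longrightarrow> x \<in> V \<Longrightarrow> ip (w i) (Z x) = 0"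
    and won: "\<And>i j. i < m \<Longrightarrow> j < m \<Longrightarrow> ip (w i) (w j) = (if i = j then 1 else 0)"
    and wspan: "\<And>x. x \<in> V \<Longrightarrow> (\<And>y. y \<in> V \<Longrightarrow> ip x (Z y) = 0) \<Longrightarrow> \<exists>c. x = (\<Sum>i<m. sc (c i) (w i))"
  defines "e \<equiv> \<lambda>i k. (Z ^^ k) (w i)"
  shows "onfamily m e" and "\<And>i k. i < m \<Longrightarrow> e i k \<in> V"
    and "\<And>v. v \<in> V \<Longrightarrow> v = onseries m e (\<lambda>i k. ip v (e i k))"
proof -
  have Zk_ip: "ip ((Z ^^ k) x) ((Z ^^ k) y) = ip x y" for k x y
    by (induction k) (auto simp: Z_ip)
  have Zk_V: "(Z ^^ k) x \<in> V" if "x \<in> V" for k x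
    by (induction k) (auto simp: that V(3))
  show eV: "\<And>i k. i < m \<Longrightarrow> e i k \<in> V"
    unfolding e_def using Zk_V w(1) by blast
  have less: "ip (e i k) (e j l) = 0" if "i < m" "j < m" "k < l" for i j k l
  proof -
    obtain d where d: "l = k + Suc d" using \<open>k < l\<close> less_iff_Suc_add by auto
    have "e j l = (Z ^^ k) (Z ((Z ^^ d) (w j)))"
      by (simp add: e_def d funpow_add funpow_swap1)
    then have "ip (e i k) (e j l) = ip (w i) (Z ((Z ^^ d) (w j)))"
      by (simp add: e_def Zk_ip)
    then show ?thesis using w Zk_V that by auto
  qed
  show on: "onfamily m e"
    unfolding onfamily_def
  proof (intro allI impI)
    fix i j k l :: nat assume ij: "i < m" "j < m"
    consider "k = l" | "k < l" | "l < k" by linarith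
    then show "ip (e i k) (e j l) = (if i = j \<and> k = l then 1 else 0)"
    proof cases
      case 1 then show ?thesis using won[OF ij] by (simp add: e_def Zk_ip)
    next
      case 2 then show ?thesis using less[OF ij] by simp
    next
      case 3 then show ?thesis using less[OF ij(2,1)] ip_commute[of "e i k" "e j l"] by simp
    qed
  qed
  have Z_scaleR: "Z (r *\<^sub>R x) = r *\<^sub>R Z x" for r x by (simp add: scaleR_eq_sc Z_sc)
  have Z_norm: "norm (Z x) = norm x" for x
    using Z_ip[of x x] unfolding ip_self_norm of_real_eq_iff by (simp add: power2_eq_iff_nonneg)
  have Z_bl: "bounded_linear Z"
    by (rule bounded_linear_intro[where K = 1]) (simp_all add: Z_add Z_scaleR Z_norm)
  \<comment> \<open>An isometry maps complete sets to complete sets, so the image of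
    \<open>V\<close> admits orthogonal projections.\<close>
  have ZV_closed: "closed (Z ` V)"
  proof -
    have "complete (Z ` V)"
      by (rule complete_isometric_image[where e = 1])
        (use Z_bl csubspace_imp_subspace[OF V(1)] V(2) in \<open>auto simp: Z_norm complete_eq_closed\<close>)
    then show ?thesis by (simp add: complete_eq_closed)
  qed
  have Z0: "Z 0 = 0" using Z_sc[of 0 0] by (metis ell2_coef_simps(1,6) ell2_eqI mult_zero_left)
  have ZV_sub: "csubspace (Z ` V)"
    using V(1) unfolding csubspace_def by (auto simp: Z_add[symmetric] Z_sc[symmetric] Z0 intro: image_eqI[of 0 Z 0])
  \<comment> \<open>The remainder of x after projection onto the image of \<open>V\<close> is
    orthogonal to that image, hence a combination of the \<open>w i\<close> by \<open>wspan\<close>.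
    It is then orthogonal to x and to its projection u, therefore to itself.\<close>
  have step: "\<exists>y\<in>V. x = Z y" if "x \<in> V" "\<And>i. i < m \<Longrightarrow> ip x (w i) = 0" for x
  proof -
    obtain u where u: "u \<in> Z ` V" "\<And>y. y \<in> Z ` V \<Longrightarrow> ip (x - u) y = 0"
      using orthogonal_projection_exists[OF ZV_sub ZV_closed] by blast
    have "u \<in> V" using u(1) V(3) by auto
    then have "x - u \<in> V" using \<open>x \<in> V\<close> csubspace_imp_subspace[OF V(1)] by (blast intro: subspace_diff)
    then obtain c where c: "x - u = (\<Sum>i<m. sc (c i) (w i))"
      using wspan[of "x - u"] u(2) by blast
    have "ip x (x - u) = 0" unfolding c ip_sum_right ip_sc_right using that(2) by simp
    moreover have "ip u (x - u) = 0" using u ip_commute[of u "x - u"] by simp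
    ultimately have "ip (x - u) (x - u) = 0" by (simp add: ip_diff_left)
    then have "x = u" by (simp add: ip_self_norm)
    then show ?thesis using u(1) by auto
  qed
  fix v assume "v \<in> V"
  define c where "c = (\<lambda>i k. ip v (e i k))"
  have c_sum: "summable (\<lambda>k. (norm (c i k))\<^sup>2)" if "i < m" for i
    unfolding c_def by (rule bessel_summable) (use on that in \<open>auto simp: onfamily_row\<close>)
  define x where "x = v - onseries m e c"
  have "x \<in> V" unfolding x_def
    using csubspace_imp_subspace[OF V(1)] \<open>v \<in> V\<close>
    by (rule subspace_diff) (rule onseries_mem[OF on c_sum V(1,2) eV])
  have x_orth: "ip x (e i k) = 0" if "i < m" for i k
    using ip_onseries_basis[of m e c i k, OF on c_sum that] unfolding x_def ip_diff_left by (simp add: c_def)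
  have "\<exists>y\<in>V. x = (Z ^^ k) y" for k
  proof (induction k)
    case 0 then show ?case using \<open>x \<in> V\<close> by auto
  next
    case (Suc k)
    then obtain y where y: "y \<in> V" "x = (Z ^^ k) y" by blast
    have "ip y (w i) = 0" if "i < m" for i
      using x_orth[OF that, of k] by (simp add: y(2) e_def Zk_ip)
    then obtain y' where "y' \<in> V" "y = Z y'" using step[OF y(1)] by blast
    then show ?case using y(2) by (auto simp: funpow_swap1)
  qed
  then have "x = 0" using pure by blast
  then show "v = onseries m e (\<lambda>i k. ip v (e i k))" by (simp add: x_def c_def)
qed

section \<open>Hardy spaces as spaces of square-summable coefficients\<close>

lemma power_series_sums_zero_imp:
  fixes a :: "nat \<Rightarrow> complex"
  assumes "\<And>z. norm z < 1 \<Longrightarrow> (\<lambda>k. a k * z ^ k) sums 0"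
  shows "a k = 0"
proof -
  have sums: "(\<lambda>n. a n * (z - 0) ^ n) sums 0" if "norm (z - 0) < 1" for z
    using assms that by auto
  show ?thesis
  proof (cases "k = 0")
    case True
    have "(\<lambda>n. a n * 0 ^ n) sums 0" using sums[of 0] by simp
    then show ?thesis using True by simp
  next
    case False
    show ?thesis
    proof (rule ccontr)
      assume "a k \<noteq> 0"
      \<comment> \<open>Zeros of a nontrivial power series are isolated; this is contradicted by the
        function that vanishes identically. The isolation theorem asks for a positive index, so k =
        0 is read off at the origin instead.\<close>
      show False
      proof (rule powser_0_nonzero[of 1 0 a "\<lambda>_. 0" k])
        fix s :: real
        assume "0 < s" "\<And>z :: complex. z \<in> cball 0 s - {0} \<Longrightarrow> (0 :: complex) \<noteq> 0"
        moreover from this have "of_real s \<in> cball 0 s - {0 :: complex}" by simp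
        ultimately show False by blast
      qed (use sums False \<open>a k \<noteq> 0\<close> in auto)
    qed
  qed
qed

lemma power_series_zero_imp:
  fixes a :: "nat \<Rightarrow> complex"
  assumes "\<And>z. norm z < 1 \<Longrightarrow> ((\<lambda>k. a k * z ^ k) has_sum 0) UNIV"
  shows "a k = 0"
  using assms by (intro power_series_sums_zero_imp has_sum_imp_sums)

lemma double_geometric_summable:
  fixes r s :: real
  assumes "0 \<le> r" "r < 1" "0 \<le> s" "s < 1"
  shows "(\<lambda>(j, k). r ^ j * s ^ k) summable_on (UNIV :: (nat \<times> nat) set)"
proof -
  have "(\<lambda>(j, k). r ^ j * s ^ k) summable_on (Sigma UNIV (\<lambda>_. UNIV) :: (nat \<times> nat) set)"
  proof (rule summable_on_SigmaI)
    fix j :: nat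
    have "((\<lambda>k. s ^ k) has_sum (1 / (1 - s))) UNIV"
      using geometric_sums[of s] assms by (intro sums_nonneg_imp_has_sum) auto
    then show "((\<lambda>k. case (j, k) of (j, k) \<Rightarrow> r ^ j * s ^ k) has_sum (r ^ j * (1 / (1 - s)))) UNIV"
      using has_sum_cmult_right by fastforce
    have "((\<lambda>k. r ^ k) has_sum (1 / (1 - r))) UNIV"
      using geometric_sums[of r] assms by (intro sums_nonneg_imp_has_sum) auto
    then show "(\<lambda>j. r ^ j * (1 / (1 - s))) summable_on UNIV"
      using has_sum_imp_summable summable_on_cmult_left by blast
  qed (use assms in auto)
  then show ?thesis by simp
qed

text \<open>The coefficient family of the Szego kernel at z, so that pairing with it evaluates a
  function at z. Off the bidisk the family is not square-summable and \<open>Abs_ell2\<close> is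
  unspecified; hence the guard in \<open>fn2\<close>, which also realises the extension by 0 used in
  \<open>H2\<close>.\<close>

definition kern2 :: "complex \<times> complex \<Rightarrow> (nat \<times> nat) ell2" where
  "kern2 z = Abs_ell2 (\<lambda>(j, k). cnj (fst z) ^ j * cnj (snd z) ^ k)"

definition fn2 :: "(nat \<times> nat) ell2 \<Rightarrow> complex \<times> complex \<Rightarrow> complex" where
  "fn2 x z = (if z \<in> bidisk then ip x (kern2 z) else 0)"

definition kern1 :: "complex \<Rightarrow> nat ell2" where
  "kern1 z = Abs_ell2 (\<lambda>k. cnj z ^ k)"

definition fn1 :: "nat ell2 \<Rightarrow> complex \<Rightarrow> complex" where
  "fn1 x z = (if z \<in> ball 0 1 then ip x (kern1 z) else 0)"

lemma bidisk_iff [simp]: "(z1, z2) \<in> bidisk \<longleftrightarrow> norm z1 < 1 \<and> norm z2 < 1"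
  by (simp add: bidisk_def)

lemma kern2_coef:
  assumes "norm z1 < 1" "norm z2 < 1"
  shows "ell2_coef (kern2 (z1, z2)) (j, k) = cnj z1 ^ j * cnj z2 ^ k"
proof -
  have "(\<lambda>(j, k). ((norm z1)\<^sup>2) ^ j * ((norm z2)\<^sup>2) ^ k) summable_on UNIV"
    using assms by (intro double_geometric_summable) (auto simp: power_less_one_iff)
  moreover have "(\<lambda>(j, k). ((norm z1)\<^sup>2) ^ j * ((norm z2)\<^sup>2) ^ k)
      = (\<lambda>i. (norm (case i of (j, k) \<Rightarrow> cnj z1 ^ j * cnj z2 ^ k))\<^sup>2)"
    by (auto simp: fun_eq_iff norm_mult norm_power power_mult_distrib power_mult[symmetric] mult.commute)
  ultimately show ?thesis
    by (simp add: kern2_def Abs_ell2_inverse)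
qed

lemma kern1_geometric:
  assumes "norm z < 1"
  shows "((\<lambda>k. (norm (cnj z ^ k))\<^sup>2) has_sum (1 / (1 - (norm z)\<^sup>2))) UNIV"
proof -
  have "(\<lambda>k. ((norm z)\<^sup>2) ^ k) sums (1 / (1 - (norm z)\<^sup>2))"
    using assms by (intro geometric_sums) (auto simp: power_less_one_iff)
  then have "((\<lambda>k. ((norm z)\<^sup>2) ^ k) has_sum (1 / (1 - (norm z)\<^sup>2))) UNIV"
    by (intro sums_nonneg_imp_has_sum) auto
  then show ?thesis
    by (simp add: norm_power power_mult[symmetric] mult.commute)
qed

lemma kern1_coef:
  assumes "norm z < 1"
  shows "ell2_coef (kern1 z) k = cnj z ^ k"
  using has_sum_imp_summable[OF kern1_geometric[OF assms]] by (simp add: kern1_def Abs_ell2_inverse)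

text \<open>Cauchy-Schwarz against the Szego kernel, whose squared norm is the geometric sum 1/(1 -
  |z|^2). This growth bound is what later excludes poles on the unit circle.\<close>

lemma norm_fn1_le:
  assumes "norm z < 1"
  shows "norm (fn1 x z) \<le> norm x / sqrt (1 - (norm z)\<^sup>2)"
proof -
  have "(norm (kern1 z))\<^sup>2 = 1 / (1 - (norm z)\<^sup>2)"
    unfolding norm_ell2_square kern1_coef[OF assms] using kern1_geometric[OF assms] by (rule infsumI)
  then have "norm (kern1 z) = 1 / sqrt (1 - (norm z)\<^sup>2)"
    by (metis real_sqrt_abs abs_norm_cancel real_sqrt_divide real_sqrt_one)
  then show ?thesis
    using norm_ip_le[of x "kern1 z"] assms by (simp add: fn1_def)
qed

lemma fn2_has_sum:
  assumes "norm z1 < 1" "norm z2 < 1"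
  shows "((\<lambda>(j, k). ell2_coef x (j, k) * z1 ^ j * z2 ^ k) has_sum fn2 x (z1, z2)) UNIV"
proof -
  have "((\<lambda>i. ell2_coef x i * cnj (ell2_coef (kern2 (z1, z2)) i)) has_sum fn2 x (z1, z2)) UNIV"
    using assms by (simp add: fn2_def ip_def ell2_ip_summable)
  then show ?thesis
    by (rule has_sum_cong[THEN iffD1, rotated]) (auto simp: kern2_coef[OF assms])
qed

lemma fn1_has_sum:
  assumes "norm z < 1"
  shows "((\<lambda>k. ell2_coef x k * z ^ k) has_sum fn1 x z) UNIV"
proof -
  have "((\<lambda>i. ell2_coef x i * cnj (ell2_coef (kern1 z) i)) has_sum fn1 x z) UNIV"
    using assms by (simp add: fn1_def ip_def ell2_ip_summable)
  then show ?thesis by (simp add: kern1_coef[OF assms])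
qed

lemma fn2_eqI:
  assumes "norm z1 < 1" "norm z2 < 1"
    and "((\<lambda>(j, k). ell2_coef x (j, k) * z1 ^ j * z2 ^ k) has_sum s) UNIV"
  shows "fn2 x (z1, z2) = s"
  using fn2_has_sum[OF assms(1,2)] assms(3) by (rule has_sum_unique)

lemma fn1_eqI:
  assumes "norm z < 1" "((\<lambda>k. ell2_coef x k * z ^ k) has_sum s) UNIV"
  shows "fn1 x z = s"
  using fn1_has_sum[OF assms(1)] assms(2) by (rule has_sum_unique)

lemma fn2_linear:
  "(\<lambda>z. fn2 x z + fn2 y z) = fn2 (x + y)" "(\<lambda>z. fn2 x z - fn2 y z) = fn2 (x - y)"
  "(\<lambda>z. c * fn2 x z) = fn2 (sc c x)" "fn2 0 = (\<lambda>_. 0)"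
  by (auto simp: fn2_def ip_add_left ip_diff_left ip_sc_left fun_eq_iff)

lemma fn1_diff: "fn1 (x - y) z = fn1 x z - fn1 y z"
  by (simp add: fn1_def ip_diff_left)

lemma ell2_of_square_summable:
  assumes "(\<lambda>i. (norm (a i))\<^sup>2) summable_on UNIV"
  obtains x where "ell2_coef x = a"
  using assms Abs_ell2_inverse by blast

lemma fn1_inject: "fn1 x = fn1 y \<longleftrightarrow> x = y"
proof
  assume "fn1 x = fn1 y"
  then have "fn1 (x - y) z = 0" for z
    by (simp add: fn1_diff)
  then have "ell2_coef (x - y) k = 0" for k
    using fn1_has_sum[of _ "x - y"] by (intro power_series_zero_imp) auto
  then show "x = y" by (intro ell2_eqI) (simp)
qed simp

text \<open>For fixed z_2, summing over the second index first leaves a power series in z_1 whose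
  coefficients are the row sums. These vanish, and each row is in turn a power series in z_2 that
  vanishes.\<close>

lemma double_power_series_zero_imp:
  fixes a :: "nat \<times> nat \<Rightarrow> complex"
  assumes "\<And>z1 z2. norm z1 < 1 \<Longrightarrow> norm z2 < 1 \<Longrightarrow> ((\<lambda>(j, k). a (j, k) * z1 ^ j * z2 ^ k) has_sum 0) UNIV"
  shows "a (j, k) = 0"
proof (rule power_series_zero_imp)
  fix z2 :: complex assume z2: "norm z2 < 1"
  define b where "b = (\<lambda>z1 j k. a (j, k) * z1 ^ j * z2 ^ k)"
  have sum: "((\<lambda>(j, k). b z1 j k) has_sum 0) (Sigma UNIV (\<lambda>_. UNIV))" if "norm z1 < 1" for z1
    using assms[OF that z2] by (simp add: b_def)
  have row: "(\<lambda>k. a (j, k) * z2 ^ k) summable_on UNIV" for j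
  proof -
    \<comment> \<open>A nonzero value of z_1 isolates a row: at 1/2 the factor z_1^j is removed by
      multiplying with 2^j.\<close>
    have "(\<lambda>(j, k). b (1/2) j k) summable_on (Sigma UNIV (\<lambda>_. UNIV))"
      using sum[of "1/2"] has_sum_imp_summable by force
    then have "(\<lambda>k. b (1/2) j k) summable_on UNIV"
      using summable_on_SigmaD1[of "b (1/2)" UNIV "\<lambda>_. UNIV" j] by simp
    then have "(\<lambda>k. 2 ^ j * b (1/2) j k) summable_on UNIV"
      by (rule summable_on_cmult_right)
    then show ?thesis by (simp add: b_def field_simps power_divide)
  qed
  have "((\<lambda>j. (\<Sum>\<^sub>\<infinity>k. a (j, k) * z2 ^ k) * z1 ^ j) has_sum 0) UNIV" if "norm z1 < 1" for z1
  proof (rule has_sum_SigmaD[OF sum[OF that]])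
    fix j
    show "((\<lambda>k. case (j, k) of (j, k) \<Rightarrow> b z1 j k) has_sum (\<Sum>\<^sub>\<infinity>k. a (j, k) * z2 ^ k) * z1 ^ j) UNIV"
      using has_sum_cmult_left[OF has_sum_infsum[OF row[of j]], of "z1 ^ j"] by (simp add: b_def mult_ac)
  qed
  then have "(\<Sum>\<^sub>\<infinity>k. a (j, k) * z2 ^ k) = 0"
    by (rule power_series_zero_imp)
  then show "((\<lambda>k. a (j, k) * z2 ^ k) has_sum 0) UNIV"
    using has_sum_infsum[OF row[of j]] by simp
qed

lemma fn2_inject: "fn2 x = fn2 y \<longleftrightarrow> x = y"
proof
  assume "fn2 x = fn2 y"
  then have "fn2 (x - y) z = 0" for z
    unfolding fn2_linear(2)[symmetric] by simp
  then have "ell2_coef (x - y) (j, k) = 0" for j k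
    using fn2_has_sum[of _ _ "x - y"] by (intro double_power_series_zero_imp) auto
  then show "x = y" by (intro ell2_eqI) auto
qed simp

text \<open>Uniqueness of the coefficients pins down the \<open>SOME\<close> in
  \<open>h2coef\<close>, so that \<open>h2inner\<close> and \<open>h2norm\<close> of functions
  \<open>fn2 x\<close> reduce to \<open>ip\<close> and \<open>norm\<close>.\<close>

lemma H2rep_fn2: "H2rep (fn2 x) a \<longleftrightarrow> a = ell2_coef x"
proof
  assume "a = ell2_coef x"
  then show "H2rep (fn2 x) a"
    using fn2_has_sum[of _ _ x] ell2_square_summable[of x] by (auto simp: H2rep_def)
next
  assume a: "H2rep (fn2 x) a"
  then obtain y where y: "ell2_coef y = a"
    unfolding H2rep_def using ell2_of_square_summable by blast
  have "fn2 y z = fn2 x z" for z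
  proof (cases "z \<in> bidisk")
    case True
    then show ?thesis
      using a by (cases z) (auto simp: H2rep_def y intro!: fn2_eqI)
  qed (simp add: fn2_def)
  then show "a = ell2_coef x" using y fn2_inject by (metis ext)
qed

lemma H2_eq: "H2 = range fn2"
proof
  show "range fn2 \<subseteq> H2"
    unfolding H2_def using H2rep_fn2 by (auto simp: fn2_def)
  show "H2 \<subseteq> range fn2"
  proof
    fix f assume "f \<in> H2"
    then obtain a where a: "H2rep f a" "\<And>z. z \<notin> bidisk \<Longrightarrow> f z = 0"
      unfolding H2_def by blast
    then obtain y where y: "ell2_coef y = a"
      unfolding H2rep_def using ell2_of_square_summable by blast
    have "f z = fn2 y z" for z
    proof (cases "z \<in> bidisk")
      case True
      then show ?thesis
        using a(1) by (cases z) (auto simp: H2rep_def y intro!: fn2_eqI[symmetric])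
    qed (simp add: a fn2_def)
    then show "f \<in> range fn2" by blast
  qed
qed

lemma h2coef_fn2: "h2coef (fn2 x) = ell2_coef x"
  by (simp add: h2coef_def H2rep_fn2)

lemma h2inner_fn2: "h2inner (fn2 x) (fn2 y) = ip x y"
  by (simp add: h2inner_def h2coef_fn2 ip_def)

lemma h2norm_fn2: "h2norm (fn2 x) = norm x"
  by (simp add: h2norm_def h2inner_fn2 norm_ell2_def inner_ell2_def)

lemma H2rep1_fn1: "H2rep1 (fn1 x) a \<longleftrightarrow> a = ell2_coef x"
proof
  assume "a = ell2_coef x"
  then show "H2rep1 (fn1 x) a"
    using fn1_has_sum[of _ x] ell2_square_summable[of x] by (auto simp: H2rep1_def)
next
  assume a: "H2rep1 (fn1 x) a"
  then obtain y where y: "ell2_coef y = a"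
    unfolding H2rep1_def using ell2_of_square_summable by blast
  have "fn1 y z = fn1 x z" for z
  proof (cases "norm z < 1")
    case True
    then show ?thesis
      using a by (auto simp: H2rep1_def y intro!: fn1_eqI)
  qed (simp add: fn1_def)
  then show "a = ell2_coef x" using y fn1_inject by (metis ext)
qed

lemma H2one_eq: "H2one = range fn1"
proof
  show "range fn1 \<subseteq> H2one"
    unfolding H2one_def using H2rep1_fn1 by (auto simp: fn1_def)
  show "H2one \<subseteq> range fn1"
  proof
    fix f assume "f \<in> H2one"
    then obtain a where a: "H2rep1 f a" "\<And>z. z \<notin> ball 0 1 \<Longrightarrow> f z = 0"
      unfolding H2one_def by blast
    then obtain y where y: "ell2_coef y = a"
      unfolding H2rep1_def using ell2_of_square_summable by blast
    have "f z = fn1 y z" for z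
    proof (cases "norm z < 1")
      case True
      then show ?thesis
        using a(1) by (auto simp: H2rep1_def y intro!: fn1_eqI[symmetric])
    qed (simp add: a fn1_def)
    then show "f \<in> range fn1" by blast
  qed
qed

lemma h2inner1_fn1: "h2inner1 (fn1 x) (fn1 y) = ip x y"
  by (simp add: h2inner1_def h2coef1_def H2rep1_fn1 ip_def)

lemma fn2_sum: "(\<lambda>z. \<Sum>i\<in>A. fn2 (f i) z) = fn2 (\<Sum>i\<in>A. f i)"
  by (auto simp: fn2_def ip_sum_left fun_eq_iff)

text \<open>\<open>closed_subspace\<close> speaks of \<open>h2norm\<close>-convergent sequences with
  limit in \<open>H2\<close>. Through \<open>fn2\<close> this becomes topological closedness of the
  coefficient set, the form that orthogonal projection and the Wold decomposition take as
  input.\<close>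

lemma closed_subspace_preimage:
  assumes "closed_subspace S"
  shows "csubspace {x. fn2 x \<in> S}" "closed {x. fn2 x \<in> S}" "S = fn2 ` {x. fn2 x \<in> S}"
proof -
  show "csubspace {x. fn2 x \<in> S}"
    using assms by (auto simp: closed_subspace_def csubspace_def simp flip: fn2_linear)
  show "S = fn2 ` {x. fn2 x \<in> S}"
    using assms unfolding closed_subspace_def H2_eq by auto
  show "closed {x. fn2 x \<in> S}"
    unfolding closed_sequential_limits
  proof (intro allI impI)
    fix s l assume "(\<forall>n. s n \<in> {x. fn2 x \<in> S}) \<and> s \<longlonglongrightarrow> l"
    then have s: "\<And>n. fn2 (s n) \<in> S" "s \<longlonglongrightarrow> l" by auto
    have "(\<lambda>n. h2norm (\<lambda>z. fn2 (s n) z - fn2 l z)) \<longlonglongrightarrow> 0"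
      unfolding fn2_linear h2norm_fn2 using s(2) by (simp add: LIM_zero_iff tendsto_norm_zero_iff)
    moreover have "fn2 l \<in> H2" by (simp add: H2_eq)
    ultimately have "fn2 l \<in> S"
      using assms s(1) unfolding closed_subspace_def by (elim conjE allE[of _ "\<lambda>n. fn2 (s n)"]) blast
    then show "l \<in> {x. fn2 x \<in> S}" by simp
  qed
qed

section \<open>Shifts\<close>

lemma has_sum_push:
  assumes "inj h" "\<And>y. y \<notin> range h \<Longrightarrow> b y = 0"
  shows "(b has_sum s) UNIV \<longleftrightarrow> ((\<lambda>x. b (h x)) has_sum s) UNIV"
proof -
  have "(b has_sum s) UNIV \<longleftrightarrow> (b has_sum s) (range h)"
    by (rule has_sum_cong_neutral) (use assms in auto)
  also have "\<dots> \<longleftrightarrow> ((\<lambda>x. b (h x)) has_sum s) UNIV"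
    using has_sum_reindex[OF assms(1)] by (simp add: o_def)
  finally show ?thesis .
qed

lemma inj_Suc_fst: "inj (\<lambda>x :: nat \<times> nat. (Suc (fst x), snd x))"
  and inj_Suc_snd: "inj (\<lambda>x :: nat \<times> nat. (fst x, Suc (snd x)))"
  by (auto simp: inj_def)

lemma has_sum_Suc_fst:
  fixes b :: "nat \<times> nat \<Rightarrow> 'a :: {comm_monoid_add, topological_space}"
  assumes "\<And>k. b (0, k) = 0"
  shows "(b has_sum s) UNIV \<longleftrightarrow> ((\<lambda>x. b (Suc (fst x), snd x)) has_sum s) UNIV"
proof (rule has_sum_push[OF inj_Suc_fst])
  fix y :: "nat \<times> nat"
  assume "y \<notin> range (\<lambda>x. (Suc (fst x), snd x))"
  then have "y \<noteq> (Suc (fst (fst y - 1, snd y)), snd (fst y - 1, snd y))" by blast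
  then show "b y = 0" using assms by (cases y, cases "fst y") auto
qed

lemma has_sum_Suc_snd:
  fixes b :: "nat \<times> nat \<Rightarrow> 'a :: {comm_monoid_add, topological_space}"
  assumes "\<And>j. b (j, 0) = 0"
  shows "(b has_sum s) UNIV \<longleftrightarrow> ((\<lambda>x. b (fst x, Suc (snd x))) has_sum s) UNIV"
proof (rule has_sum_push[OF inj_Suc_snd])
  fix y :: "nat \<times> nat"
  assume "y \<notin> range (\<lambda>x. (fst x, Suc (snd x)))"
  then have "y \<noteq> (fst (fst y, snd y - 1), Suc (snd (fst y, snd y - 1)))" by blast
  then show "b y = 0" using assms by (cases y, cases "snd y") auto
qed

lift_definition shift1 :: "(nat \<times> nat) ell2 \<Rightarrow> (nat \<times> nat) ell2"
  is "\<lambda>a jk. if fst jk = 0 then 0 else a (fst jk - 1, snd jk)"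
proof -
  fix a :: "nat \<times> nat \<Rightarrow> complex"
  assume "(\<lambda>i. (norm (a i))\<^sup>2) summable_on UNIV"
  then show "(\<lambda>i. (norm (if fst i = 0 then 0 else a (fst i - 1, snd i)))\<^sup>2) summable_on UNIV"
    unfolding summable_on_def by (subst has_sum_Suc_fst) auto
qed

lift_definition shift2 :: "(nat \<times> nat) ell2 \<Rightarrow> (nat \<times> nat) ell2"
  is "\<lambda>a jk. if snd jk = 0 then 0 else a (fst jk, snd jk - 1)"
proof -
  fix a :: "nat \<times> nat \<Rightarrow> complex"
  assume "(\<lambda>i. (norm (a i))\<^sup>2) summable_on UNIV"
  then show "(\<lambda>i. (norm (if snd i = 0 then 0 else a (fst i, snd i - 1)))\<^sup>2) summable_on UNIV"
    unfolding summable_on_def by (subst has_sum_Suc_snd) auto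
qed

lift_definition bshift1 :: "(nat \<times> nat) ell2 \<Rightarrow> (nat \<times> nat) ell2"
  is "\<lambda>a jk. a (Suc (fst jk), snd jk)"
proof -
  fix a :: "nat \<times> nat \<Rightarrow> complex"
  assume "(\<lambda>i. (norm (a i))\<^sup>2) summable_on UNIV"
  then have "(\<lambda>i. (norm (a i))\<^sup>2) summable_on range (\<lambda>x. (Suc (fst x), snd x))"
    by (rule summable_on_subset) auto
  then show "(\<lambda>i. (norm (a (Suc (fst i), snd i)))\<^sup>2) summable_on UNIV"
    by (subst (asm) summable_on_reindex[OF inj_Suc_fst]) (auto simp: o_def)
qed

lemma shift_coefs [simp]:
  "ell2_coef (shift1 x) jk = (if fst jk = 0 then 0 else ell2_coef x (fst jk - 1, snd jk))"
  "ell2_coef (shift2 x) jk = (if snd jk = 0 then 0 else ell2_coef x (fst jk, snd jk - 1))"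
  "ell2_coef (bshift1 x) jk = ell2_coef x (Suc (fst jk), snd jk)"
  by (transfer; simp)+

lemma ip_shift1_bshift1: "ip (shift1 x) y = ip x (bshift1 y)"
proof -
  have "((\<lambda>i. ell2_coef (shift1 x) i * cnj (ell2_coef y i)) has_sum ip x (bshift1 y)) UNIV"
    by (subst has_sum_Suc_fst) (simp_all add: ip_def ell2_ip_summable[of x "bshift1 y", simplified])
  then show ?thesis unfolding ip_def[of "shift1 x"] by (rule infsumI)
qed

lemma ip_shift2: "ip (shift2 x) (shift2 y) = ip x y"
proof -
  have "((\<lambda>i. ell2_coef (shift2 x) i * cnj (ell2_coef (shift2 y) i)) has_sum ip x y) UNIV"
    by (subst has_sum_Suc_snd) (simp_all add: ip_def ell2_ip_summable)
  then show ?thesis unfolding ip_def[of "shift2 x"] by (rule infsumI)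
qed

lemma bshift1_shift2: "bshift1 (shift2 x) = shift2 (bshift1 x)"
  by (rule ell2_eqI) auto

lemma fn2_shift1: "fn2 (shift1 x) = Mz1 (fn2 x)"
proof
  fix z :: "complex \<times> complex"
  obtain z1 z2 where z: "z = (z1, z2)" by (cases z)
  show "fn2 (shift1 x) z = Mz1 (fn2 x) z"
  proof (cases "z \<in> bidisk")
    case True
    then have b: "norm z1 < 1" "norm z2 < 1" by (auto simp: z)
    have "((\<lambda>(j, k). ell2_coef (shift1 x) (j, k) * z1 ^ j * z2 ^ k) has_sum z1 * fn2 x z) UNIV"
      using has_sum_cmult_right[OF fn2_has_sum[OF b, of x], of z1]
      by (subst has_sum_Suc_fst) (auto simp: case_prod_beta z mult_ac)
    then show ?thesis
      using fn2_eqI[OF b] by (simp add: Mz1_def z)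
  qed (simp add: Mz1_def fn2_def)
qed

lemma fn2_shift2: "fn2 (shift2 x) = Mz2 (fn2 x)"
proof
  fix z :: "complex \<times> complex"
  obtain z1 z2 where z: "z = (z1, z2)" by (cases z)
  show "fn2 (shift2 x) z = Mz2 (fn2 x) z"
  proof (cases "z \<in> bidisk")
    case True
    then have b: "norm z1 < 1" "norm z2 < 1" by (auto simp: z)
    have "((\<lambda>(j, k). ell2_coef (shift2 x) (j, k) * z1 ^ j * z2 ^ k) has_sum z2 * fn2 x z) UNIV"
      using has_sum_cmult_right[OF fn2_has_sum[OF b, of x], of z2]
      by (subst has_sum_Suc_snd) (auto simp: case_prod_beta z mult_ac)
    then show ?thesis
      using fn2_eqI[OF b] by (simp add: Mz2_def z)
  qed (simp add: Mz2_def fn2_def)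
qed

text \<open>Everything in the range of the k-th power has vanishing coefficients below z_2^k, so a
  vector in all these ranges has none left. This purity excludes a unitary part in the Wold
  decomposition.\<close>

lemma shift2_pure:
  assumes "\<And>k. \<exists>y. x = (shift2 ^^ k) y"
  shows "x = 0"
proof (rule ell2_eqI)
  have coef0: "ell2_coef ((shift2 ^^ n) y) (j, k) = 0" if "k < n" for n y j k
    using that by (induction n arbitrary: k) auto
  fix i :: "nat \<times> nat"
  obtain y where "x = (shift2 ^^ Suc (snd i)) y" using assms by blast
  then show "ell2_coef x i = ell2_coef 0 i" using coef0[of "snd i" "Suc (snd i)" y "fst i"] by simp
qed

text \<open>Subtracting z_1 L x from x leaves only the coefficients with j = 0, a function of z_2
  alone. Thus L is the difference quotient in z_1, from which the linear system for the symbol is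
  derived.\<close>

lemma fn2_bshift1:
  assumes "norm z1 < 1" "norm z2 < 1"
  shows "z1 * fn2 (bshift1 x) (z1, z2) = fn2 x (z1, z2) - fn2 x (0, z2)"
proof -
  define y where "y = x - shift1 (bshift1 x)"
  have "ell2_coef y (j, k) = (if j = 0 then ell2_coef x (0, k) else 0)" for j k
    by (simp add: y_def)
  then have "(\<lambda>(j, k). ell2_coef y (j, k) * z1 ^ j * z2 ^ k) = (\<lambda>(j, k). ell2_coef y (j, k) * 0 ^ j * z2 ^ k)"
    by (auto simp: fun_eq_iff)
  then have "fn2 y (z1, z2) = fn2 y (0, z2)"
    using fn2_has_sum[of 0 z2 y] assms by (intro fn2_eqI) auto
  moreover have "fn2 y (w, z2) = fn2 x (w, z2) - w * fn2 (bshift1 x) (w, z2)" for w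
    unfolding y_def fn2_linear(2)[symmetric] fn2_shift1 by (simp add: Mz1_def)
  ultimately have "fn2 x (z1, z2) - z1 * fn2 (bshift1 x) (z1, z2) = fn2 x (0, z2) - 0 * fn2 (bshift1 x) (0, z2)"
    by metis
  then show ?thesis by (simp add: algebra_simps)
qed

section \<open>Parseval on the circle\<close>

text \<open>A boundary series on the circle. With absolutely summable coefficients, as for a Hardy
  function dilated by r < 1, it converges uniformly, so the integrals are first computed for
  continuous functions.\<close>

definition tser :: "(nat \<Rightarrow> complex) \<Rightarrow> real \<Rightarrow> complex" where
  "tser a t = (\<Sum>j. a j * cis t ^ j)"

lemma integral_cis_int:
  fixes k :: int
  shows "integral\<^sup>L (lebesgue_on {0..2*pi}) (\<lambda>t. cis (of_int k * t)) = (if k = 0 then 2 * pi else 0)"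
proof -
  have "integral\<^sup>L (lebesgue_on {0..2*pi}) (\<lambda>t. cis (of_int k * t)) = integral {0..2*pi} (\<lambda>t. cis (of_int k * t))"
    by (intro lebesgue_integral_eq_integral continuous_imp_integrable_real continuous_intros) auto
  also have "\<dots> = (if k = 0 then 2 * pi else 0)"
  proof (cases "k = 0")
    case False
    define c where "c = \<i> * of_int k"
    have c: "c \<noteq> 0" using False by (simp add: c_def)
    have "((\<lambda>t. exp (c * of_real t)) has_integral exp (c * of_real (2*pi)) / c - exp (c * of_real 0) / c) {0..2*pi}"
    proof (rule fundamental_theorem_of_calculus)
      fix x :: real
      have "((\<lambda>z. exp (c * z) / c) has_field_derivative exp (c * of_real x)) (at (of_real x))"
        using c by (auto intro!: derivative_eq_intros)
      then show "((\<lambda>t. exp (c * of_real t) / c) has_vector_derivative exp (c * of_real x)) (at x within {0..2*pi})"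
        by (rule has_vector_derivative_real_field)
    qed simp
    moreover have "exp (c * of_real (2*pi)) = 1"
      unfolding exp_eq_1 by (auto simp: c_def intro!: exI[of _ k])
    moreover have "exp (c * of_real t) = cis (of_int k * t)" for t
      by (simp add: c_def cis_conv_exp mult.assoc)
    ultimately show ?thesis using False by (simp add: integral_unique)
  qed (simp add: scaleR_conv_of_real)
  finally show ?thesis .
qed

lemma integral_cis_powers:
  "integral\<^sup>L (lebesgue_on {0..2*pi}) (\<lambda>t. cis t ^ j * cnj (cis t ^ l)) = (if j = l then 2 * pi else 0)"
proof -
  have "cis t ^ j * cnj (cis t ^ l) = cis (of_int (int j - int l) * t)" for t
  proof -
    have "cis t ^ j * cnj (cis t ^ l) = cis (real j * t + - (real l * t))"
      by (simp only: Complex.DeMoivre cis_cnj cis_mult)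
    also have "real j * t + - (real l * t) = of_int (int j - int l) * t" by (simp add: algebra_simps)
    finally show ?thesis .
  qed
  then show ?thesis using integral_cis_int[of "int j - int l"] by simp
qed

lemma tser_sums:
  assumes "summable (\<lambda>j. norm (a j))"
  shows "(\<lambda>j. a j * cis t ^ j) sums tser a t"
  unfolding tser_def
  by (rule summable_sums, rule summable_norm_cancel) (use assms in \<open>simp add: norm_mult norm_power\<close>)

lemma continuous_on_tser:
  assumes "summable (\<lambda>j. norm (a j))"
  shows "continuous_on A (tser a)"
proof (rule uniform_limit_theorem[where f = "\<lambda>n t. \<Sum>j<n. a j * cis t ^ j"])
  show "\<forall>\<^sub>F n in sequentially. continuous_on A (\<lambda>t. \<Sum>j<n. a j * cis t ^ j)"
    by (intro always_eventually allI continuous_intros)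
  show "uniform_limit A (\<lambda>n t. \<Sum>j<n. a j * cis t ^ j) (tser a) sequentially"
    unfolding tser_def by (rule Weierstrass_m_test[OF _ assms]) (simp add: norm_mult norm_power)
qed simp

lemma integrable_circle:
  assumes "continuous_on {0..2*pi} (f :: real \<Rightarrow> complex)"
  shows "integrable (lebesgue_on {0..2*pi}) f"
  using assms by (rule continuous_imp_integrable_real)

text \<open>Termwise integration, justified because the L^1 norms of the terms are |a_j| times that
  of g and hence summable.\<close>

lemma integral_tser_mult:
  assumes a: "summable (\<lambda>j. norm (a j))" and g: "continuous_on {0..2*pi} g"
  shows "integral\<^sup>L (lebesgue_on {0..2*pi}) (\<lambda>t. tser a t * g t)
    = (\<Sum>j. a j * integral\<^sup>L (lebesgue_on {0..2*pi}) (\<lambda>t. cis t ^ j * g t))"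
proof -
  let ?M = "lebesgue_on {0..2*pi}"
  have int: "integrable ?M (\<lambda>t. a j * (cis t ^ j * g t))" for j
    by (intro integrable_circle continuous_intros g)
  have "integral\<^sup>L ?M (\<lambda>t. \<Sum>j. a j * (cis t ^ j * g t)) = (\<Sum>j. integral\<^sup>L ?M (\<lambda>t. a j * (cis t ^ j * g t)))"
  proof (rule integral_suminf[OF int])
    have "summable (\<lambda>j. norm (a j * (cis t ^ j * g t)))" for t
      using summable_mult2[OF a, of "norm (g t)"] by (simp add: norm_mult norm_power)
    then show "AE t in ?M. summable (\<lambda>j. norm (a j * (cis t ^ j * g t)))" by simp
    have "(\<lambda>j. integral\<^sup>L ?M (\<lambda>t. norm (a j * (cis t ^ j * g t)))) = (\<lambda>j. norm (a j) * integral\<^sup>L ?M (\<lambda>t. norm (g t)))"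
      by (simp add: norm_mult norm_power)
    then show "summable (\<lambda>j. integral\<^sup>L ?M (\<lambda>t. norm (a j * (cis t ^ j * g t))))"
      using summable_mult2[OF a] by simp
  qed
  moreover have "(\<Sum>j. a j * (cis t ^ j * g t)) = tser a t * g t" for t
    using sums_mult2[OF tser_sums[OF a], of t "g t"] by (simp add: mult.assoc sums_iff)
  ultimately show ?thesis by simp
qed

lemma summable_mult_cnj:
  fixes a b :: "nat \<Rightarrow> complex"
  assumes a: "summable (\<lambda>j. norm (a j))" and b: "summable (\<lambda>j. norm (b j))"
  shows "summable (\<lambda>j. a j * cnj (b j))"
proof -
  have "Bseq b"
    using b summable_LIMSEQ_zero summable_norm_cancel convergent_imp_Bseq convergentI by blast
  then obtain K where K: "\<And>j. norm (b j) \<le> K" by (auto simp: Bseq_def)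
  have "summable (\<lambda>j. norm (a j * cnj (b j)))"
    by (rule summable_comparison_test'[OF summable_mult2[OF a, of K], of 0])
      (simp add: norm_mult mult_left_mono K)
  then show ?thesis by (rule summable_norm_cancel)
qed

lemma summable_square_of_summable:
  fixes a :: "nat \<Rightarrow> complex"
  assumes "summable (\<lambda>j. norm (a j))"
  shows "summable (\<lambda>j. (norm (a j))\<^sup>2)"
proof -
  have "summable (\<lambda>j. of_real ((norm (a j))\<^sup>2) :: complex)"
    unfolding complex_norm_square by (rule summable_mult_cnj[OF assms assms])
  then show ?thesis by (simp only: summable_of_real_iff)
qed

lemma parseval:
  assumes a: "summable (\<lambda>j. norm (a j))" and b: "summable (\<lambda>j. norm (b j))"
  shows "integral\<^sup>L (lebesgue_on {0..2*pi}) (\<lambda>t. tser a t * cnj (tser b t)) = 2 * pi * (\<Sum>j. a j * cnj (b j))"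
proof -
  let ?M = "lebesgue_on {0..2*pi}"
  have "integral\<^sup>L ?M (\<lambda>t. cis t ^ j * cnj (tser b t)) = 2 * pi * cnj (b j)" for j
  proof -
    have "integral\<^sup>L ?M (\<lambda>t. tser b t * cnj (cis t ^ j)) = (\<Sum>l. b l * (if l = j then 2 * pi else 0))"
      by (subst integral_tser_mult[OF b]) (auto simp: integral_cis_powers simp del: complex_cnj_power intro!: continuous_intros)
    also have "\<dots> = b j * (2 * pi)"
      using sums_unique[OF sums_single[of j "\<lambda>l. b l * (2 * pi)"]] by (simp add: if_distrib cong: if_cong)
    finally have "cnj (integral\<^sup>L ?M (\<lambda>t. tser b t * cnj (cis t ^ j))) = cnj (b j * (2 * pi))" by simp
    then show ?thesis
      unfolding Bochner_Integration.integral_cnj[symmetric] by (simp add: mult_ac)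
  qed
  then have "integral\<^sup>L ?M (\<lambda>t. tser a t * cnj (tser b t)) = (\<Sum>j. (2 * pi) * (a j * cnj (b j)))"
    by (subst integral_tser_mult[OF a]) (auto intro!: continuous_intros continuous_on_tser b simp: mult_ac)
  also have "\<dots> = 2 * pi * (\<Sum>j. a j * cnj (b j))"
    by (rule suminf_mult) (rule summable_mult_cnj[OF a b])
  finally show ?thesis .
qed

lemma parseval_norm:
  assumes a: "summable (\<lambda>j. norm (a j))"
  shows "integral\<^sup>L (lebesgue_on {0..2*pi}) (\<lambda>t. (norm (tser a t))\<^sup>2) = 2 * pi * (\<Sum>j. (norm (a j))\<^sup>2)"
proof -
  have "complex_of_real (integral\<^sup>L (lebesgue_on {0..2*pi}) (\<lambda>t. (norm (tser a t))\<^sup>2))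
      = integral\<^sup>L (lebesgue_on {0..2*pi}) (\<lambda>t. tser a t * cnj (tser a t))"
    unfolding complex_norm_square[symmetric] by (rule integral_complex_of_real[symmetric])
  also have "\<dots> = 2 * pi * (\<Sum>j. a j * cnj (a j))" by (rule parseval[OF a a])
  also have "(\<Sum>j. a j * cnj (a j)) = of_real (\<Sum>j. (norm (a j))\<^sup>2)"
    unfolding complex_norm_square[symmetric]
    by (rule suminf_of_real[symmetric]) (rule summable_square_of_summable[OF a])
  finally show ?thesis by (metis of_real_eq_iff of_real_mult of_real_numeral)
qed

text \<open>Pointwise AM-GM \<open>2 B \<bar>h\<bar> \<le> B\<^sup>2 + \<bar>h\<bar>\<^sup>2\<close> replaces the Cauchy-Schwarz inequality.\<close>
lemma tser_L1_le:
  assumes a: "summable (\<lambda>j. norm (a j))" and B: "(\<Sum>j. (norm (a j))\<^sup>2) \<le> B\<^sup>2" "B > 0"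
  shows "integral\<^sup>L (lebesgue_on {0..2*pi}) (\<lambda>t. norm (tser a t)) \<le> 2 * pi * B"
proof -
  let ?M = "lebesgue_on {0..2*pi}"
  have int: "integrable ?M (\<lambda>t. (norm (tser a t))\<^sup>2)" "integrable ?M (\<lambda>t. norm (tser a t))"
    by (auto intro!: continuous_imp_integrable_real continuous_intros continuous_on_tser a)
  have "integral\<^sup>L ?M (\<lambda>t. norm (tser a t)) \<le> integral\<^sup>L ?M (\<lambda>t. B / 2 + (norm (tser a t))\<^sup>2 / (2 * B))"
  proof (rule integral_mono)
    fix t
    have "0 \<le> (B - norm (tser a t))\<^sup>2" by simp
    then have "2 * B * norm (tser a t) \<le> B * B + (norm (tser a t))\<^sup>2"
      by (simp add: power2_eq_square algebra_simps)
    then show "norm (tser a t) \<le> B / 2 + (norm (tser a t))\<^sup>2 / (2 * B)"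
      using B(2) by (simp add: field_simps)
  qed (auto intro!: continuous_imp_integrable_real continuous_intros continuous_on_tser a simp: B(2)[THEN less_imp_neq, symmetric])
  also have "\<dots> = integral\<^sup>L ?M (\<lambda>t. B / 2) + integral\<^sup>L ?M (\<lambda>t. (norm (tser a t))\<^sup>2) / (2 * B)"
    using int by (subst Bochner_Integration.integral_add) auto
  also have "\<dots> = pi * B + 2 * pi * (\<Sum>j. (norm (a j))\<^sup>2) / (2 * B)"
    by (simp add: parseval_norm[OF a] measure_restrict_space)
  also have "\<dots> \<le> pi * B + 2 * pi * B\<^sup>2 / (2 * B)"
    using B by (intro add_left_mono divide_right_mono mult_left_mono) auto
  also have "\<dots> = 2 * pi * B" using B by (simp add: power2_eq_square)
  finally show ?thesis .
qed

section \<open>The Poisson formula and the maximal inequality\<close>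

definition poisson :: "real \<Rightarrow> real \<Rightarrow> real" where
  "poisson r s = (1 - r\<^sup>2) / (1 - 2 * r * cos s + r\<^sup>2)"

lemma poisson_denominator_pos:
  fixes r s :: real
  assumes "0 \<le> r" "r < 1"
  shows "0 < 1 - 2 * r * cos s + r\<^sup>2"
proof -
  have "0 < (1 - r)\<^sup>2" using assms by (intro zero_less_power) simp
  also have "\<dots> \<le> 1 - 2 * r * cos s + r\<^sup>2"
    using mult_left_mono[OF cos_le_one, of r s] assms by (simp add: power2_eq_square algebra_simps)
  finally show ?thesis .
qed

lemma poisson_nonneg: "0 \<le> r \<Longrightarrow> r < 1 \<Longrightarrow> 0 \<le> poisson r s"
  using poisson_denominator_pos[of r s] by (simp add: poisson_def power_le_one less_imp_le)

lemma continuous_on_poisson: "0 \<le> r \<Longrightarrow> r < 1 \<Longrightarrow> continuous_on A (poisson r)"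
  unfolding poisson_def using poisson_denominator_pos[of r] by (intro continuous_intros) (metis less_irrefl)

text \<open>Cauchy's formula at w = r for g(w) = h(w e^{it}) (1 - r^2)/(1 - r w): the extra factor
  equals 1 at w = r and turns the Cauchy kernel on the circle into the Poisson kernel.\<close>

lemma poisson_formula:
  fixes h :: "complex \<Rightarrow> complex" and r t :: real
  assumes h: "h holomorphic_on cball 0 1" and r: "0 \<le> r" "r < 1"
  shows "((\<lambda>s. h (cis (t + s)) * poisson r s) has_integral 2 * pi * h (r * cis t)) {0..2*pi}"
proof -
  define g where "g w = h (w * cis t) * (1 - of_real (r\<^sup>2)) / (1 - of_real r * w)" for w :: complex
  have nz: "1 - of_real r * w \<noteq> 0" if "norm w \<le> 1" for w :: complex
  proof
    assume "1 - of_real r * w = 0"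
    then have "1 = norm (of_real r * w)" by (metis eq_iff_diff_eq_0 norm_one)
    also have "\<dots> \<le> r * 1" using r that unfolding norm_mult by (intro mult_mono) auto
    finally show False using r by simp
  qed
  have "(\<lambda>w. h (w * cis t)) holomorphic_on cball 0 1"
    by (rule holomorphic_on_compose_gen[OF _ h, unfolded o_def]) (auto intro!: holomorphic_intros simp: norm_mult)
  then have "g holomorphic_on cball 0 1"
    unfolding g_def using nz by (intro holomorphic_intros) auto
  then have "((\<lambda>u. g u / (u - of_real r)) has_contour_integral (2 * of_real pi * \<i> * g (of_real r))) (circlepath 0 1)"
    using r by (intro Cauchy_integral_circlepath_simple) auto
  then have "((\<lambda>s. g (cis s) / (cis s - of_real r) * \<i> * cis s) has_integral 2 * of_real pi * \<i> * g (of_real r)) {0..2*pi}"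
    unfolding circlepath_def by (subst (asm) has_contour_integral_part_circlepath_iff) auto
  from has_integral_mult_right[OF this, of "- \<i>"]
  have "((\<lambda>s. g (cis s) * cis s / (cis s - of_real r)) has_integral 2 * of_real pi * g (of_real r)) {0..2*pi}"
    by (simp add: algebra_simps)
  moreover have "g (of_real r) = h (r * cis t)"
  proof -
    have "1 - of_real (r\<^sup>2) \<noteq> (0::complex)"
      using nz[of "of_real r"] r by (simp add: power2_eq_square)
    then show ?thesis by (simp add: g_def power2_eq_square)
  qed
  moreover have "g (cis s) * cis s / (cis s - of_real r) = h (cis (t + s)) * poisson r s" for s
  proof -
    have c: "cis s * cis (- s) = 1" by (simp add: cis_mult)
    have ne: "cis s - of_real r \<noteq> 0"
    proof
      assume "cis s - of_real r = 0"
      then have "norm (cis s) = norm (complex_of_real r)" by simp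
      then show False using r by simp
    qed
    have "(1 - of_real r * cis s) * (cis s - of_real r)
        = cis s * ((1 - of_real r * cis s) * (1 - of_real r * cis (- s)))"
    proof -
      have "cis s - of_real r = cis s * (1 - of_real r * cis (- s))"
        using c by (simp add: right_diff_distrib mult.left_commute[of "cis s"])
      then show ?thesis by (simp add: mult_ac)
    qed
    also have "(1 - of_real r * cis s) * (1 - of_real r * cis (- s)) = of_real (1 - 2 * r * cos s + r\<^sup>2)"
      by (rule complex_eqI) (simp_all add: algebra_simps power2_eq_square sin_squared_eq flip: cos_squared_eq,
          simp add: algebra_simps flip: distrib_left power2_eq_square)
    finally have *: "(1 - of_real r * cis s) * (cis s - of_real r) = cis s * of_real (1 - 2 * r * cos s + r\<^sup>2)"
      .
    have "g (cis s) * cis s / (cis s - of_real r)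
        = h (cis (t + s)) * of_real (1 - r\<^sup>2) * cis s / ((1 - of_real r * cis s) * (cis s - of_real r))"
      by (simp add: g_def cis_mult add.commute)
    also have "\<dots> = h (cis (t + s)) * poisson r s"
      unfolding * by (simp add: poisson_def)
    finally show ?thesis .
  qed
  ultimately show ?thesis by simp
qed

text \<open>The Poisson kernel decreases on [0, pi], so a Poisson average is a mixture of averages
  over symmetric windows around t and inherits their common bound. The mixture is realised by the
  second mean value theorem for \<open>B\<close>, whose integrals over [0, u] are nonnegative by the
  hypothesis on the windows.\<close>

lemma maximal_pointwise:
  fixes h :: "complex \<Rightarrow> complex" and r t M :: real
  assumes h: "h holomorphic_on cball 0 1" and r: "0 \<le> r" "r < 1"
    and M: "\<And>u. 0 \<le> u \<Longrightarrow> u \<le> pi \<Longrightarrow> integral {t - u..t + u} (\<lambda>s. norm (h (cis s))) \<le> 2 * u * M"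
  shows "norm (h (r * cis t)) \<le> M"
proof -
  define G where "G = (\<lambda>s. norm (h (cis s)))"
  have contG: "continuous_on A G" for A
    unfolding G_def
    by (intro continuous_on_norm continuous_on_compose2[OF holomorphic_on_imp_continuous_on[OF h]] continuous_intros) auto
  have contG': "continuous_on A (\<lambda>s. G (f s))" if "continuous_on A f" for A f
    using continuous_on_compose2[OF contG[of UNIV] that] by auto
  note contP = continuous_on_poisson[OF r]
  define B where "B s = 2 * M - (G (t + s) + G (t - s))" for s
  have contB: "continuous_on A B" for A
    unfolding B_def by (intro continuous_intros contG')
  \<comment> \<open>Folding at pi reduces the full circle to [0, pi], where the cosine is monotone
    and the windows are symmetric about t.\<close>
  have halves: "integral {0..2*pi} f = integral {0..pi} (\<lambda>s. f s + f (2 * pi - s))"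
    if f: "continuous_on UNIV f" for f :: "real \<Rightarrow> real"
  proof -
    have f': "continuous_on A (\<lambda>s. f (2 * pi - s))" "continuous_on A f" for A
      using continuous_on_subset[OF f] by (auto intro!: continuous_on_compose2[OF f] continuous_intros)
    have "integral {pi..2*pi} f = integral {-(2*pi)..-pi} (\<lambda>x. f (- x))"
      by (rule Henstock_Kurzweil_Integration.integral_reflect_real[symmetric])
    also have "\<dots> = integral {0..pi} (\<lambda>s. f (2 * pi - s))"
      using integral_shift_real_ivl[of "-(2*pi)" "-(2*pi)" "-pi" "\<lambda>x. f (- x)"] by (simp add: algebra_simps)
    finally have "integral {pi..2*pi} f = integral {0..pi} (\<lambda>s. f (2 * pi - s))" .
    moreover have "integral {0..pi} f + integral {pi..2*pi} f = integral {0..2*pi} f"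
      by (rule Henstock_Kurzweil_Integration.integral_combine) (auto intro!: integrable_continuous_real f')
    moreover have "integral {0..pi} (\<lambda>s. f s + f (2 * pi - s)) = integral {0..pi} f + integral {0..pi} (\<lambda>s. f (2 * pi - s))"
      by (rule Henstock_Kurzweil_Integration.integral_add) (auto intro!: integrable_continuous_real f')
    ultimately show ?thesis by simp
  qed
  have window: "integral {t - u..t + u} G = integral {0..u} (\<lambda>s. G (t + s) + G (t - s))" if "0 \<le> u" for u
  proof -
    have "integral {t - u..t} G = integral {-t..-(t - u)} (\<lambda>x. G (- x))"
      by (rule Henstock_Kurzweil_Integration.integral_reflect_real[symmetric])
    also have "\<dots> = integral {0..u} (\<lambda>s. G (t - s))"
      using integral_shift_real_ivl[of "-t" "-t" "u - t" "\<lambda>x. G (- x)"] by (simp add: algebra_simps)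
    finally have "integral {t - u..t} G = integral {0..u} (\<lambda>s. G (t - s))" .
    moreover have "integral {t..t + u} G = integral {0..u} (\<lambda>s. G (t + s))"
      using integral_shift_real_ivl[of t t "t + u" G] by (simp add: algebra_simps)
    moreover have "integral {t - u..t} G + integral {t..t + u} G = integral {t - u..t + u} G"
      using that by (intro Henstock_Kurzweil_Integration.integral_combine integrable_continuous_real contG) auto
    moreover have "integral {0..u} (\<lambda>s. G (t + s) + G (t - s)) = integral {0..u} (\<lambda>s. G (t + s)) + integral {0..u} (\<lambda>s. G (t - s))"
      by (intro Henstock_Kurzweil_Integration.integral_add integrable_continuous_real contG' continuous_intros)
    ultimately show ?thesis by simp
  qed
  have K: "0 \<le> integral {0..u} B" if "0 \<le> u" "u \<le> pi" for u
  proof -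
    have "integral {0..u} B = integral {0..u} (\<lambda>_. 2 * M) - integral {0..u} (\<lambda>s. G (t + s) + G (t - s))"
      unfolding B_def by (intro Henstock_Kurzweil_Integration.integral_diff integrable_continuous_real contG' continuous_intros)
    moreover have "integral {t - u..t + u} G \<le> 2 * u * M" using M[OF that] by (simp add: G_def)
    ultimately show ?thesis using that by (simp add: window)
  qed
  \<comment> \<open>The mean value theorem wants an increasing weight, hence the minus sign in front
    of the kernel.\<close>
  have "\<exists>c\<in>{0..pi}. integral {0..pi} (\<lambda>s. - poisson r s * B s)
      = - poisson r 0 * integral {0..c} B + - poisson r pi * integral {c..pi} B"
  proof (rule second_mean_value_theorem[of B 0 pi "\<lambda>s. - poisson r s"])
    show "- poisson r x \<le> - poisson r y" if "0 \<le> x" "x \<le> y" "y \<le> pi" for x y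
    proof -
      have "cos y \<le> cos x" using that by (simp add: cos_monotone_0_pi_le)
      then have "1 - 2 * r * cos x + r\<^sup>2 \<le> 1 - 2 * r * cos y + r\<^sup>2"
        using r by (simp add: mult_left_mono)
      then show ?thesis
        using poisson_denominator_pos[OF r, of x] r unfolding poisson_def
        by (simp add: divide_left_mono power_le_one)
    qed
  qed (auto intro!: integrable_continuous_real contB)
  then obtain c where c: "0 \<le> c" "c \<le> pi" "integral {0..pi} (\<lambda>s. - poisson r s * B s)
      = - poisson r 0 * integral {0..c} B + - poisson r pi * integral {c..pi} B" by auto
  have split: "integral {0..c} B + integral {c..pi} B = integral {0..pi} B"
    using c by (intro Henstock_Kurzweil_Integration.integral_combine integrable_continuous_real contB) auto
  \<comment> \<open>Summation by parts: regrouped this way, the coefficients P(0) - P(pi) and P(pi)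
    are nonnegative and multiply the integrals of \<open>B\<close> over [0, c] and [0, pi].\<close>
  from c(3) have "integral {0..pi} (\<lambda>s. poisson r s * B s)
      = (poisson r 0 - poisson r pi) * integral {0..c} B + poisson r pi * (integral {0..c} B + integral {c..pi} B)"
    by (simp add: algebra_simps)
  note this[unfolded split]
  moreover have "poisson r pi \<le> poisson r 0"
    using poisson_denominator_pos[OF r, of 0] r unfolding poisson_def
    by (intro divide_left_mono mult_pos_pos add_mono) (auto simp: power_le_one)
  ultimately have "0 \<le> integral {0..pi} (\<lambda>s. poisson r s * B s)"
    using K[OF c(1,2)] K[of pi] poisson_nonneg[OF r, of pi] by simp
  also have "integral {0..pi} (\<lambda>s. poisson r s * B s)
      = M * integral {0..pi} (\<lambda>s. poisson r s + poisson r (2 * pi - s))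
        - integral {0..pi} (\<lambda>s. G (t + s) * poisson r s + G (t + (2 * pi - s)) * poisson r (2 * pi - s))"
  proof -
    have "poisson r (2 * pi - s) = poisson r s" for s by (simp add: poisson_def cos_diff)
    moreover have "G (t + (2 * pi - s)) = G (t - s)" for s
    proof -
      have "t + (2 * pi - s) = t - s + 2 * pi" by simp
      then have "cis (t + (2 * pi - s)) = cis (t - s)"
        using cis_mult[of "t - s" "2 * pi"] by (metis cis_2pi mult.right_neutral)
      then show ?thesis by (simp add: G_def)
    qed
    moreover have "integral {0..pi} (\<lambda>s. M * (poisson r s + poisson r s) - (G (t + s) * poisson r s + G (t - s) * poisson r s))
        = integral {0..pi} (\<lambda>s. M * (poisson r s + poisson r s)) - integral {0..pi} (\<lambda>s. G (t + s) * poisson r s + G (t - s) * poisson r s)"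
      by (intro Henstock_Kurzweil_Integration.integral_diff integrable_continuous_real contG' contP continuous_intros)
    ultimately show ?thesis
      by (simp add: B_def algebra_simps)
  qed
  also have "\<dots> = M * integral {0..2*pi} (poisson r) - integral {0..2*pi} (\<lambda>s. G (t + s) * poisson r s)"
    by (subst (1 2) halves) (auto intro!: continuous_intros contG' contP)
  also have "integral {0..2*pi} (poisson r) = 2 * pi"
  proof -
    have "((\<lambda>s. complex_of_real (poisson r s)) has_integral 2 * pi) {0..2*pi}"
      using poisson_formula[of "\<lambda>_. 1" r t, OF _ r] by simp
    from has_integral_Re[OF this] show ?thesis by (simp add: integral_unique)
  qed
  finally have "integral {0..2*pi} (\<lambda>s. G (t + s) * poisson r s) \<le> 2 * pi * M" by (simp add: mult_ac)
  moreover have "norm (2 * pi * h (r * cis t)) \<le> integral {0..2*pi} (\<lambda>s. G (t + s) * poisson r s)"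
    unfolding integral_unique[OF poisson_formula[OF h r], symmetric]
  proof (rule integral_norm_bound_integral)
    show "(\<lambda>s. h (cis (t + s)) * complex_of_real (poisson r s)) integrable_on {0..2 * pi}"
      using poisson_formula[OF h r] by (rule has_integral_integrable)
    show "(\<lambda>s. G (t + s) * poisson r s) integrable_on {0..2 * pi}"
      by (intro integrable_continuous_real contG' contP continuous_intros)
  qed (simp add: G_def norm_mult poisson_nonneg[OF r])
  moreover have "norm (2 * pi * h (r * cis t)) = 2 * pi * norm (h (r * cis t))" by (simp add: norm_mult)
  ultimately have "2 * pi * norm (h (r * cis t)) \<le> 2 * pi * M" by linarith
  then show ?thesis by (rule mult_left_le_imp_le) simp
qed

text \<open>By contraposition of the pointwise bound, every point of \<open>T\<close> has a window
  of radius at most pi on which the mean of |h| exceeds l. The constant 15 is 5 times 3: enlarging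
  the disjoint Vitali windows fivefold covers \<open>T\<close>, and all windows lie in
  [-2 pi, 4 pi], which is three periods.\<close>

lemma weak_type_maximal:
  fixes h :: "complex \<Rightarrow> complex" and l :: real
  assumes h: "h holomorphic_on cball 0 1" and l: "l > 0"
  defines "T \<equiv> {t \<in> {0<..<2*pi}. \<exists>r\<in>{0..<1}. norm (h (of_real r * cis t)) > l}"
  shows "T \<in> lmeasurable" "measure lebesgue T \<le> 15 / l * integral {0..2*pi} (\<lambda>s. norm (h (cis s)))"
proof -
  define G where "G = (\<lambda>s. norm (h (cis s)))"
  have conth: "continuous_on A (\<lambda>t. h (of_real r * cis t))" if "r \<in> {0..1}" for r A
    using that by (intro continuous_on_compose2[OF holomorphic_on_imp_continuous_on[OF h]] continuous_intros) (auto simp: norm_mult)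
  have contG: "continuous_on A G" for A
    unfolding G_def using conth[of 1] by (auto intro!: continuous_intros)
  have G0: "G s \<ge> 0" for s by (simp add: G_def)
  have "open T"
  proof -
    have "T = {0<..<2*pi} \<inter> (\<Union>r\<in>{0..<1}. {t. norm (h (of_real r * cis t)) > l})"
      by (auto simp: T_def)
    moreover have "open {t. norm (h (of_real r * cis t)) > l}" if "r \<in> {0..<1}" for r
      using that by (intro open_Collect_less continuous_intros conth) auto
    ultimately show ?thesis by (metis (no_types, lifting) open_Int open_UN open_greaterThanLessThan)
  qed
  moreover have "T \<subseteq> {0..2*pi}" by (auto simp: T_def)
  ultimately show T: "T \<in> lmeasurable"
    by (meson bounded_closed_interval bounded_subset lmeasurable_open)
  have "\<exists>u. 0 < u \<and> u \<le> pi \<and> 2 * u * l < integral {t - u..t + u} G" if "t \<in> T" for t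
  proof (rule ccontr)
    assume *: "\<not> ?thesis"
    have "integral {t - u..t + u} (\<lambda>s. norm (h (cis s))) \<le> 2 * u * l" if "0 \<le> u" "u \<le> pi" for u
      using * that unfolding G_def by (cases "u = 0") (auto simp: not_less)
    then have "norm (h (of_real r * cis t)) \<le> l" if "r \<in> {0..<1}" for r
      using maximal_pointwise[OF h, of r t l] that by auto
    then show False using \<open>t \<in> T\<close> by (force simp: T_def)
  qed
  then obtain u where u: "\<And>t. t \<in> T \<Longrightarrow> 0 < u t \<and> u t \<le> pi \<and> 2 * u t * l < integral {t - u t..t + u t} G"
    by metis
  obtain C where C: "countable C" "C \<subseteq> T"
     "pairwise (\<lambda>i j. disjnt (ball i (u i)) (ball j (u j))) C"
     "T \<subseteq> (\<Union>i\<in>C. ball i (5 * u i))"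
  proof (rule Vitali_covering_lemma_balls[where S = T and K = T and a = "\<lambda>t. t" and r = u and B = pi])
    show "T \<subseteq> (\<Union>t\<in>T. ball t (u t))" using u by (auto intro!: bexI)
  qed (use u that in auto)
  define I where "I = integral {0..2*pi} G"
  have big: "integral {-(2*pi)..4*pi} G = 3 * I"
  proof -
    have per: "G (x + c) = G x" if "c = 2 * pi \<or> c = - (2 * pi)" for x c
    proof -
      have "cis c = 1" using that cis_2pi cis_cnj[of "2*pi"] by auto
      then show ?thesis using cis_mult[of x c] by (simp add: G_def)
    qed
    have per': "G (x - 2 * pi) = G x" for x using per[of "-(2*pi)" x] by simp
    have "integral {-(2*pi)..0} G = I" "integral {2*pi..4*pi} G = I"
      using integral_shift_real_ivl[of 0 "2*pi" "2*pi" G] integral_shift_real_ivl[of 0 "-(2*pi)" "2*pi" G]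
      by (simp_all add: per per' I_def)
    moreover have "integral {-(2*pi)..0} G + integral {0..2*pi} G = integral {-(2*pi)..2*pi} G"
      "integral {-(2*pi)..2*pi} G + integral {2*pi..4*pi} G = integral {-(2*pi)..4*pi} G"
      by (auto intro!: Henstock_Kurzweil_Integration.integral_combine integrable_continuous_real contG)
    ultimately show ?thesis by (simp add: I_def)
  qed
  have bound: "measure lebesgue (\<Union>i\<in>J. ball i (5 * u i)) \<le> 15 / l * I" if "J \<subseteq> C" "finite J" for J
  proof -
    have sub: "ball i (u i) \<subseteq> {-(2*pi)..4*pi}" if "i \<in> J" for i
    proof -
      have "i \<in> T" using that \<open>J \<subseteq> C\<close> C(2) by blast
      then have "0 < i" "i < 2 * pi" "u i \<le> pi" using u by (auto simp: T_def)
      then show ?thesis by (auto simp: dist_real_def)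
    qed
    have intb: "G integrable_on ball i (u i)" for i
      unfolding ball_eq_greaterThanLessThan integrable_on_open_interval_real
      by (intro integrable_continuous_real contG)
    have "measure lebesgue (\<Union>i\<in>J. ball i (5 * u i)) \<le> (\<Sum>i\<in>J. measure lebesgue (ball i (5 * u i)))"
      by (rule measure_UNION_le[OF \<open>finite J\<close>]) auto
    also have "\<dots> \<le> (\<Sum>i\<in>J. 5 / l * integral (ball i (u i)) G)"
    proof (rule sum_mono)
      fix i assume "i \<in> J"
      then have ui: "0 < u i" "2 * u i * l < integral {i - u i..i + u i} G"
        using u \<open>J \<subseteq> C\<close> C(2) by auto
      have "measure lebesgue (ball i (5 * u i)) = 10 * u i"
        using ui unfolding ball_eq_greaterThanLessThan by simp
      also have "\<dots> \<le> 5 / l * integral {i - u i..i + u i} G"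
        using ui(2) l by (simp add: field_simps)
      finally show "measure lebesgue (ball i (5 * u i)) \<le> 5 / l * integral (ball i (u i)) G"
        unfolding ball_eq_greaterThanLessThan integral_open_interval_real .
    qed
    also have "\<dots> = 5 / l * (\<Sum>i\<in>J. integral {-(2*pi)..4*pi} (\<lambda>x. if x \<in> ball i (u i) then G x else 0))"
      unfolding sum_distrib_left integral_restrict_Int
      by (intro sum.cong refl) (simp only: Int_absorb2[OF sub])
    also have "(\<Sum>i\<in>J. integral {-(2*pi)..4*pi} (\<lambda>x. if x \<in> ball i (u i) then G x else 0))
        = integral {-(2*pi)..4*pi} (\<lambda>x. \<Sum>i\<in>J. if x \<in> ball i (u i) then G x else 0)"
      using sub intb by (intro Henstock_Kurzweil_Integration.integral_sum[symmetric] \<open>finite J\<close>)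
        (simp only: integrable_restrict_Int Int_absorb2)
    also have "\<dots> \<le> integral {-(2*pi)..4*pi} G"
    proof (rule integral_le)
      show "(\<lambda>x. \<Sum>i\<in>J. if x \<in> ball i (u i) then G x else 0) integrable_on {- (2 * pi)..4 * pi}"
        using sub intb by (intro integrable_sum \<open>finite J\<close>) (simp only: integrable_restrict_Int Int_absorb2)
      show "G integrable_on {- (2 * pi)..4 * pi}" by (intro integrable_continuous_real contG)
      fix x
      show "(\<Sum>i\<in>J. if x \<in> ball i (u i) then G x else 0) \<le> G x"
      proof (cases "\<exists>i\<in>J. x \<in> ball i (u i)")
        case True
        then obtain i where i: "i \<in> J" "x \<in> ball i (u i)" by blast
        have "x \<in> ball j (u j) \<longleftrightarrow> j = i" if "j \<in> J" for j
          using C(3) i that \<open>J \<subseteq> C\<close> unfolding pairwise_def disjnt_iff by blast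
        then have "(\<Sum>j\<in>J. if x \<in> ball j (u j) then G x else 0) = (\<Sum>j\<in>J. if j = i then G x else 0)"
          by (intro sum.cong) auto
        then show ?thesis using i \<open>finite J\<close> by simp
      qed (use G0 in \<open>simp add: sum_nonneg\<close>)
    qed
    finally have "measure lebesgue (\<Union>i\<in>J. ball i (5 * u i)) \<le> 5 / l * integral {-(2*pi)..4*pi} G"
      using l by (simp add: divide_right_mono)
    then show ?thesis unfolding big by simp
  qed
  have W: "(\<Union>i\<in>C. ball i (5 * u i)) \<in> lmeasurable" "measure lebesgue (\<Union>i\<in>C. ball i (5 * u i)) \<le> 15 / l * I"
    by (rule fmeasurable_UN_bound[OF C(1) _ bound] measure_UN_bound[OF C(1) _ bound]; auto)+
  have "measure lebesgue T \<le> measure lebesgue (\<Union>i\<in>C. ball i (5 * u i))"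
    using C(4) T W(1) by (intro measure_mono_fmeasurable) auto
  then show "measure lebesgue T \<le> 15 / l * integral {0..2*pi} (\<lambda>s. norm (h (cis s)))"
    using W(2) unfolding I_def G_def by linarith
qed

section \<open>Fatou's theorem for the Hardy space\<close>

lemma norm_ell2_sums: "(\<lambda>k. (norm (ell2_coef x k))\<^sup>2) sums (norm x)\<^sup>2"
  unfolding norm_ell2_square using has_sum_infsum[OF ell2_square_summable] by (rule has_sum_imp_sums)

lemma fn1_sums: "norm z < 1 \<Longrightarrow> (\<lambda>k. ell2_coef x k * z ^ k) sums fn1 x z"
  using fn1_has_sum by (rule has_sum_imp_sums)

lemma dilation_summable:
  assumes "0 \<le> r" "r < 1"
  shows "summable (\<lambda>k. norm (ell2_coef x k * of_real r ^ k))"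
proof -
  have "norm (complex_of_real r) < 1" using assms by simp
  then show ?thesis
    using summable_on_imp_summable[OF ell2_ip_abs_summable[of x "kern1 (of_real r)"]] by (simp add: kern1_coef)
qed

lemma fn1_tser:
  assumes "0 \<le> r" "r < 1"
  shows "fn1 x (of_real r * cis t) = tser (\<lambda>k. ell2_coef x k * of_real r ^ k) t"
  using fn1_sums[of "of_real r * cis t" x] assms
  by (simp add: tser_def norm_mult power_mult_distrib mult.assoc sums_iff)

lemma fn1_holomorphic: "fn1 x holomorphic_on ball 0 1"
  by (rule power_series_holomorphic[where a = "ell2_coef x"]) (use fn1_sums in auto)

lemma norm_power_mult_le:
  assumes "0 \<le> r" "r \<le> 1"
  shows "(norm (a * of_real r ^ k))\<^sup>2 \<le> (norm (a :: complex))\<^sup>2"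
  using assms by (simp add: norm_mult norm_power power_mult_distrib mult_left_le power_le_one)

lemma dilation_square_le:
  assumes "0 \<le> r" "r < 1"
  shows "(\<Sum>k. (norm (ell2_coef x k * of_real r ^ k))\<^sup>2) \<le> (norm x)\<^sup>2"
proof -
  have "(\<Sum>k. (norm (ell2_coef x k * of_real r ^ k))\<^sup>2) \<le> (\<Sum>k. (norm (ell2_coef x k))\<^sup>2)"
    using assms by (intro suminf_le norm_power_mult_le summable_square_of_summable dilation_summable
        sums_summable[OF norm_ell2_sums]) auto
  then show ?thesis using sums_unique[OF norm_ell2_sums[of x]] by simp
qed

text \<open>The weak-type inequality asks for holomorphy on the closed disk, so it is applied to the
  dilations by \<open>\<rho> n\<close>, whose exceptional sets \<open>S n\<close> increase to
  \<open>T\<close>. The constant is 15/l times the L^1 bound 2 pi B.\<close>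

lemma fn1_weak_type:
  fixes x :: "nat ell2"
  assumes l: "l > 0" and B: "norm x \<le> B" "B > 0"
  defines "T \<equiv> {t \<in> {0<..<2*pi}. \<exists>r\<in>{0..<1}. norm (fn1 x (of_real r * cis t)) > l}"
  shows "T \<in> lmeasurable" "measure lebesgue T \<le> 30 * pi * B / l"
proof -
  \<comment> \<open>With n + 2 in the denominator even \<open>\<rho> 0\<close> = 1/2 is positive, so
    radii may be divided by \<open>\<rho> n\<close>.\<close>
  define \<rho> where "\<rho> n = 1 - 1 / real (n + 2)" for n :: nat
  have \<rho>: "0 < \<rho> n" "\<rho> n < 1" for n by (auto simp: \<rho>_def field_simps)
  have \<rho>_mono: "\<rho> n \<le> \<rho> k" if "n \<le> k" for n k
    using that by (simp add: \<rho>_def field_simps)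
  define h where "h n w = fn1 x (of_real (\<rho> n) * w)" for n w
  define S where "S n = {t \<in> {0<..<2*pi}. \<exists>r\<in>{0..<1}. norm (h n (of_real r * cis t)) > l}" for n
  have S_le: "S n \<in> lmeasurable \<and> measure lebesgue (S n) \<le> 30 * pi * B / l" for n
  proof -
    have hol: "h n holomorphic_on cball 0 1"
      unfolding h_def
    proof (rule holomorphic_on_compose_gen[OF _ fn1_holomorphic, unfolded o_def])
      have "\<rho> n * norm w < 1" if "norm w \<le> 1" for w :: complex
        using mult_left_le[OF that less_imp_le[OF \<rho>(1)], of n] \<rho>(2)[of n] by linarith
      then show "(*) (complex_of_real (\<rho> n)) ` cball 0 1 \<subseteq> ball 0 1"
        using \<rho>(1)[of n] by (auto simp: norm_mult)
    qed (intro holomorphic_intros)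
    have eq: "h n (cis s) = tser (\<lambda>k. ell2_coef x k * of_real (\<rho> n) ^ k) s" for s
      unfolding h_def using \<rho>[of n] by (intro fn1_tser) auto
    have sm: "summable (\<lambda>k. norm (ell2_coef x k * of_real (\<rho> n) ^ k))"
      using \<rho>[of n] by (intro dilation_summable) auto
    have "integral {0..2*pi} (\<lambda>s. norm (h n (cis s))) = integral\<^sup>L (lebesgue_on {0..2*pi}) (\<lambda>s. norm (h n (cis s)))"
      unfolding eq by (intro lebesgue_integral_eq_integral[symmetric] continuous_imp_integrable_real
          continuous_intros continuous_on_tser sm) auto
    also have "\<dots> \<le> 2 * pi * B"
      unfolding eq
    proof (rule tser_L1_le[OF sm _ B(2)])
      have "(\<Sum>k. (norm (ell2_coef x k * of_real (\<rho> n) ^ k))\<^sup>2) \<le> (norm x)\<^sup>2"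
        using \<rho>[of n] by (intro dilation_square_le) auto
      also have "\<dots> \<le> B\<^sup>2" using B by (intro power_mono) auto
      finally show "(\<Sum>k. (norm (ell2_coef x k * of_real (\<rho> n) ^ k))\<^sup>2) \<le> B\<^sup>2" .
    qed
    finally have "15 / l * integral {0..2*pi} (\<lambda>s. norm (h n (cis s))) \<le> 15 / l * (2 * pi * B)"
      using l by (intro mult_left_mono) auto
    then show ?thesis
      unfolding S_def using weak_type_maximal[OF hol l] by auto
  qed
  have S_mono: "S n \<subseteq> S k" if "n \<le> k" for n k
  proof
    fix t assume "t \<in> S n"
    then obtain r where r: "r \<in> {0..<1}" "norm (h n (of_real r * cis t)) > l" "t \<in> {0<..<2*pi}"
      by (auto simp: S_def)
    \<comment> \<open>The radius is rescaled so that \<open>\<rho> k * r'\<close> equals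
      \<open>\<rho> n * r\<close>: both dilations then look at the same point of the disk.\<close>
    define r' where "r' = r * \<rho> n / \<rho> k"
    have "r * \<rho> n < \<rho> k"
    proof (cases "r = 0")
      case False
      then have "r * \<rho> n < 1 * \<rho> n" using r \<rho>[of n] by (intro mult_strict_right_mono) auto
      then show ?thesis using \<rho>_mono[OF that] by simp
    qed (use \<rho> in simp)
    then have "r' \<in> {0..<1}" using r \<rho>[of k] \<rho>[of n] by (auto simp: r'_def)
    moreover have "\<rho> k * r' = \<rho> n * r" using \<rho>[of k] by (simp add: r'_def)
    then have "h k (of_real r' * cis t) = h n (of_real r * cis t)"
      by (metis h_def mult.assoc of_real_mult)
    ultimately show "t \<in> S k" using r unfolding S_def by (auto intro!: bexI[of _ r'])
  qed
  have T_eq: "T = (\<Union>n\<in>UNIV. S n)"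
  proof (intro equalityI subsetI)
    fix t assume "t \<in> T"
    then obtain r where r: "r \<in> {0..<1}" "norm (fn1 x (of_real r * cis t)) > l" "t \<in> {0<..<2*pi}"
      by (auto simp: T_def)
    then have "1 - r > 0" by simp
    then obtain n where "inverse (real (Suc n)) < 1 - r" using reals_Archimedean by blast
    moreover have "1 / real (n + 2) \<le> inverse (real (Suc n))" by (simp add: field_simps)
    ultimately have "r < \<rho> n" by (simp add: \<rho>_def)
    then have "r / \<rho> n \<in> {0..<1}" using r \<rho>[of n] by (auto simp: field_simps)
    moreover have "h n (of_real (r / \<rho> n) * cis t) = fn1 x (of_real r * cis t)"
      using \<rho>[of n] by (simp add: h_def)
    ultimately have "t \<in> S n" using r unfolding S_def by (auto intro!: bexI[of _ "r / \<rho> n"])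
    then show "t \<in> (\<Union>n\<in>UNIV. S n)" by blast
  next
    fix t assume "t \<in> (\<Union>n\<in>UNIV. S n)"
    then obtain n r where r: "r \<in> {0..<1}" "norm (h n (of_real r * cis t)) > l" "t \<in> {0<..<2*pi}"
      by (auto simp: S_def)
    have "\<rho> n * r < 1 * 1" using r \<rho>[of n] by (intro mult_strict_mono') auto
    then have "\<rho> n * r \<in> {0..<1}" using r \<rho>[of n] by auto
    moreover have "h n (of_real r * cis t) = fn1 x (of_real (\<rho> n * r) * cis t)"
      by (simp add: h_def mult.assoc)
    ultimately show "t \<in> T" using r unfolding T_def by (auto intro!: bexI[of _ "\<rho> n * r"])
  qed
  have bound: "measure lebesgue (\<Union>n\<in>J. S n) \<le> 30 * pi * B / l" if "J \<subseteq> UNIV" "finite J" for J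
  proof (cases "J = {}")
    case False
    then have "(\<Union>n\<in>J. S n) = S (Max J)" using S_mono that(2) by (auto intro: Max_in dest: Max_ge[OF that(2)])
    then show ?thesis using S_le by simp
  qed (use l B in simp)
  show "T \<in> lmeasurable" "measure lebesgue T \<le> 30 * pi * B / l"
    unfolding T_eq using S_le
    by (auto intro!: fmeasurable_UN_bound[OF _ _ bound] measure_UN_bound[OF _ _ bound])
qed

lift_definition trunc :: "nat \<Rightarrow> nat ell2 \<Rightarrow> nat ell2" is "\<lambda>n a k. if k < n then a k else 0"
proof -
  fix n :: nat and a :: "nat \<Rightarrow> complex"
  have "(\<lambda>k. (norm (a k))\<^sup>2) summable_on {..<n}" by simp
  then show "(\<lambda>k. (norm (if k < n then a k else 0))\<^sup>2) summable_on UNIV"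
    by (rule summable_on_cong_neutral[THEN iffD1, rotated -1]) auto
qed

lemma trunc_coef [simp]: "ell2_coef (trunc n x) k = (if k < n then ell2_coef x k else 0)"
  by transfer simp

lemma trunc_tendsto: "(\<lambda>n. norm (x - trunc n x)) \<longlonglongrightarrow> 0"
proof -
  have "(norm (x - trunc n x))\<^sup>2 = (norm x)\<^sup>2 - (\<Sum>k<n. (norm (ell2_coef x k))\<^sup>2)" for n
  proof -
    have "(\<lambda>k. if k \<in> {..<n} then (norm (ell2_coef x k))\<^sup>2 else 0) sums (\<Sum>k<n. (norm (ell2_coef x k))\<^sup>2)"
      by (rule sums_If_finite_set) simp
    from sums_diff[OF norm_ell2_sums[of x] this]
    have "(\<lambda>k. (norm (ell2_coef (x - trunc n x) k))\<^sup>2) sums ((norm x)\<^sup>2 - (\<Sum>k<n. (norm (ell2_coef x k))\<^sup>2))"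
      by (rule sums_cong[THEN iffD1, rotated]) auto
    then show ?thesis using norm_ell2_sums sums_unique2 by blast
  qed
  moreover have "(\<lambda>n. (norm x)\<^sup>2 - (\<Sum>k<n. (norm (ell2_coef x k))\<^sup>2)) \<longlonglongrightarrow> (norm x)\<^sup>2 - (norm x)\<^sup>2"
    using norm_ell2_sums[of x] unfolding sums_def by (intro tendsto_intros)
  ultimately have "(\<lambda>n. (norm (x - trunc n x))\<^sup>2) \<longlonglongrightarrow> 0" by simp
  then have "(\<lambda>n. sqrt ((norm (x - trunc n x))\<^sup>2)) \<longlonglongrightarrow> sqrt 0" by (rule tendsto_real_sqrt)
  then show ?thesis by simp
qed

lemma fn1_trunc:
  assumes "norm z < 1"
  shows "fn1 (trunc n x) z = (\<Sum>k<n. ell2_coef x k * z ^ k)"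
proof -
  have "(\<lambda>k. if k \<in> {..<n} then ell2_coef x k * z ^ k else 0) sums (\<Sum>k<n. ell2_coef x k * z ^ k)"
    by (rule sums_If_finite_set) simp
  then have "(\<lambda>k. ell2_coef (trunc n x) k * z ^ k) sums (\<Sum>k<n. ell2_coef x k * z ^ k)"
    by (rule sums_cong[THEN iffD1, rotated]) auto
  then show ?thesis using fn1_sums[OF assms] sums_unique2 by blast
qed

text \<open>Splitting off a long Taylor polynomial leaves a tail \<open>y\<close> of small norm. The
  polynomial converges along every radius, so oscillation beyond e forces the radial maximal
  function of \<open>y\<close> above e/3, and the weak-type bound makes the set where this happens
  as small as desired.\<close>

lemma radial_oscillation_negligible:
  fixes x :: "nat ell2"
  assumes "e > 0"
  shows "negligible {t \<in> {0<..<2*pi}. \<forall>r0\<in>{0..<1}. \<exists>r\<in>{r0..<1}. \<exists>s\<in>{r0..<1}.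
      norm (fn1 x (of_real r * cis t) - fn1 x (of_real s * cis t)) > e}" (is "negligible ?S")
  unfolding negligible_outer_le
proof (intro allI impI)
  fix d :: real assume "d > 0"
  \<comment> \<open>Chosen so that the weak-type bound at level e/3, namely 30 pi B / (e/3), equals
    d.\<close>
  define B where "B = d * e / (90 * pi)"
  have "B > 0" using \<open>d > 0\<close> \<open>e > 0\<close> by (simp add: B_def)
  then have "\<forall>\<^sub>F n in sequentially. norm (x - trunc n x) < B"
    using order_tendstoD(2)[OF trunc_tendsto] by blast
  then obtain n where n: "norm (x - trunc n x) \<le> B"
    using eventually_happens'[OF sequentially_bot] less_imp_le by blast
  define y where "y = x - trunc n x"
  let ?T = "{t \<in> {0<..<2*pi}. \<exists>r\<in>{0..<1}. norm (fn1 y (of_real r * cis t)) > e / 3}"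
  have T: "?T \<in> lmeasurable" "measure lebesgue ?T \<le> 30 * pi * B / (e / 3)"
    using \<open>e > 0\<close> n \<open>B > 0\<close> by (intro fn1_weak_type; simp add: y_def)+
  have "30 * pi * B / (e / 3) = d" using \<open>e > 0\<close> by (simp add: B_def)
  moreover have "?S \<subseteq> ?T"
  proof
    fix t assume t: "t \<in> ?S"
    show "t \<in> ?T"
    proof (rule ccontr)
      assume "t \<notin> ?T"
      then have small: "norm (fn1 y (of_real r * cis t)) \<le> e / 3" if "r \<in> {0..<1}" for r
        using t that by (simp add: not_less)
      define P where "P r = (\<Sum>k<n. ell2_coef x k * (of_real r * cis t) ^ k)" for r :: real
      have "(P \<longlongrightarrow> P 1) (at_left 1)"
        unfolding P_def by (intro tendsto_intros)
      then have "\<forall>\<^sub>F r in at_left 1. dist (P r) (P 1) < e / 6"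
        using \<open>e > 0\<close> by (intro tendstoD) auto
      then obtain b where b: "b < 1" "\<And>r. b < r \<Longrightarrow> r < 1 \<Longrightarrow> dist (P r) (P 1) < e / 6"
        unfolding eventually_at_left_field by blast
      define r0 where "r0 = max 0 ((b + 1) / 2)"
      have r0: "r0 \<in> {0..<1}" "b < r0" using b(1) by (auto simp: r0_def max_def)
      obtain r s where rs: "r \<in> {r0..<1}" "s \<in> {r0..<1}"
        "norm (fn1 x (of_real r * cis t) - fn1 x (of_real s * cis t)) > e"
        using t r0 by blast
      have dec: "fn1 x (of_real r * cis t) = fn1 y (of_real r * cis t) + P r" if "r \<in> {r0..<1}" for r
      proof -
        have "norm (of_real r * cis t) < 1" using that r0 by (simp add: norm_mult)
        then show ?thesis unfolding y_def fn1_diff by (simp add: fn1_trunc P_def)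
      qed
      have "dist (P r) (P 1) < e / 6" "dist (P s) (P 1) < e / 6" using b rs r0 by auto
      then have "norm (P r - P s) < e / 3"
        using dist_triangle2[of "P r" "P s" "P 1"] by (simp add: dist_norm)
      moreover have "norm (fn1 y (of_real r * cis t)) \<le> e / 3" "norm (fn1 y (of_real s * cis t)) \<le> e / 3"
        using small rs r0 by auto
      moreover have "fn1 x (of_real r * cis t) - fn1 x (of_real s * cis t)
          = (fn1 y (of_real r * cis t) - fn1 y (of_real s * cis t)) + (P r - P s)"
        using dec[OF rs(1)] dec[OF rs(2)] by simp
      moreover have "norm ((fn1 y (of_real r * cis t) - fn1 y (of_real s * cis t)) + (P r - P s))
          \<le> norm (fn1 y (of_real r * cis t)) + norm (fn1 y (of_real s * cis t)) + norm (P r - P s)"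
        using norm_triangle_ineq[of "fn1 y (of_real r * cis t) - fn1 y (of_real s * cis t)" "P r - P s"]
          norm_triangle_ineq4[of "fn1 y (of_real r * cis t)" "fn1 y (of_real s * cis t)"] by linarith
      ultimately show False using rs(3) by simp
    qed
  qed
  ultimately show "\<exists>T. ?S \<subseteq> T \<and> T \<in> lmeasurable \<and> measure lebesgue T \<le> d"
    using T by (intro exI[of _ ?T]) simp
qed

lemma tendsto_at_left_of_Cauchy:
  fixes f :: "real \<Rightarrow> complex"
  assumes "\<And>e. e > 0 \<Longrightarrow> \<exists>r0\<in>{0..<1}. \<forall>r\<in>{r0..<1}. \<forall>s\<in>{r0..<1}. norm (f r - f s) \<le> e"
  shows "\<exists>l. (f \<longlongrightarrow> l) (at_left 1)"
proof -
  define \<rho> where "\<rho> n = 1 - inverse (real (Suc n))" for n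
  have lim: "\<rho> \<longlonglongrightarrow> 1" unfolding \<rho>_def
    using tendsto_diff[OF tendsto_const LIMSEQ_inverse_real_of_nat, of 1] by simp
  have ev: "\<exists>N. \<forall>n\<ge>N. \<rho> n \<in> {r0..<1}" if r0: "r0 \<in> {0..<1}" for r0
  proof -
    have "\<forall>\<^sub>F n in sequentially. r0 < \<rho> n" using order_tendstoD(1)[OF lim] r0 by auto
    then show ?thesis unfolding eventually_sequentially by (force simp: \<rho>_def)
  qed
  have "Cauchy (\<lambda>n. f (\<rho> n))"
  proof (rule CauchyI)
    fix e :: real assume "e > 0"
    then obtain r0 where r0: "r0 \<in> {0..<1}" "\<forall>r\<in>{r0..<1}. \<forall>s\<in>{r0..<1}. norm (f r - f s) \<le> e / 2"
      using assms[of "e / 2"] by auto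
    obtain N where "\<forall>n\<ge>N. \<rho> n \<in> {r0..<1}" using ev[OF r0(1)] by blast
    then have "\<forall>m\<ge>N. \<forall>n\<ge>N. norm (f (\<rho> m) - f (\<rho> n)) \<le> e / 2" using r0(2) by blast
    then show "\<exists>M. \<forall>m\<ge>M. \<forall>n\<ge>M. norm (f (\<rho> m) - f (\<rho> n)) < e"
      using \<open>e > 0\<close> by (intro exI[of _ N] allI impI) (smt (verit, best) field_sum_of_halves)
  qed
  then obtain l where l: "(\<lambda>n. f (\<rho> n)) \<longlonglongrightarrow> l"
    using Cauchy_convergent convergent_def by blast
  have "(f \<longlongrightarrow> l) (at_left 1)"
  proof (rule tendstoI)
    fix e :: real assume "e > 0"
    then obtain r0 where r0: "r0 \<in> {0..<1}" "\<forall>r\<in>{r0..<1}. \<forall>s\<in>{r0..<1}. norm (f r - f s) \<le> e / 2"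
      using assms[of "e / 2"] by auto
    obtain N where N: "\<forall>n\<ge>N. \<rho> n \<in> {r0..<1}" using ev[OF r0(1)] by blast
    have "dist (f r) l < e" if "r0 < r" "r < 1" for r
    proof -
      have "norm (f r - l) \<le> e / 2"
      proof (rule LIMSEQ_le_const2)
        show "(\<lambda>n. norm (f r - f (\<rho> n))) \<longlonglongrightarrow> norm (f r - l)" by (intro tendsto_intros l)
        have "r \<in> {r0..<1}" using that by simp
        then show "\<exists>N. \<forall>n\<ge>N. norm (f r - f (\<rho> n)) \<le> e / 2" using N r0(2) by blast
      qed
      then show ?thesis using \<open>e > 0\<close> by (simp add: dist_norm)
    qed
    then show "\<forall>\<^sub>F r in at_left 1. dist (f r) l < e"
      unfolding eventually_at_left_field using r0(1) by (intro exI[of _ r0]) auto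
  qed
  then show ?thesis by blast
qed

text \<open>Outside the null sets of oscillation beyond 1/(n+1) the radial function is Cauchy.
  \<open>bv\<close> is given by \<open>Lim\<close>, so it has the intended value only where a limit
  exists. The endpoints 0 and 2 pi join the exceptional set because the oscillation sets lie in the
  open interval.\<close>

lemma radial_limit_ae:
  fixes x :: "nat ell2"
  shows "AE t in lebesgue_on {0..2*pi}. ((\<lambda>r. fn1 x (of_real r * cis t)) \<longlongrightarrow> bv (fn1 x) (cis t)) (at_left 1)"
proof -
  define S where "S e = {t \<in> {0<..<2*pi}. \<forall>r0\<in>{0..<1}. \<exists>r\<in>{r0..<1}. \<exists>s\<in>{r0..<1}.
      norm (fn1 x (of_real r * cis t) - fn1 x (of_real s * cis t)) > e}" for e
  define N where "N = (\<Union>n. S (inverse (real (Suc n)))) \<union> {0, 2 * pi}"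
  have "negligible (S e)" if "e > 0" for e
    unfolding S_def by (rule radial_oscillation_negligible[OF that])
  then have "negligible (\<Union>n. S (inverse (real (Suc n))))"
    by (intro negligible_countable_Union) auto
  then have "negligible N" unfolding N_def by (intro negligible_Un) auto
  then have "AE t in lebesgue. t \<notin> N"
    unfolding negligible_iff_null_sets by (rule AE_not_in)
  then have "AE t in lebesgue. t \<in> {0..2*pi} \<longrightarrow> ((\<lambda>r. fn1 x (of_real r * cis t)) \<longlongrightarrow> bv (fn1 x) (cis t)) (at_left 1)"
  proof eventually_elim
    case (elim t)
    show ?case
    proof
      assume "t \<in> {0..2*pi}"
      then have t: "t \<in> {0<..<2*pi}" using elim unfolding N_def by (cases "t = 0 \<or> t = 2 * pi") auto
      have "\<exists>l. ((\<lambda>r. fn1 x (of_real r * cis t)) \<longlongrightarrow> l) (at_left 1)"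
      proof (rule tendsto_at_left_of_Cauchy)
        fix e :: real assume "e > 0"
        then obtain n where n: "inverse (real (Suc n)) < e" using reals_Archimedean by blast
        have "t \<notin> S (inverse (real (Suc n)))" using elim by (auto simp: N_def)
        then obtain r0 where r0: "r0 \<in> {0..<1}" "\<And>r s. r \<in> {r0..<1} \<Longrightarrow> s \<in> {r0..<1} \<Longrightarrow>
            norm (fn1 x (of_real r * cis t) - fn1 x (of_real s * cis t)) \<le> inverse (real (Suc n))"
          using t unfolding S_def by (auto simp: not_less)
        then show "\<exists>r0\<in>{0..<1}. \<forall>r\<in>{r0..<1}. \<forall>s\<in>{r0..<1}.
            norm (fn1 x (of_real r * cis t) - fn1 x (of_real s * cis t)) \<le> e"
          using n by (meson less_imp_le order_trans)
      qed
      then obtain l where l: "((\<lambda>r. fn1 x (of_real r * cis t)) \<longlongrightarrow> l) (at_left 1)" by blast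
      then have "bv (fn1 x) (cis t) = l"
        unfolding bv_def by (intro tendsto_Lim) auto
      then show "((\<lambda>r. fn1 x (of_real r * cis t)) \<longlongrightarrow> bv (fn1 x) (cis t)) (at_left 1)" using l by simp
    qed
  qed
  then show ?thesis by (subst AE_restrict_space_iff) auto
qed

section \<open>From dilations to boundary values: L^1 convergence and Fourier coefficients\<close>

lemma tannery_sequence:
  fixes a :: "nat \<Rightarrow> nat \<Rightarrow> 'a :: {real_normed_algebra, banach}"
  assumes "\<And>k. (\<lambda>n. a k n) \<longlonglongrightarrow> b k" "\<And>k n. norm (a k n) \<le> M k" "summable M"
  shows "(\<lambda>n. \<Sum>k. a k n) \<longlonglongrightarrow> (\<Sum>k. b k)"
proof -
  have "\<forall>\<^sub>F (k, n) in sequentially \<times>\<^sub>F sequentially. norm (a k n) \<le> M k"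
    using assms(2) by (intro always_eventually) auto
  then show ?thesis using tannerys_theorem[of a b sequentially M] assms(1,3) by auto
qed

text \<open>Fatou's lemma turns the Cauchy property of the dilations in \<open>L\<^sup>1\<close> into convergence to the radial limits.\<close>
lemma dilation_L1_limit:
  fixes x :: "nat ell2" and \<rho> :: "nat \<Rightarrow> real"
  assumes \<rho>: "\<And>n. 0 \<le> \<rho> n" "\<And>n. \<rho> n < 1" "\<rho> \<longlonglongrightarrow> 1"
  shows "integrable (lebesgue_on {0..2*pi}) (\<lambda>t. bv (fn1 x) (cis t))"
    and "(\<lambda>n. integral\<^sup>L (lebesgue_on {0..2*pi})
           (\<lambda>t. norm (fn1 x (of_real (\<rho> n) * cis t) - bv (fn1 x) (cis t)))) \<longlonglongrightarrow> 0"
proof -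
  let ?M = "lebesgue_on {0..2*pi}"
  define f where "f n t = fn1 x (of_real (\<rho> n) * cis t)" for n t
  define g where "g t = bv (fn1 x) (cis t)" for t
  have sm: "summable (\<lambda>k. norm (ell2_coef x k * of_real (\<rho> n) ^ k))" for n
    using \<rho> by (intro dilation_summable)
  have f_tser: "f n = tser (\<lambda>k. ell2_coef x k * of_real (\<rho> n) ^ k)" for n
    unfolding f_def using \<rho> fn1_tser by blast
  have contf: "continuous_on A (f n)" for A n
    unfolding f_tser by (rule continuous_on_tser[OF sm])
  have [measurable]: "f n \<in> borel_measurable ?M" for n
    by (intro continuous_imp_measurable_on_sets_lebesgue contf) auto
  have lim: "AE t in ?M. (\<lambda>n. f n t) \<longlonglongrightarrow> g t"
    using radial_limit_ae[of x]
  proof eventually_elim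
    case (elim t)
    have "filterlim \<rho> (at_left 1) sequentially"
      unfolding filterlim_at using \<rho> by (auto intro!: always_eventually simp: less_imp_neq)
    from filterlim_compose[OF elim this] show ?case by (simp add: f_def g_def)
  qed
  \<comment> \<open>\<open>g\<close> is only almost everywhere a limit of continuous functions;
    completeness of Lebesgue measure passes measurability on to \<open>g\<close>, whatever its
    values on the exceptional set.\<close>
  have g_meas [measurable]: "g \<in> borel_measurable ?M"
  proof -
    have "(\<lambda>t. lim (\<lambda>n. f n t)) \<in> borel_measurable ?M" by measurable
    then have "(\<lambda>t. if t \<in> {0..2*pi} then lim (\<lambda>n. f n t) else 0) \<in> borel_measurable lebesgue"
      by (subst borel_measurable_if) auto
    moreover have "AE t in ?M. lim (\<lambda>n. f n t) = g t"
      using lim by eventually_elim (rule limI)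
    then have "AE t in lebesgue. t \<in> {0..2*pi} \<longrightarrow> lim (\<lambda>n. f n t) = g t"
      by (subst (asm) AE_restrict_space_iff) auto
    then have "AE t in lebesgue. (if t \<in> {0..2*pi} then lim (\<lambda>n. f n t) else 0) = (if t \<in> {0..2*pi} then g t else 0)"
      by eventually_elim auto
    ultimately have "(\<lambda>t. if t \<in> {0..2*pi} then g t else 0) \<in> borel_measurable lebesgue"
      by (rule borel_measurable_AE)
    then show ?thesis by (subst (asm) borel_measurable_if) auto
  qed
  \<comment> \<open>The squared Hardy norm of the difference between \<open>x\<close> and its
    dilation by \<open>\<rho> n\<close>; it tends to 0 by dominated convergence.\<close>
  define D where "D n = (\<Sum>k. (norm (ell2_coef x k))\<^sup>2 * (1 - \<rho> n ^ k)\<^sup>2)" for n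
  have D_bound: "(norm (ell2_coef x k))\<^sup>2 * (1 - \<rho> n ^ k)\<^sup>2 \<le> (norm (ell2_coef x k))\<^sup>2" for n k
    using \<rho>(1,2)[of n] by (intro mult_left_le power_le_one) (auto simp: power_le_one less_imp_le)
  have D_sum: "summable (\<lambda>k. (norm (ell2_coef x k))\<^sup>2 * (1 - \<rho> n ^ k)\<^sup>2)" for n
    by (rule summable_comparison_test'[OF sums_summable[OF norm_ell2_sums[of x]], of 0]) (simp add: D_bound)
  have "D \<longlonglongrightarrow> (\<Sum>k. (norm (ell2_coef x k))\<^sup>2 * (1 - 1 ^ k)\<^sup>2)"
    unfolding D_def
  proof (rule tannery_sequence[OF _ _ sums_summable[OF norm_ell2_sums[of x]]])
    show "(\<lambda>n. (norm (ell2_coef x k))\<^sup>2 * (1 - \<rho> n ^ k)\<^sup>2) \<longlonglongrightarrow> (norm (ell2_coef x k))\<^sup>2 * (1 - 1 ^ k)\<^sup>2" for k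
      by (intro tendsto_intros \<rho>(3))
  qed (simp add: D_bound)
  then have D0: "D \<longlonglongrightarrow> 0" by simp
  have nn: "\<exists>N. \<forall>n\<ge>N. (\<integral>\<^sup>+ t. ennreal (norm (f n t - g t)) \<partial>?M) \<le> ennreal (2 * pi * d)" if "d > 0" for d
  proof -
    \<comment> \<open>The threshold makes 2 D n + 2 D m at most d^2, the form that
      \<open>tser_L1_le\<close> takes with bound d.\<close>
    have "\<forall>\<^sub>F n in sequentially. D n < d\<^sup>2 / 4"
      by (rule order_tendstoD(2)[OF D0]) (use that in simp)
    then obtain N where N: "\<And>n. n \<ge> N \<Longrightarrow> D n < d\<^sup>2 / 4" by (auto simp: eventually_sequentially)
    have pair: "(\<integral>\<^sup>+ t. ennreal (norm (f n t - f m t)) \<partial>?M) \<le> ennreal (2 * pi * d)" if "n \<ge> N" "m \<ge> N" for n m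
    proof -
      define c where "c k = ell2_coef x k * of_real (\<rho> n) ^ k - ell2_coef x k * of_real (\<rho> m) ^ k" for k
      have c_sum: "summable (\<lambda>k. norm (c k))"
        by (rule summable_comparison_test'[OF summable_add[OF sm[of n] sm[of m]], of 0])
          (simp add: c_def norm_triangle_ineq4)
      have fc: "f n t - f m t = tser c t" for t
        using sums_diff[OF tser_sums[OF sm[of n], of t] tser_sums[OF sm[of m], of t]]
        by (simp add: f_tser tser_def c_def left_diff_distrib sums_iff)
      have "(norm (c k))\<^sup>2 \<le> 2 * ((norm (ell2_coef x k))\<^sup>2 * (1 - \<rho> n ^ k)\<^sup>2) + 2 * ((norm (ell2_coef x k))\<^sup>2 * (1 - \<rho> m ^ k)\<^sup>2)" for k
      proof -
        define u v where "u = 1 - \<rho> n ^ k" and "v = 1 - \<rho> m ^ k"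
        have "c k = ell2_coef x k * of_real (v - u)"
          by (simp add: c_def u_def v_def algebra_simps)
        then have "(norm (c k))\<^sup>2 = (norm (ell2_coef x k))\<^sup>2 * (v - u)\<^sup>2"
          by (simp only: norm_mult norm_of_real power_mult_distrib power2_abs)
        also have "\<dots> \<le> (norm (ell2_coef x k))\<^sup>2 * (2 * u\<^sup>2 + 2 * v\<^sup>2)"
          using zero_le_power2[of "u + v"] by (intro mult_left_mono) (auto simp: power2_eq_square algebra_simps)
        finally show ?thesis by (simp add: u_def v_def algebra_simps)
      qed
      then have "(\<Sum>k. (norm (c k))\<^sup>2) \<le> 2 * D n + 2 * D m"
        unfolding D_def suminf_mult[OF D_sum, symmetric]
        by (subst suminf_add) (auto intro!: suminf_le summable_square_of_summable[OF c_sum] summable_add summable_mult D_sum)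
      also have "\<dots> \<le> d\<^sup>2" using N[OF that(1)] N[OF that(2)] by simp
      finally have "integral\<^sup>L ?M (\<lambda>t. norm (tser c t)) \<le> 2 * pi * d"
        by (rule tser_L1_le[OF c_sum _ \<open>d > 0\<close>])
      moreover have "integrable ?M (\<lambda>t. norm (tser c t))"
        by (intro continuous_imp_integrable_real continuous_intros continuous_on_tser c_sum)
      then have "(\<integral>\<^sup>+ t. ennreal (norm (tser c t)) \<partial>?M) = ennreal (integral\<^sup>L ?M (\<lambda>t. norm (tser c t)))"
        by (rule nn_integral_eq_integral) auto
      ultimately show ?thesis unfolding fc by (simp add: ennreal_leI)
    qed
    have "(\<integral>\<^sup>+ t. ennreal (norm (f n t - g t)) \<partial>?M) \<le> ennreal (2 * pi * d)" if "n \<ge> N" for n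
    proof -
      have "AE t in ?M. ennreal (norm (f n t - g t)) = liminf (\<lambda>m. ennreal (norm (f n t - f m t)))"
        using lim
      proof eventually_elim
        case (elim t)
        then have "(\<lambda>m. ennreal (norm (f n t - f m t))) \<longlonglongrightarrow> ennreal (norm (f n t - g t))"
          by (intro tendsto_ennrealI tendsto_intros)
        then show ?case by (intro lim_imp_Liminf[symmetric]) auto
      qed
      then have "(\<integral>\<^sup>+ t. ennreal (norm (f n t - g t)) \<partial>?M) = (\<integral>\<^sup>+ t. liminf (\<lambda>m. ennreal (norm (f n t - f m t))) \<partial>?M)"
        by (rule nn_integral_cong_AE)
      also have "\<dots> \<le> liminf (\<lambda>m. \<integral>\<^sup>+ t. ennreal (norm (f n t - f m t)) \<partial>?M)"
        by (rule nn_integral_liminf) measurable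
      also have "\<dots> \<le> limsup (\<lambda>m. \<integral>\<^sup>+ t. ennreal (norm (f n t - f m t)) \<partial>?M)"
        by (rule Liminf_le_Limsup) simp
      also have "\<dots> \<le> ennreal (2 * pi * d)"
        by (rule Limsup_bounded) (use pair[OF that] in \<open>auto simp: eventually_sequentially\<close>)
      finally show ?thesis .
    qed
    then show ?thesis by blast
  qed
  have int_f: "integrable ?M (f n)" for n by (intro integrable_circle contf)
  obtain N where N: "(\<integral>\<^sup>+ t. ennreal (norm (f N t - g t)) \<partial>?M) \<le> ennreal (2 * pi * 1)"
    using nn[of 1] by auto
  have "integrable ?M (\<lambda>t. f N t - g t)"
    by (rule integrableI_bounded) (use N in \<open>auto intro: le_less_trans\<close>)
  from Bochner_Integration.integrable_diff[OF int_f[of N] this] have int_g: "integrable ?M g" by simp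
  then show "integrable ?M (\<lambda>t. bv (fn1 x) (cis t))" by (simp add: g_def[abs_def])
  have "(\<lambda>n. integral\<^sup>L ?M (\<lambda>t. norm (f n t - g t))) \<longlonglongrightarrow> 0"
  proof (rule LIMSEQ_I)
    fix e :: real assume "e > 0"
    define d where "d = e / (4 * pi)"
    have "d > 0" using \<open>e > 0\<close> by (simp add: d_def)
    then obtain N where N: "\<And>n. n \<ge> N \<Longrightarrow> (\<integral>\<^sup>+ t. ennreal (norm (f n t - g t)) \<partial>?M) \<le> ennreal (2 * pi * d)"
      using nn by blast
    have "norm (integral\<^sup>L ?M (\<lambda>t. norm (f n t - g t)) - 0) < e" if "n \<ge> N" for n
    proof -
      have "integrable ?M (\<lambda>t. norm (f n t - g t))"
        by (intro integrable_norm Bochner_Integration.integrable_diff int_f int_g)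
      then have "ennreal (integral\<^sup>L ?M (\<lambda>t. norm (f n t - g t))) \<le> ennreal (2 * pi * d)"
        using N[OF that] by (subst nn_integral_eq_integral[symmetric]) auto
      then have "integral\<^sup>L ?M (\<lambda>t. norm (f n t - g t)) \<le> 2 * pi * d"
        using \<open>d > 0\<close> by (simp add: ennreal_le_iff)
      also have "\<dots> < e" using \<open>e > 0\<close> by (simp add: d_def)
      finally show ?thesis by simp
    qed
    then show "\<exists>N. \<forall>n\<ge>N. norm (integral\<^sup>L ?M (\<lambda>t. norm (f n t - g t)) - 0) < e" by blast
  qed
  then show "(\<lambda>n. integral\<^sup>L ?M (\<lambda>t. norm (fn1 x (of_real (\<rho> n) * cis t) - bv (fn1 x) (cis t)))) \<longlonglongrightarrow> 0"
    by (simp add: f_def g_def)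
qed

text \<open>These are the coefficients that a Toeplitz operator with conjugate-analytic symbol
  produces. At radius \<open>\<rho> n\<close> the value comes from Parseval; as the radius tends to
  1 the symbol converges uniformly, the vector in L^1, and the series is dominated.\<close>

lemma fourier_coanalytic_mult:
  fixes x y :: "nat ell2" and \<phi> :: "complex \<Rightarrow> complex" and k :: nat
  assumes \<phi>: "continuous_on (cball 0 1) \<phi>" "\<And>z. norm z < 1 \<Longrightarrow> \<phi> z = fn1 y z"
  shows "integrable (lebesgue_on {0..2*pi}) (\<lambda>t. cnj (\<phi> (cis t)) * bv (fn1 x) (cis t) * cis (- (of_int (int k) * t)))"
    and "integral\<^sup>L (lebesgue_on {0..2*pi}) (\<lambda>t. cnj (\<phi> (cis t)) * bv (fn1 x) (cis t) * cis (- (of_int (int k) * t)))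
       = 2 * pi * (\<Sum>j. ell2_coef x (j + k) * cnj (ell2_coef y j))"
proof -
  let ?M = "lebesgue_on {0..2*pi}"
  define \<rho> where "\<rho> n = 1 - inverse (real (Suc n))" for n
  have \<rho>: "0 \<le> \<rho> n" "\<rho> n < 1" for n by (auto simp: \<rho>_def field_simps)
  have \<rho>_lim: "\<rho> \<longlonglongrightarrow> 1" unfolding \<rho>_def
    using tendsto_diff[OF tendsto_const LIMSEQ_inverse_real_of_nat, of 1] by simp
  define f where "f n t = fn1 x (of_real (\<rho> n) * cis t)" for n t
  define g where "g t = bv (fn1 x) (cis t)" for t
  define w where "w t = cnj (\<phi> (cis t)) * cis (- (real k * t))" for t
  define v where "v n t = cnj (\<phi> (of_real (\<rho> n) * cis t)) * cis (- (real k * t))" for n t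
  note L1 = dilation_L1_limit[OF \<rho> \<rho>_lim, of x, folded f_def g_def]
  have sm: "summable (\<lambda>k. norm (ell2_coef z k * of_real (\<rho> n) ^ k))" for z :: "nat ell2" and n
    using \<rho> by (intro dilation_summable)
  have f_tser: "f n = tser (\<lambda>k. ell2_coef x k * of_real (\<rho> n) ^ k)" for n
    unfolding f_def using \<rho> fn1_tser by blast
  have contf: "continuous_on A (f n)" for A n
    unfolding f_tser by (rule continuous_on_tser[OF sm])
  have contw: "continuous_on A w" for A
    unfolding w_def by (intro continuous_intros continuous_on_compose2[OF \<phi>(1)]) auto
  have contv: "continuous_on A (v n)" for A n
    unfolding v_def using \<rho>[of n]
    by (intro continuous_intros continuous_on_compose2[OF \<phi>(1)]) (auto simp: norm_mult)
  have "bounded (\<phi> ` cball 0 1)"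
    using compact_continuous_image[OF \<phi>(1)] by (simp add: compact_imp_bounded)
  then obtain W where W: "W > 0" "\<And>z. z \<in> cball 0 1 \<Longrightarrow> norm (\<phi> z) \<le> W"
    unfolding bounded_pos by auto
  have w_le: "norm (w t) \<le> W" for t using W(2)[of "cis t"] by (simp add: w_def norm_mult)
  have int_gw: "integrable ?M (\<lambda>t. g t * w t)"
  proof (rule Bochner_Integration.integrable_bound)
    show "integrable ?M (\<lambda>t. W * norm (g t))" using L1(1) by simp
    show "(\<lambda>t. g t * w t) \<in> borel_measurable ?M"
      by (intro borel_measurable_times borel_measurable_integrable[OF L1(1)]
          continuous_imp_measurable_on_sets_lebesgue contw) auto
    show "AE t in ?M. norm (g t * w t) \<le> norm (W * norm (g t))"
      using w_le W(1) by (intro always_eventually allI) (simp add: norm_mult mult.commute[of W] mult_left_mono)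
  qed
  have gw: "cnj (\<phi> (cis t)) * bv (fn1 x) (cis t) * cis (- (of_int (int k) * t)) = g t * w t" for t
    by (simp add: g_def w_def)
  show "integrable ?M (\<lambda>t. cnj (\<phi> (cis t)) * bv (fn1 x) (cis t) * cis (- (of_int (int k) * t)))"
    unfolding gw by (rule int_gw)
  define B where "B = norm x + 1"
  have B: "B > 0" by (simp add: B_def add_nonneg_pos)
  have f_L1: "integral\<^sup>L ?M (\<lambda>t. norm (f n t)) \<le> 2 * pi * B" for n
    unfolding f_tser
  proof (rule tser_L1_le[OF sm _ B])
    have "(\<Sum>k. (norm (ell2_coef x k * of_real (\<rho> n) ^ k))\<^sup>2) \<le> (norm x)\<^sup>2"
      using \<rho> by (intro dilation_square_le)
    also have "\<dots> \<le> B\<^sup>2" by (intro power_mono) (auto simp: B_def)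
    finally show "(\<Sum>k. (norm (ell2_coef x k * of_real (\<rho> n) ^ k))\<^sup>2) \<le> B\<^sup>2" .
  qed
  have unif: "\<exists>N. \<forall>n\<ge>N. \<forall>t. norm (v n t - w t) \<le> e" if e: "e > 0" for e
  proof -
    have "uniformly_continuous_on (cball 0 1) \<phi>"
      by (rule compact_uniformly_continuous[OF \<phi>(1)]) simp
    then obtain d where d: "d > 0" "\<And>z z'. z \<in> cball 0 1 \<Longrightarrow> z' \<in> cball 0 1 \<Longrightarrow> dist z' z < d \<Longrightarrow> dist (\<phi> z') (\<phi> z) < e"
      unfolding uniformly_continuous_on_def using e by metis
    have "\<forall>\<^sub>F n in sequentially. 1 - d < \<rho> n" using order_tendstoD(1)[OF \<rho>_lim] d(1) by auto
    then obtain N where N: "\<And>n. n \<ge> N \<Longrightarrow> 1 - d < \<rho> n" by (auto simp: eventually_sequentially)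
    have "norm (v n t - w t) \<le> e" if "n \<ge> N" for n t
    proof -
      have "of_real (\<rho> n) * cis t - cis t = of_real (\<rho> n - 1) * cis t" by (simp add: algebra_simps)
      then have "dist (of_real (\<rho> n) * cis t) (cis t) = 1 - \<rho> n"
        using \<rho>(2)[of n] by (simp only: dist_norm norm_mult norm_of_real norm_cis) simp
      then have "dist (\<phi> (of_real (\<rho> n) * cis t)) (\<phi> (cis t)) < e"
        using d(2)[of "cis t" "of_real (\<rho> n) * cis t"] N[OF that] \<rho>[of n] by (auto simp: norm_mult)
      moreover have "v n t - w t = cnj (\<phi> (of_real (\<rho> n) * cis t) - \<phi> (cis t)) * cis (- (real k * t))"
        by (simp add: v_def w_def left_diff_distrib)
      ultimately show ?thesis by (simp add: norm_mult dist_norm flip: complex_cnj_diff)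
    qed
    then show ?thesis by blast
  qed
  have lim1: "(\<lambda>n. integral\<^sup>L ?M (\<lambda>t. f n t * v n t)) \<longlonglongrightarrow> integral\<^sup>L ?M (\<lambda>t. g t * w t)"
  proof (rule LIMSEQ_I)
    fix e :: real assume "e > 0"
    \<comment> \<open>The error splits in two: d times the L^1 bound 2 pi B is e/2, and the sup
      bound \<open>W\<close> times the L^1 distance stays below e/2.\<close>
    define d where "d = e / (4 * pi * B)"
    have "d > 0" using \<open>e > 0\<close> B by (simp add: d_def)
    then obtain N1 where N1: "\<And>n t. n \<ge> N1 \<Longrightarrow> norm (v n t - w t) \<le> d" using unif by metis
    have "e / (2 * W) > 0" using \<open>e > 0\<close> W by simp
    then obtain N2 where N2: "\<And>n. n \<ge> N2 \<Longrightarrow> norm (integral\<^sup>L ?M (\<lambda>t. norm (f n t - g t)) - 0) < e / (2 * W)"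
      using LIMSEQ_D[OF L1(2)] by blast
    have "norm (integral\<^sup>L ?M (\<lambda>t. f n t * v n t) - integral\<^sup>L ?M (\<lambda>t. g t * w t)) < e" if "n \<ge> max N1 N2" for n
    proof -
      have int_fv: "integrable ?M (\<lambda>t. f n t * v n t)" and int_fn: "integrable ?M (\<lambda>t. norm (f n t))"
        by (intro integrable_circle continuous_imp_integrable_real continuous_intros contf contv)+
      have int_fg: "integrable ?M (\<lambda>t. norm (f n t - g t))"
        by (rule integrable_norm, rule Bochner_Integration.integrable_diff[OF integrable_circle[OF contf] L1(1)])
      have "norm (integral\<^sup>L ?M (\<lambda>t. f n t * v n t) - integral\<^sup>L ?M (\<lambda>t. g t * w t))
          = norm (integral\<^sup>L ?M (\<lambda>t. f n t * v n t - g t * w t))"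
        using int_fv int_gw by simp
      also have "\<dots> \<le> integral\<^sup>L ?M (\<lambda>t. d * norm (f n t) + W * norm (f n t - g t))"
      proof (rule order_trans[OF integral_norm_bound integral_mono])
        show "integrable ?M (\<lambda>t. norm (f n t * v n t - g t * w t))"
          using int_fv int_gw by simp
        show "integrable ?M (\<lambda>t. d * norm (f n t) + W * norm (f n t - g t))"
          using int_fn int_fg by simp
        fix t
        have "f n t * v n t - g t * w t = f n t * (v n t - w t) + (f n t - g t) * w t"
          by (simp add: algebra_simps)
        then have "norm (f n t * v n t - g t * w t) \<le> norm (f n t) * norm (v n t - w t) + norm (f n t - g t) * norm (w t)"
          by (metis norm_mult norm_triangle_ineq)
        also have "\<dots> \<le> norm (f n t) * d + norm (f n t - g t) * W"
          using N1[of n t] that w_le by (intro add_mono mult_left_mono) auto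
        finally show "norm (f n t * v n t - g t * w t) \<le> d * norm (f n t) + W * norm (f n t - g t)"
          by (simp add: mult.commute)
      qed
      also have "\<dots> = d * integral\<^sup>L ?M (\<lambda>t. norm (f n t)) + W * integral\<^sup>L ?M (\<lambda>t. norm (f n t - g t))"
        using int_fn int_fg by simp
      also have "\<dots> < d * (2 * pi * B) + W * (e / (2 * W))"
        using f_L1[of n] N2[of n] that \<open>d > 0\<close> W
        by (intro add_le_less_mono mult_left_mono mult_strict_left_mono) auto
      also have "\<dots> = e" using W B by (simp add: d_def)
      finally show ?thesis .
    qed
    then show "\<exists>N. \<forall>n\<ge>N. norm (integral\<^sup>L ?M (\<lambda>t. f n t * v n t) - integral\<^sup>L ?M (\<lambda>t. g t * w t)) < e" by blast
  qed
  have val: "integral\<^sup>L ?M (\<lambda>t. f n t * v n t)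
      = 2 * pi * (\<Sum>j. (ell2_coef x (j + k) * cnj (ell2_coef y j)) * of_real (\<rho> n ^ (j + k) * \<rho> n ^ j))" for n
  proof -
    \<comment> \<open>Taylor coefficients of z^k \<phi>(\<rho> z): the power z^k absorbs the
      frequency factor, so the integrand becomes \<open>f n\<close> times the conjugate of a single
      absolutely convergent series.\<close>
    define b where "b j = (if j < k then 0 else ell2_coef y (j - k) * of_real (\<rho> n) ^ (j - k))" for j
    have b_shift: "b (j + k) = ell2_coef y j * of_real (\<rho> n) ^ j" for j by (simp add: b_def)
    have b_sum: "summable (\<lambda>j. norm (b j))"
      using sm[where z = y and n = n] summable_iff_shift[of "\<lambda>j. norm (b j)" k] by (simp add: b_shift)
    have "tser b t = cis t ^ k * \<phi> (of_real (\<rho> n) * cis t)" for t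
    proof -
      have "(\<lambda>j. b (j + k) * cis t ^ (j + k)) sums (cis t ^ k * tser (\<lambda>k. ell2_coef y k * of_real (\<rho> n) ^ k) t)"
        using sums_mult[OF tser_sums[OF sm[where z = y and n = n]], of "cis t ^ k"]
        by (simp add: b_shift power_add mult_ac)
      then have "(\<lambda>j. b j * cis t ^ j) sums (cis t ^ k * tser (\<lambda>k. ell2_coef y k * of_real (\<rho> n) ^ k) t + (\<Sum>j<k. b j * cis t ^ j))"
        by (subst (asm) sums_iff_shift) 
      then show ?thesis
        using fn1_tser[of "\<rho> n" y t] \<rho>[of n] \<phi>(2)[of "of_real (\<rho> n) * cis t"]
        by (simp add: tser_def b_def sums_iff norm_mult)
    qed
    then have "v n t = cnj (tser b t)" for t
      by (simp add: v_def Complex.DeMoivre cis_cnj mult.commute flip: complex_cnj_power)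
    then have "integral\<^sup>L ?M (\<lambda>t. f n t * v n t) = 2 * pi * (\<Sum>j. ell2_coef x j * of_real (\<rho> n) ^ j * cnj (b j))"
      unfolding f_tser using parseval[OF sm b_sum] by simp
    also have "(\<Sum>j. ell2_coef x j * of_real (\<rho> n) ^ j * cnj (b j))
        = (\<Sum>j. ell2_coef x (j + k) * of_real (\<rho> n) ^ (j + k) * cnj (b (j + k)))"
    proof -
      have "summable (\<lambda>j. ell2_coef x j * of_real (\<rho> n) ^ j * cnj (b j))"
        by (rule summable_mult_cnj[OF sm b_sum])
      from suminf_split_initial_segment[OF this, of k] show ?thesis by (simp add: b_def)
    qed
    finally show ?thesis by (simp add: b_shift mult_ac)
  qed
  have "(\<lambda>n. \<Sum>j. (ell2_coef x (j + k) * cnj (ell2_coef y j)) * of_real (\<rho> n ^ (j + k) * \<rho> n ^ j))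
      \<longlonglongrightarrow> (\<Sum>j. (ell2_coef x (j + k) * cnj (ell2_coef y j)) * of_real (1 ^ (j + k) * 1 ^ j))"
  proof (rule tannery_sequence)
    fix j n
    show "(\<lambda>n. (ell2_coef x (j + k) * cnj (ell2_coef y j)) * of_real (\<rho> n ^ (j + k) * \<rho> n ^ j))
        \<longlonglongrightarrow> (ell2_coef x (j + k) * cnj (ell2_coef y j)) * of_real (1 ^ (j + k) * 1 ^ j)"
      by (intro tendsto_intros \<rho>_lim)
    have "\<rho> n ^ (j + k) * \<rho> n ^ j \<le> 1 * 1"
      using \<rho>[of n] by (intro mult_mono power_le_one) auto
    then show "norm ((ell2_coef x (j + k) * cnj (ell2_coef y j)) * of_real (\<rho> n ^ (j + k) * \<rho> n ^ j))
        \<le> norm (ell2_coef x (j + k) * cnj (ell2_coef y j))"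
      using \<rho>[of n] by (subst norm_mult, intro mult_left_le) (auto simp del: of_real_mult of_real_power)
  next
    have "(\<lambda>j. (norm (ell2_coef x (j + k)))\<^sup>2) summable_on UNIV"
      using summable_iff_shift[of "\<lambda>j. (norm (ell2_coef x j))\<^sup>2" k] sums_summable[OF norm_ell2_sums[of x]]
      by (simp add: summable_on_UNIV_nonneg_real_iff)
    from square_summable_mult[OF this, of "\<lambda>j. cnj (ell2_coef y j)"]
    show "summable (\<lambda>j. norm (ell2_coef x (j + k) * cnj (ell2_coef y j)))"
      by (simp add: ell2_square_summable summable_on_imp_summable)
  qed
  then have "(\<lambda>n. integral\<^sup>L ?M (\<lambda>t. f n t * v n t)) \<longlonglongrightarrow> 2 * pi * (\<Sum>j. ell2_coef x (j + k) * cnj (ell2_coef y j))"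
    unfolding val by (intro tendsto_intros) simp
  from LIMSEQ_unique[OF lim1 this]
  show "integral\<^sup>L ?M (\<lambda>t. cnj (\<phi> (cis t)) * bv (fn1 x) (cis t) * cis (- (of_int (int k) * t)))
       = 2 * pi * (\<Sum>j. ell2_coef x (j + k) * cnj (ell2_coef y j))"
    unfolding gw .
qed

section \<open>Two-variable polynomials and double power series\<close>

lemma eval2_sum:
  assumes "degree p \<le> N"
  shows "eval2 p z1 z2 = (\<Sum>k\<le>N. poly (coeff p k) z1 * z2 ^ k)"
proof -
  let ?q = "map_poly (\<lambda>c. poly c z1) p"
  have c: "coeff ?q k = poly (coeff p k) z1" for k by (simp add: coeff_map_poly)
  have "degree ?q \<le> N" using assms by (intro degree_le) (simp add: c coeff_eq_0)
  then have "poly ?q z2 = (\<Sum>k\<le>N. coeff ?q k * z2 ^ k)"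
    unfolding poly_altdef by (intro sum.mono_neutral_left) (auto simp: coeff_eq_0)
  then show ?thesis by (simp add: eval2_def c)
qed

lemma degree_coeff_le_deg1: "degree (coeff p k) \<le> deg1 p"
proof (cases "coeff p k = 0")
  case False
  then have "p \<noteq> 0" "k \<le> degree p" by (auto simp: le_degree)
  then have "degree (coeff p k) \<in> insert 0 (degree ` set (coeffs p))"
    using coeff_in_coeffs by blast
  then show ?thesis unfolding deg1_def by (intro Max_ge) auto
qed simp

lemma poly_sum_le:
  fixes c :: "complex poly"
  assumes "degree c \<le> M"
  shows "poly c z = (\<Sum>j\<le>M. coeff c j * z ^ j)"
  unfolding poly_altdef using assms by (intro sum.mono_neutral_left) (auto simp: coeff_eq_0)

lemma eval2_double_sum:
  assumes "deg1 p \<le> m" "deg2 p \<le> n"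
  shows "eval2 p z1 z2 = (\<Sum>k\<le>n. \<Sum>j\<le>m. coeff2 p j k * z1 ^ j * z2 ^ k)"
proof -
  have "degree (coeff p k) \<le> m" for k using degree_coeff_le_deg1[of p k] assms by linarith
  then have "poly (coeff p k) z1 = (\<Sum>j\<le>m. coeff2 p j k * z1 ^ j)" for k
    unfolding coeff2_def by (rule poly_sum_le)
  then show ?thesis
    using assms by (simp add: eval2_sum[of p n] deg2_def sum_distrib_right)
qed

lemma eval2_ptilde:
  "eval2 (ptilde m n p) z1 z2 = (\<Sum>k\<le>n. \<Sum>j\<le>m. cnj (coeff2 p (m - j) (n - k)) * z1 ^ j * z2 ^ k)"
proof -
  let ?c = "\<lambda>k. \<Sum>j\<le>m. monom (cnj (coeff2 p (m - j) (n - k))) j"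
  have c: "coeff (ptilde m n p) k = (if k \<le> n then ?c k else 0)" for k
    unfolding ptilde_def by (simp add: coeff_sum sum.delta)
  then have "degree (ptilde m n p) \<le> n" by (intro degree_le) auto
  then have "eval2 (ptilde m n p) z1 z2 = (\<Sum>k\<le>n. poly (coeff (ptilde m n p) k) z1 * z2 ^ k)"
    by (rule eval2_sum)
  also have "\<dots> = (\<Sum>k\<le>n. \<Sum>j\<le>m. cnj (coeff2 p (m - j) (n - k)) * z1 ^ j * z2 ^ k)"
    by (intro sum.cong refl) (simp add: c poly_sum poly_monom sum_distrib_right)
  finally show ?thesis .
qed

lemma continuous_on_eval2:
  assumes "continuous_on A f" "continuous_on A g"
  shows "continuous_on A (\<lambda>x. eval2 p (f x) (g x))"
  unfolding eval2_sum[OF order_refl, of p] by (intro continuous_intros assms)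

lemma holomorphic_on_eval2:
  assumes "f holomorphic_on A" "g holomorphic_on A"
  shows "(\<lambda>x. eval2 p (f x) (g x)) holomorphic_on A"
proof -
  have "(\<lambda>x. poly (coeff p k) (f x)) holomorphic_on A" for k
    unfolding poly_altdef by (intro holomorphic_intros assms)
  then show ?thesis unfolding eval2_sum[OF order_refl, of p] by (intro holomorphic_intros assms)
qed

text \<open>The Taylor coefficients of \<open>1/p\<close> in \<open>z\<^sub>2\<close> are holomorphic in \<open>z\<^sub>1\<close> because comparing coefficients
  in \<open>p \<cdot> (1/p) = 1\<close> determines them recursively.\<close>
lemma reciprocal_double_series:
  assumes nz: "\<And>z1 z2. norm z1 < 1 \<Longrightarrow> norm z2 < 1 \<Longrightarrow> eval2 p z1 z2 \<noteq> 0"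
  obtains d :: "nat \<times> nat \<Rightarrow> complex" where
    "\<And>z1 z2. norm z1 < 1 \<Longrightarrow> norm z2 < 1 \<Longrightarrow>
      (\<lambda>(j, k). norm (d (j, k) * z1 ^ j * z2 ^ k)) summable_on UNIV \<and>
      ((\<lambda>(j, k). d (j, k) * z1 ^ j * z2 ^ k) has_sum (1 / eval2 p z1 z2)) UNIV"
proof -
  define c where "c k z1 = (deriv ^^ k) (\<lambda>z2. 1 / eval2 p z1 z2) 0 / fact k" for k z1
  have hol2: "(\<lambda>z2. 1 / eval2 p z1 z2) holomorphic_on ball 0 1" if "norm z1 < 1" for z1
    using nz[OF that] by (intro holomorphic_intros holomorphic_on_eval2) auto
  have c_sums: "(\<lambda>k. c k z1 * z2 ^ k) sums (1 / eval2 p z1 z2)" if "norm z1 < 1" "norm z2 < 1" for z1 z2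
    using holomorphic_power_series[OF hol2[OF that(1)], of z2] that by (simp add: c_def)
  have c_abs: "summable (\<lambda>k. norm (c k z1 * z2 ^ k))" if "norm z1 < 1" and z2: "norm z2 < 1" for z1 z2
  proof -
    obtain r where r: "norm z2 < r" "r < 1" using dense[OF z2] by blast
    have "0 \<le> r" using r(1) norm_ge_zero[of z2] by linarith
    then have "norm z2 < norm (complex_of_real r)" using r by simp
    moreover have "norm (complex_of_real r) < 1" using r \<open>0 \<le> r\<close> by simp
    then have "summable (\<lambda>k. c k z1 * of_real r ^ k)" using c_sums[OF that(1)] sums_summable by blast
    ultimately show ?thesis using powser_insidea[of "\<lambda>k. c k z1" "of_real r" z2] by blast
  qed
  define P where "P k z1 = poly (coeff p k) z1" for k z1
  have conv: "(\<Sum>i\<le>k. P i z1 * c (k - i) z1) = (if k = 0 then 1 else 0)" if z1: "norm z1 < 1" for k z1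
  proof -
    have "(\<Sum>i\<le>k. P i z1 * c (k - i) z1) - (if k = 0 then 1 else 0) = 0"
    proof (rule power_series_sums_zero_imp[where a = "\<lambda>k. (\<Sum>i\<le>k. P i z1 * c (k - i) z1) - (if k = 0 then 1 else 0)"])
      fix z2 :: complex assume z2: "norm z2 < 1"
      have P_sums: "(\<lambda>k. P k z1 * z2 ^ k) sums eval2 p z1 z2"
        unfolding eval2_sum[OF order_refl] P_def by (rule sums_finite) (auto simp: coeff_eq_0)
      have "summable (\<lambda>k. norm (P k z1 * z2 ^ k))"
        by (rule summable_finite[of "{..degree p}"]) (auto simp: P_def coeff_eq_0)
      from Cauchy_product_sums[OF this c_abs[OF z1 z2]]
      have "(\<lambda>k. \<Sum>i\<le>k. (P i z1 * z2 ^ i) * (c (k - i) z1 * z2 ^ (k - i))) sums (eval2 p z1 z2 * (1 / eval2 p z1 z2))"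
        using sums_unique[OF P_sums] sums_unique[OF c_sums[OF z1 z2]] by simp
      moreover have "(\<Sum>i\<le>k. (P i z1 * z2 ^ i) * (c (k - i) z1 * z2 ^ (k - i))) = (\<Sum>i\<le>k. P i z1 * c (k - i) z1) * z2 ^ k" for k
        unfolding sum_distrib_right
      proof (rule sum.cong[OF refl])
        fix i assume "i \<in> {..k}"
        then have "z2 ^ i * z2 ^ (k - i) = z2 ^ k" by (simp flip: power_add)
        then show "(P i z1 * z2 ^ i) * (c (k - i) z1 * z2 ^ (k - i)) = P i z1 * c (k - i) z1 * z2 ^ k"
          by (metis (no_types, lifting) mult.assoc mult.left_commute)
      qed
      ultimately have "(\<lambda>k. (\<Sum>i\<le>k. P i z1 * c (k - i) z1) * z2 ^ k) sums 1"
        using nz[OF z1 z2] by simp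
      moreover have "(\<lambda>k. (if k = 0 then 1 else 0) * z2 ^ k) sums 1"
        using sums_single[of 0 "\<lambda>k. z2 ^ k"] by (simp add: if_distrib[of "\<lambda>x. x * _"] cong: if_cong)
      ultimately show "(\<lambda>k. ((\<Sum>i\<le>k. P i z1 * c (k - i) z1) - (if k = 0 then 1 else 0)) * z2 ^ k) sums 0"
        using sums_diff by (fastforce simp: left_diff_distrib)
    qed
    then show ?thesis by simp
  qed
  have P0: "P 0 z1 \<noteq> 0" if "norm z1 < 1" for z1
  proof -
    have "eval2 p z1 0 = P 0 z1" by (simp add: eval2_sum[OF order_refl] P_def power_0_left if_distrib sum.delta cong: if_cong)
    then show ?thesis using nz[OF that, of 0] by simp
  qed
  have P_hol: "P k holomorphic_on A" for k A
    unfolding P_def poly_altdef by (intro holomorphic_intros)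
  have c_hol: "c k holomorphic_on ball 0 1" for k
  proof (induction k rule: less_induct)
    case (less k)
    have "c k z1 = ((if k = 0 then 1 else 0) - (\<Sum>i\<in>{1..k}. P i z1 * c (k - i) z1)) / P 0 z1" if "norm z1 < 1" for z1
    proof -
      have "{..k} = insert 0 {1..k}" by auto
      then have "(\<Sum>i\<le>k. P i z1 * c (k - i) z1) = P 0 z1 * c k z1 + (\<Sum>i\<in>{1..k}. P i z1 * c (k - i) z1)"
        by simp
      with conv[OF that, of k] show ?thesis using P0[OF that] by (simp add: field_simps)
    qed
    moreover have "(\<lambda>z1. ((if k = 0 then 1 else 0) - (\<Sum>i\<in>{1..k}. P i z1 * c (k - i) z1)) / P 0 z1) holomorphic_on ball 0 1"
      using P0 by (intro holomorphic_intros P_hol less) auto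
    ultimately show ?case by (subst holomorphic_cong[OF refl]) auto
  qed
  define d where "d jk = (deriv ^^ fst jk) (c (snd jk)) 0 / fact (fst jk)" for jk
  \<comment> \<open>Two nested Cauchy estimates on the polydisk of radius r; K bounds 1/p on this
    compact set, where p has no zero.\<close>
  have d_bound: "\<exists>K. \<forall>j k. norm (d (j, k)) \<le> K / r ^ j / r ^ k" if r: "0 < r" "r < 1" for r :: real
  proof -
    have "compact ((\<lambda>z. 1 / eval2 p (fst z) (snd z)) ` (cball 0 r \<times> cball 0 r))"
      using nz r by (intro compact_continuous_image compact_Times continuous_intros continuous_on_eval2) auto
    then have "bounded ((\<lambda>z. 1 / eval2 p (fst z) (snd z)) ` (cball 0 r \<times> cball 0 r))"
      by (rule compact_imp_bounded)
    then obtain K where K': "\<And>w. w \<in> (\<lambda>z. 1 / eval2 p (fst z) (snd z)) ` (cball 0 r \<times> cball 0 r) \<Longrightarrow> norm w \<le> K"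
      unfolding bounded_iff by blast
    have K: "norm (1 / eval2 p z1 z2) \<le> K" if "norm z1 \<le> r" "norm z2 \<le> r" for z1 z2
      using that by (intro K' image_eqI[of _ _ "(z1, z2)"]) auto
    have ck: "norm (c k z1) \<le> K / r ^ k" if "norm z1 \<le> r" for k z1
    proof -
      have "norm z1 < 1" using that r by simp
      have "norm ((deriv ^^ k) (\<lambda>z2. 1 / eval2 p z1 z2) 0) \<le> fact k * K / r ^ k"
      proof (rule Cauchy_inequality)
        have sub: "(\<lambda>z2. 1 / eval2 p z1 z2) holomorphic_on cball 0 r"
          by (rule holomorphic_on_subset[OF hol2[OF \<open>norm z1 < 1\<close>]]) (use r in auto)
        then show "(\<lambda>z2. 1 / eval2 p z1 z2) holomorphic_on ball 0 r" by (rule holomorphic_on_subset) auto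
        show "continuous_on (cball 0 r) (\<lambda>z2. 1 / eval2 p z1 z2)" using sub by (rule holomorphic_on_imp_continuous_on)
      qed (use r K[OF that] in auto)
      then show ?thesis by (simp add: c_def norm_divide field_simps)
    qed
    have "norm (d (j, k)) \<le> K / r ^ j / r ^ k" for j k
    proof -
      have "norm ((deriv ^^ j) (c k) 0) \<le> fact j * (K / r ^ k) / r ^ j"
      proof (rule Cauchy_inequality)
        have sub: "c k holomorphic_on cball 0 r"
          by (rule holomorphic_on_subset[OF c_hol]) (use r in auto)
        then show "c k holomorphic_on ball 0 r" by (rule holomorphic_on_subset) auto
        show "continuous_on (cball 0 r) (c k)" using sub by (rule holomorphic_on_imp_continuous_on)
      qed (use r ck in auto)
      then show ?thesis using r by (simp add: d_def norm_divide field_simps)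
    qed
    then show ?thesis by blast
  qed
  show ?thesis
  proof (rule that[of d])
    fix z1 z2 :: complex assume z: "norm z1 < 1" "norm z2 < 1"
    \<comment> \<open>With r strictly between both moduli and 1 the Cauchy estimates dominate the
      series by a convergent product of geometric series.\<close>
    obtain r where r: "max (norm z1) (norm z2) < r" "r < 1" using dense[of "max (norm z1) (norm z2)" 1] z by auto
    then have r': "0 < r" "r < 1" "norm z1 < r" "norm z2 < r" using norm_ge_zero[of z1] by linarith+
    obtain K where K: "\<And>j k. norm (d (j, k)) \<le> K / r ^ j / r ^ k" using d_bound[OF r'(1,2)] by blast
    have geo: "(\<lambda>u. case u of (j, k) \<Rightarrow> (norm z1 / r) ^ j * (norm z2 / r) ^ k) summable_on UNIV"
      using r' by (intro double_geometric_summable) auto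
    have abs: "(\<lambda>(j, k). norm (d (j, k) * z1 ^ j * z2 ^ k)) summable_on UNIV"
    proof (rule summable_on_comparison_test[OF summable_on_cmult_right[OF geo, of K]])
      fix u :: "nat \<times> nat"
      obtain j k where u: "u = (j, k)" by (cases u)
      have "norm (d (j, k) * z1 ^ j * z2 ^ k) \<le> K / r ^ j / r ^ k * norm z1 ^ j * norm z2 ^ k"
        unfolding norm_mult norm_power by (intro mult_right_mono K) auto
      then show "(case u of (j, k) \<Rightarrow> norm (d (j, k) * z1 ^ j * z2 ^ k))
          \<le> K * (case u of (j, k) \<Rightarrow> (norm z1 / r) ^ j * (norm z2 / r) ^ k)"
        by (simp add: u power_divide field_simps)
    qed auto
    have "(\<lambda>u. norm (case u of (j, k) \<Rightarrow> d (j, k) * z1 ^ j * z2 ^ k)) summable_on UNIV"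
      using abs by (simp add: case_prod_unfold)
    then have summ: "(\<lambda>(j, k). d (j, k) * z1 ^ j * z2 ^ k) summable_on UNIV"
      by (rule abs_summable_summable)
    \<comment> \<open>The expansion arises by powers of z_2 first, so it is summed over (k, j) and
      swapped afterwards.\<close>
    have "((\<lambda>(k, j). d (j, k) * z1 ^ j * z2 ^ k) has_sum (1 / eval2 p z1 z2)) (UNIV \<times> UNIV)"
    proof (rule has_sum_SigmaI)
      fix k
      have "(\<lambda>j. d (j, k) * z1 ^ j) sums c k z1"
        using holomorphic_power_series[OF c_hol, of z1 k] z by (simp add: d_def)
      moreover have "(\<lambda>j. d (j, k) * z1 ^ j * z2 ^ k) summable_on UNIV"
      proof -
        have "(\<lambda>(k, j). d (j, k) * z1 ^ j * z2 ^ k) summable_on (UNIV \<times> UNIV)"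
          using summ summable_on_swap[of "\<lambda>(k, j). d (j, k) * z1 ^ j * z2 ^ k" UNIV UNIV] by (simp add: case_prod_unfold)
        then show ?thesis using summable_on_SigmaD1[of "\<lambda>k j. d (j, k) * z1 ^ j * z2 ^ k" UNIV "\<lambda>_. UNIV" k] by simp
      qed
      ultimately show "((\<lambda>j. case (k, j) of (k, j) \<Rightarrow> d (j, k) * z1 ^ j * z2 ^ k) has_sum c k z1 * z2 ^ k) UNIV"
        using sums_mult2[of "\<lambda>j. d (j, k) * z1 ^ j" "c k z1" "z2 ^ k"]
        by (simp add: has_sum_iff) (metis has_sum_imp_sums has_sum_infsum sums_unique2)
    next
      have "(\<lambda>k. norm (c k z1 * z2 ^ k)) summable_on UNIV"
        using c_abs[OF z] by (simp add: summable_on_UNIV_nonneg_real_iff)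
      then have "(\<lambda>k. c k z1 * z2 ^ k) summable_on UNIV" by (rule abs_summable_summable)
      then show "((\<lambda>k. c k z1 * z2 ^ k) has_sum (1 / eval2 p z1 z2)) UNIV"
        using c_sums[OF z] has_sum_imp_sums[OF has_sum_infsum] sums_unique2 by (metis has_sum_infsum)
    next
      show "(\<lambda>(k, j). d (j, k) * z1 ^ j * z2 ^ k) summable_on UNIV \<times> UNIV"
        using summ summable_on_swap[of "\<lambda>(k, j). d (j, k) * z1 ^ j * z2 ^ k" UNIV UNIV] by (simp add: case_prod_unfold)
    qed
    then have "((\<lambda>(j, k). d (j, k) * z1 ^ j * z2 ^ k) has_sum (1 / eval2 p z1 z2)) UNIV"
      by (subst (asm) has_sum_swap) (simp add: case_prod_unfold)
    with abs show "(\<lambda>(j, k). norm (d (j, k) * z1 ^ j * z2 ^ k)) summable_on UNIV \<and>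
      ((\<lambda>(j, k). d (j, k) * z1 ^ j * z2 ^ k) has_sum (1 / eval2 p z1 z2)) UNIV" by blast
  qed
qed

section \<open>Cauchy products of double series and Parseval on the torus\<close>

definition conv2 :: "(nat \<times> nat \<Rightarrow> complex) \<Rightarrow> (nat \<times> nat \<Rightarrow> complex) \<Rightarrow> nat \<times> nat \<Rightarrow> complex" where
  "conv2 a b u = (\<Sum>v\<in>{..fst u} \<times> {..snd u}. a v * b (fst u - fst v, snd u - snd v))"

text \<open>Pairs (v, w) are regrouped by their sum u = v + w; the pairs with a given sum correspond
  to a finite box of values v, so the inner sums are finite and absolute convergence is inherited
  from the product family.\<close>

lemma conv2_has_sum:
  assumes a: "(\<lambda>u. norm (a u)) summable_on UNIV" "(a has_sum s) UNIV"
    and b: "(\<lambda>u. norm (b u)) summable_on UNIV" "(b has_sum t) UNIV"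
  shows "(conv2 a b has_sum s * t) UNIV" "(\<lambda>u. norm (conv2 a b u)) summable_on UNIV"
proof -
  define f where "f = (\<lambda>(u, v). a u * b v)"
  define box where "box u = {..fst u} \<times> {..snd u}" for u :: "nat \<times> nat"
  define F where "F = (\<lambda>(u, v). a v * b (fst u - fst v, snd u - snd v))"
  have abs_f: "(\<lambda>w. norm (f w)) summable_on (UNIV \<times> UNIV)"
  proof (rule summable_on_SigmaI)
    fix u
    show "((\<lambda>v. norm (f (u, v))) has_sum norm (a u) * infsum (\<lambda>v. norm (b v)) UNIV) UNIV"
      unfolding f_def using has_sum_cmult_right[OF has_sum_infsum[OF b(1)]] by (simp add: norm_mult)
    show "(\<lambda>u. norm (a u) * infsum (\<lambda>v. norm (b v)) UNIV) summable_on UNIV"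
      by (rule summable_on_cmult_left[OF a(1)])
  qed auto
  have sum_f: "(f has_sum s * t) (UNIV \<times> UNIV)"
  proof (rule has_sum_SigmaI)
    fix u
    show "((\<lambda>v. f (u, v)) has_sum a u * t) UNIV"
      unfolding f_def using has_sum_cmult_right[OF b(2)] by simp
    show "((\<lambda>u. a u * t) has_sum s * t) UNIV" by (rule has_sum_cmult_left[OF a(2)])
    show "f summable_on (UNIV \<times> UNIV)" by (rule abs_summable_summable[OF abs_f])
  qed
  have reindex: "(g has_sum S) (UNIV \<times> UNIV) \<longleftrightarrow>
      ((\<lambda>(u, v). g (v, (fst u - fst v, snd u - snd v))) has_sum S) (Sigma UNIV box)"
    for g :: "(nat \<times> nat) \<times> (nat \<times> nat) \<Rightarrow> 'c :: {comm_monoid_add, topological_space}" and S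
    by (rule has_sum_reindex_bij_witness[where
          i = "\<lambda>(u, v). (v, (fst u - fst v, snd u - snd v))" and j = "\<lambda>(v, w). ((fst v + fst w, snd v + snd w), v)"])
      (auto simp: box_def)
  have "(F has_sum s * t) (Sigma UNIV box)"
    using sum_f unfolding reindex by (simp add: F_def f_def case_prod_unfold)
  then show "(conv2 a b has_sum s * t) UNIV"
  proof (rule has_sum_SigmaD)
    fix u show "((\<lambda>v. F (u, v)) has_sum conv2 a b u) (box u)"
      by (rule has_sum_finiteI) (auto simp: box_def F_def conv2_def)
  qed
  have "(\<lambda>w. norm (F w)) summable_on (Sigma UNIV box)"
    using abs_f unfolding summable_on_def reindex by (simp add: F_def f_def case_prod_unfold)
  then have "(\<lambda>u. norm (infsum (\<lambda>v. norm (F (u, v))) (box u))) summable_on UNIV"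
    unfolding Infinite_Sum.abs_summable_on_Sigma_iff by blast
  then show "(\<lambda>u. norm (conv2 a b u)) summable_on UNIV"
  proof (rule Infinite_Sum.abs_summable_on_comparison_test)
    fix u
    have "norm (conv2 a b u) \<le> (\<Sum>v\<in>box u. norm (F (u, v)))"
      unfolding conv2_def box_def F_def by (simp add: sum_norm_le)
    then show "norm (conv2 a b u) \<le> norm (infsum (\<lambda>v. norm (F (u, v))) (box u))"
      by (simp add: box_def sum_nonneg)
  qed
qed

text \<open>The weights z_1^j z_2^k are multiplicative, so one coefficient array represents the
  product at all points and on all dilated tori at once.\<close>

lemma conv2_scale:
  "conv2 (\<lambda>(j, k). a (j, k) * z1 ^ j * z2 ^ k) (\<lambda>(j, k). b (j, k) * z1 ^ j * z2 ^ k) (j, k)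
    = conv2 a b (j, k) * z1 ^ j * z2 ^ k"
  unfolding conv2_def sum_distrib_right
proof (rule sum.cong[OF refl])
  fix v assume "v \<in> {..fst (j, k)} \<times> {..snd (j, k)}"
  then obtain i l where v: "v = (i, l)" "i \<le> j" "l \<le> k" by auto
  have "z1 ^ j = z1 ^ i * z1 ^ (j - i)" "z2 ^ k = z2 ^ l * z2 ^ (k - l)"
    using v by (simp_all flip: power_add)
  then show "(case v of (j, k) \<Rightarrow> a (j, k) * z1 ^ j * z2 ^ k) *
      (case (fst (j, k) - fst v, snd (j, k) - snd v) of (j, k) \<Rightarrow> b (j, k) * z1 ^ j * z2 ^ k)
      = a v * b (fst (j, k) - fst v, snd (j, k) - snd v) * z1 ^ j * z2 ^ k"
    by (simp add: v mult_ac)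
qed

lemma abs_summable_columns:
  fixes a :: "nat \<times> nat \<Rightarrow> complex"
  assumes a: "(\<lambda>u. norm (a u)) summable_on UNIV"
  shows "summable (\<lambda>j. norm (a (j, k)))" "summable (\<lambda>k. \<Sum>j. norm (a (j, k)))"
proof -
  have sw: "(\<lambda>(k, j). norm (a (j, k))) summable_on (UNIV \<times> UNIV)"
    using a summable_on_swap[of "\<lambda>(k, j). norm (a (j, k))" UNIV UNIV] by (simp add: case_prod_unfold)
  have col: "(\<lambda>j. norm (a (j, k))) summable_on UNIV" for k
    using summable_on_SigmaD1[of "\<lambda>k j. norm (a (j, k))" UNIV "\<lambda>_. UNIV" k] sw by simp
  then show "summable (\<lambda>j. norm (a (j, k)))" by (rule summable_on_imp_summable)
  have "((\<lambda>k. \<Sum>\<^sub>\<infinity>j. norm (a (j, k))) has_sum infsum (\<lambda>(k, j). norm (a (j, k))) (UNIV \<times> UNIV)) UNIV"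
    by (rule has_sum_SigmaD[OF has_sum_infsum[OF sw]]) (simp add: col)
  moreover have "(\<Sum>\<^sub>\<infinity>j. norm (a (j, k))) = (\<Sum>j. norm (a (j, k)))" for k
    using has_sum_imp_sums[OF has_sum_infsum[OF col]] by (rule sums_unique)
  ultimately have "(\<lambda>k. \<Sum>j. norm (a (j, k))) summable_on UNIV"
    using has_sum_imp_summable by simp
  then show "summable (\<lambda>k. \<Sum>j. norm (a (j, k)))" by (rule summable_on_imp_summable)
qed

lemma norm_tser_le:
  assumes "summable (\<lambda>j. norm (a j))"
  shows "norm (tser a s) \<le> (\<Sum>j. norm (a j))"
  using summable_norm[of "\<lambda>j. a j * cis s ^ j"] assms by (simp add: tser_def norm_mult norm_power)

lemma tser_columns_summable:
  assumes a: "(\<lambda>u. norm (a u)) summable_on UNIV"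
  shows "summable (\<lambda>k. norm (tser (\<lambda>j. a (j, k)) s))"
  by (rule summable_comparison_test'[OF abs_summable_columns(2)[OF a], of 0])
    (simp add: norm_tser_le abs_summable_columns(1)[OF a])

lemma tser_double_eqI:
  fixes a :: "nat \<times> nat \<Rightarrow> complex"
  assumes a: "(\<lambda>u. norm (a u)) summable_on UNIV"
    and S: "((\<lambda>(j, k). a (j, k) * cis s ^ j * cis t ^ k) has_sum S) UNIV"
  shows "tser (\<lambda>k. tser (\<lambda>j. a (j, k)) s) t = S"
proof -
  have "((\<lambda>(k, j). a (j, k) * cis s ^ j * cis t ^ k) has_sum S) (UNIV \<times> UNIV)"
    using S has_sum_swap[where f = "\<lambda>(k, j). a (j, k) * cis s ^ j * cis t ^ k" and A = UNIV and B = UNIV] by (simp add: case_prod_unfold)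
  then have "((\<lambda>k. tser (\<lambda>j. a (j, k)) s * cis t ^ k) has_sum S) UNIV"
  proof (rule has_sum_SigmaD)
    fix k
    have "(\<lambda>j. norm (a (j, k) * cis s ^ j)) summable_on UNIV"
      using abs_summable_columns(1)[OF a, of k] by (simp add: norm_mult norm_power summable_on_UNIV_nonneg_real_iff)
    then have row: "(\<lambda>j. a (j, k) * cis s ^ j) summable_on UNIV" by (rule abs_summable_summable)
    have "((\<lambda>j. a (j, k) * cis s ^ j) has_sum tser (\<lambda>j. a (j, k)) s) UNIV"
      using has_sum_infsum[OF row] sums_unique[OF has_sum_imp_sums[OF has_sum_infsum[OF row]]] by (simp add: tser_def)
    then show "((\<lambda>j. case (k, j) of (k, j) \<Rightarrow> a (j, k) * cis s ^ j * cis t ^ k) has_sum tser (\<lambda>j. a (j, k)) s * cis t ^ k) UNIV"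
      by (simp add: has_sum_cmult_left)
  qed
  from sums_unique[OF has_sum_imp_sums[OF this]] show ?thesis by (simp add: tser_def[of _ t])
qed

text \<open>One-variable Parseval used twice: in t for fixed s, then in s column by column. The
  integral stays iterated, the form in which two functions of equal modulus on the torus are
  compared later.\<close>

lemma torus_parseval:
  fixes a :: "nat \<times> nat \<Rightarrow> complex"
  assumes a: "(\<lambda>u. norm (a u)) summable_on UNIV"
  shows "integral\<^sup>L (lebesgue_on {0..2*pi}) (\<lambda>s. integral\<^sup>L (lebesgue_on {0..2*pi})
      (\<lambda>t. (norm (tser (\<lambda>k. tser (\<lambda>j. a (j, k)) s) t))\<^sup>2)) = 4 * pi\<^sup>2 * (\<Sum>\<^sub>\<infinity>u. (norm (a u))\<^sup>2)"
    and "(\<lambda>u. (norm (a u))\<^sup>2) summable_on UNIV"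
proof -
  let ?M = "lebesgue_on {0..2*pi}"
  note col = abs_summable_columns(1)[OF a]
  define R where "R k s = tser (\<lambda>j. a (j, k)) s" for k s
  have R_sum: "summable (\<lambda>k. norm (R k s))" for s
    unfolding R_def by (rule tser_columns_summable[OF a])
  have R_cont: "continuous_on A (R k)" for A k
    unfolding R_def by (rule continuous_on_tser[OF col])
  obtain C where C: "\<And>u. norm (a u) \<le> C"
  proof
    show "norm (a u) \<le> infsum (\<lambda>u. norm (a u)) UNIV" for u
      using finite_sum_le_infsum[OF a, of "{u}"] by simp
  qed
  show sq: "(\<lambda>u. (norm (a u))\<^sup>2) summable_on UNIV"
    by (rule summable_on_comparison_test[OF summable_on_cmult_right[OF a, of C]])
      (auto simp: power2_eq_square C intro!: mult_right_mono)
  have sw: "((\<lambda>(k, j). (norm (a (j, k)))\<^sup>2) has_sum (\<Sum>\<^sub>\<infinity>u. (norm (a u))\<^sup>2)) (UNIV \<times> UNIV)"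
    using has_sum_infsum[OF sq] has_sum_swap[where f = "\<lambda>(k, j). (norm (a (j, k)))\<^sup>2" and A = UNIV and B = UNIV]
    by (simp add: case_prod_unfold)
  have sq_sums: "(\<lambda>k. \<Sum>j. (norm (a (j, k)))\<^sup>2) sums (\<Sum>\<^sub>\<infinity>u. (norm (a u))\<^sup>2)"
  proof (rule has_sum_imp_sums, rule has_sum_SigmaD[OF sw])
    fix k
    show "((\<lambda>j. case (k, j) of (k, j) \<Rightarrow> (norm (a (j, k)))\<^sup>2) has_sum (\<Sum>j. (norm (a (j, k)))\<^sup>2)) UNIV"
      using summable_square_of_summable[OF col[of k]] by (auto intro!: sums_nonneg_imp_has_sum summable_sums)
  qed
  have R_int: "integral\<^sup>L ?M (\<lambda>s. (norm (R k s))\<^sup>2) = 2 * pi * (\<Sum>j. (norm (a (j, k)))\<^sup>2)" for k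
    unfolding R_def by (rule parseval_norm[OF col])
  have "integral\<^sup>L ?M (\<lambda>s. integral\<^sup>L ?M (\<lambda>t. (norm (tser (\<lambda>k. R k s) t))\<^sup>2))
      = integral\<^sup>L ?M (\<lambda>s. 2 * pi * (\<Sum>k. (norm (R k s))\<^sup>2))"
    by (simp add: parseval_norm[OF R_sum])
  also have "\<dots> = 2 * pi * integral\<^sup>L ?M (\<lambda>s. \<Sum>k. (norm (R k s))\<^sup>2)" by simp
  also have "integral\<^sup>L ?M (\<lambda>s. \<Sum>k. (norm (R k s))\<^sup>2) = (\<Sum>k. integral\<^sup>L ?M (\<lambda>s. (norm (R k s))\<^sup>2))"
  proof (rule integral_suminf)
    show "integrable ?M (\<lambda>s. (norm (R k s))\<^sup>2)" for k
      by (intro continuous_imp_integrable_real continuous_intros R_cont)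
    show "AE s in ?M. summable (\<lambda>k. norm ((norm (R k s))\<^sup>2))"
      using summable_square_of_summable[OF R_sum] by simp
    show "summable (\<lambda>k. integral\<^sup>L ?M (\<lambda>s. norm ((norm (R k s))\<^sup>2)))"
      using sums_summable[OF sq_sums] by (simp add: R_int)
  qed
  also have "\<dots> = 2 * pi * (\<Sum>\<^sub>\<infinity>u. (norm (a u))\<^sup>2)"
    using sums_mult[OF sq_sums, of "2 * pi"] by (simp add: R_int sums_iff)
  finally show "integral\<^sup>L ?M (\<lambda>s. integral\<^sup>L ?M (\<lambda>t. (norm (tser (\<lambda>k. tser (\<lambda>j. a (j, k)) s) t))\<^sup>2))
      = 4 * pi\<^sup>2 * (\<Sum>\<^sub>\<infinity>u. (norm (a u))\<^sup>2)"
    by (simp add: R_def power2_eq_square)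
qed

section \<open>Multiplication by the inner function\<close>

lemma fn2_abs_summable:
  assumes "norm z1 < 1" "norm z2 < 1"
  shows "(\<lambda>(j, k). norm (ell2_coef x (j, k) * z1 ^ j * z2 ^ k)) summable_on UNIV"
proof -
  have "(\<lambda>u. norm (ell2_coef x u * cnj (ell2_coef (kern2 (z1, z2)) u))) summable_on UNIV"
    by (rule ell2_ip_abs_summable)
  moreover have "(\<lambda>u. norm (ell2_coef x u * cnj (ell2_coef (kern2 (z1, z2)) u)))
      = (\<lambda>(j, k). norm (ell2_coef x (j, k) * z1 ^ j * z2 ^ k))"
    by (auto simp: fun_eq_iff kern2_coef[OF assms] mult.assoc)
  ultimately show ?thesis by simp
qed

text \<open>For \<open>r < 1\<close> the reflection of \<open>p\<^sub>r(z) = p(rz)\<close> divided by \<open>p\<^sub>r\<close> is unimodular on the torus, so multiplying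
  the dilation of \<open>x\<close> by it preserves the norm; the coefficients of the product converge as \<open>r \<rightarrow> 1\<close>.\<close>
lemma inner_function_multiplies_H2:
  fixes x :: "(nat \<times> nat) ell2"
  assumes nz: "\<And>z1 z2. norm z1 < 1 \<Longrightarrow> norm z2 < 1 \<Longrightarrow> eval2 p z1 z2 \<noteq> 0"
    and deg: "deg1 p \<le> m" "deg2 p \<le> n"
  obtains y where "fn2 y = restr2 (\<lambda>(z1, z2). eval2 (ptilde m n p) z1 z2 / eval2 p z1 z2 * fn2 x (z1, z2))"
proof -
  obtain d :: "nat \<times> nat \<Rightarrow> complex" where d: "\<And>z1 z2. norm z1 < 1 \<Longrightarrow> norm z2 < 1 \<Longrightarrow>
      (\<lambda>(j, k). norm (d (j, k) * z1 ^ j * z2 ^ k)) summable_on UNIV \<and>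
      ((\<lambda>(j, k). d (j, k) * z1 ^ j * z2 ^ k) has_sum (1 / eval2 p z1 z2)) UNIV"
    using reciprocal_double_series[OF nz] by blast
  \<comment> \<open>Coefficients of x/p. This quotient is holomorphic but need not lie in H^2, as
    1/p may be unbounded.\<close>
  define \<eta> where "\<eta> = conv2 d (ell2_coef x)"
  have \<eta>: "((\<lambda>(j, k). \<eta> (j, k) * z1 ^ j * z2 ^ k) has_sum (1 / eval2 p z1 z2 * fn2 x (z1, z2))) UNIV"
    "(\<lambda>(j, k). norm (\<eta> (j, k) * z1 ^ j * z2 ^ k)) summable_on UNIV" if "norm z1 < 1" "norm z2 < 1" for z1 z2
  proof -
    have eq: "(\<lambda>(j, k). \<eta> (j, k) * z1 ^ j * z2 ^ k)
        = conv2 (\<lambda>(j, k). d (j, k) * z1 ^ j * z2 ^ k) (\<lambda>(j, k). ell2_coef x (j, k) * z1 ^ j * z2 ^ k)"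
      by (auto simp: fun_eq_iff conv2_scale \<eta>_def)
    have "(\<lambda>u. norm (case u of (j, k) \<Rightarrow> d (j, k) * z1 ^ j * z2 ^ k)) summable_on UNIV"
      "(\<lambda>u. norm (case u of (j, k) \<Rightarrow> ell2_coef x (j, k) * z1 ^ j * z2 ^ k)) summable_on UNIV"
      using d[OF that] fn2_abs_summable[OF that, of x] by (simp_all add: case_prod_unfold)
    note * = conv2_has_sum[OF this(1) conjunct2[OF d[OF that]] this(2) fn2_has_sum[OF that]]
    show "((\<lambda>(j, k). \<eta> (j, k) * z1 ^ j * z2 ^ k) has_sum (1 / eval2 p z1 z2 * fn2 x (z1, z2))) UNIV"
      unfolding eq by (rule *(1))
    show "(\<lambda>(j, k). norm (\<eta> (j, k) * z1 ^ j * z2 ^ k)) summable_on UNIV"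
      using *(2) unfolding eq[symmetric] by (simp add: case_prod_unfold)
  qed
  \<comment> \<open>Coefficients of the bidegree (m, n) reflection of p(rz); at r = 1 they are those
    of \<open>ptilde m n p\<close>.\<close>
  define e where "e r = (\<lambda>(j, k). if j \<le> m \<and> k \<le> n
      then cnj (coeff2 p (m - j) (n - k)) * of_real r ^ (m - j) * of_real r ^ (n - k) else 0)" for r :: real
  have e0: "e r (j, k) = 0" if "\<not> (j \<le> m \<and> k \<le> n)" for r j k
    using that by (auto simp: e_def)
  have e_fin: "finite {u. e r u \<noteq> 0}" for r
    by (rule finite_subset[of _ "{..m} \<times> {..n}"]) (auto simp: e_def split: if_splits)
  have e_sum: "((\<lambda>(j, k). e r (j, k) * w1 ^ j * w2 ^ k) has_sum (\<Sum>k\<le>n. \<Sum>j\<le>m. e r (j, k) * w1 ^ j * w2 ^ k)) UNIV"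
    "(\<lambda>u. norm (case u of (j, k) \<Rightarrow> e r (j, k) * w1 ^ j * w2 ^ k)) summable_on UNIV" for r w1 w2
  proof -
    have "(\<Sum>k\<le>n. \<Sum>j\<le>m. e r (j, k) * w1 ^ j * w2 ^ k) = (\<Sum>j\<le>m. \<Sum>k\<le>n. e r (j, k) * w1 ^ j * w2 ^ k)"
      by (rule sum.swap)
    also have "\<dots> = (\<Sum>(j, k)\<in>{..m} \<times> {..n}. e r (j, k) * w1 ^ j * w2 ^ k)"
      by (simp add: sum.cartesian_product)
    finally show "((\<lambda>(j, k). e r (j, k) * w1 ^ j * w2 ^ k) has_sum (\<Sum>k\<le>n. \<Sum>j\<le>m. e r (j, k) * w1 ^ j * w2 ^ k)) UNIV"
      by (intro has_sum_finite_neutralI[of "{..m} \<times> {..n}"]) (use e0 in \<open>force+\<close>)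
    show "(\<lambda>u. norm (case u of (j, k) \<Rightarrow> e r (j, k) * w1 ^ j * w2 ^ k)) summable_on UNIV"
      by (rule finite_nonzero_values_imp_summable_on, rule finite_subset[OF _ e_fin[of r]]) auto
  qed
  \<comment> \<open>The coefficients of \<Theta> x. Their square-summability is the content of the
    lemma and is inherited from the uniform bound for r < 1.\<close>
  define \<alpha> where "\<alpha> = conv2 (e 1) \<eta>"
  have bound: "(\<Sum>u\<in>A. (norm (conv2 (e r) (\<lambda>(j, k). \<eta> (j, k) * of_real r ^ j * of_real r ^ k) u))\<^sup>2) \<le> (norm x)\<^sup>2"
    if "finite A" and r: "0 \<le> r" "r < 1" for A r
  proof -
    have nr: "norm (complex_of_real r) < 1" using r by simp
    define h where "h = (\<lambda>(j, k). \<eta> (j, k) * of_real r ^ j * of_real r ^ k)"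
    define a where "a = conv2 (e r) h"
    define b where "b = (\<lambda>(j, k). ell2_coef x (j, k) * of_real r ^ j * of_real r ^ k)"
    have h_abs: "(\<lambda>u. norm (h u)) summable_on UNIV" and b_abs: "(\<lambda>u. norm (b u)) summable_on UNIV"
      using \<eta>(2)[OF nr nr] fn2_abs_summable[OF nr nr, of x] by (simp_all add: h_def b_def case_prod_unfold)
    have e_abs: "(\<lambda>u. norm (e r u)) summable_on UNIV"
      by (rule finite_nonzero_values_imp_summable_on, rule finite_subset[OF _ e_fin[of r]]) auto
    have a_abs: "(\<lambda>u. norm (a u)) summable_on UNIV"
      unfolding a_def using conv2_has_sum(2)[OF e_abs _ h_abs] has_sum_infsum[OF abs_summable_summable[OF e_abs]]
        has_sum_infsum[OF abs_summable_summable[OF h_abs]] by blast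
    have eq: "norm (tser (\<lambda>k. tser (\<lambda>j. a (j, k)) s) t) = norm (tser (\<lambda>k. tser (\<lambda>j. b (j, k)) s) t)" for s t
    proof -
      define z1 z2 where "z1 = of_real r * cis s" and "z2 = of_real r * cis t"
      have z: "norm z1 < 1" "norm z2 < 1" using r by (simp_all add: z1_def z2_def norm_mult)
      have hz: "(\<lambda>(j, k). h (j, k) * cis s ^ j * cis t ^ k) = (\<lambda>(j, k). \<eta> (j, k) * z1 ^ j * z2 ^ k)"
        by (auto simp: fun_eq_iff h_def z1_def z2_def power_mult_distrib mult_ac)
      have bz: "(\<lambda>(j, k). b (j, k) * cis s ^ j * cis t ^ k) = (\<lambda>(j, k). ell2_coef x (j, k) * z1 ^ j * z2 ^ k)"
        by (auto simp: fun_eq_iff b_def z1_def z2_def power_mult_distrib mult_ac)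
      define E where "E = (\<Sum>k\<le>n. \<Sum>j\<le>m. e r (j, k) * cis s ^ j * cis t ^ k)"
      have az: "(\<lambda>(j, k). a (j, k) * cis s ^ j * cis t ^ k)
          = conv2 (\<lambda>(j, k). e r (j, k) * cis s ^ j * cis t ^ k) (\<lambda>(j, k). h (j, k) * cis s ^ j * cis t ^ k)"
        by (auto simp: fun_eq_iff conv2_scale a_def)
      have "(\<lambda>u. norm (case u of (j, k) \<Rightarrow> \<eta> (j, k) * z1 ^ j * z2 ^ k)) summable_on UNIV"
        using \<eta>(2)[OF z] by (simp add: case_prod_unfold)
      then have "((\<lambda>(j, k). a (j, k) * cis s ^ j * cis t ^ k) has_sum (E * (1 / eval2 p z1 z2 * fn2 x (z1, z2)))) UNIV"
        unfolding az hz E_def by (intro conv2_has_sum(1) e_sum \<eta>(1)[OF z])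
      then have A: "tser (\<lambda>k. tser (\<lambda>j. a (j, k)) s) t = E * (1 / eval2 p z1 z2 * fn2 x (z1, z2))"
        by (rule tser_double_eqI[OF a_abs])
      have B: "tser (\<lambda>k. tser (\<lambda>j. b (j, k)) s) t = fn2 x (z1, z2)"
        by (rule tser_double_eqI[OF b_abs]) (unfold bz, rule fn2_has_sum[OF z])
      \<comment> \<open>On the torus a reflected polynomial is a unimodular monomial times the
        conjugate of the original, so its modulus cancels that of the denominator.\<close>
      have "E = cis s ^ m * cis t ^ n * cnj (eval2 p z1 z2)"
      proof -
        have cis_pow: "cis a ^ j = cis a ^ N * cnj (cis a ^ (N - j))" if "j \<le> N" for a j N
        proof -
          have "cis a ^ N = cis a ^ j * cis a ^ (N - j)" using that by (simp flip: power_add)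
          moreover have "cis a ^ (N - j) * cnj (cis a ^ (N - j)) = 1"
            by (simp add: complex_norm_square[symmetric] norm_power del: complex_cnj_power)
          ultimately show ?thesis by (simp add: mult.assoc)
        qed
        have "E = (\<Sum>k\<le>n. \<Sum>j\<le>m. cis s ^ m * cis t ^ n * cnj (coeff2 p (m - j) (n - k) * z1 ^ (m - j) * z2 ^ (n - k)))"
          unfolding E_def
        proof (intro sum.cong refl)
          fix k j assume "k \<in> {..n}" "j \<in> {..m}"
          then have jk: "j \<le> m" "k \<le> n" by auto
          show "e r (j, k) * cis s ^ j * cis t ^ k
              = cis s ^ m * cis t ^ n * cnj (coeff2 p (m - j) (n - k) * z1 ^ (m - j) * z2 ^ (n - k))"
            unfolding cis_pow[OF jk(1), of s] cis_pow[OF jk(2), of t]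
            using jk by (simp add: e_def z1_def z2_def power_mult_distrib mult_ac)
        qed
        also have "\<dots> = cis s ^ m * cis t ^ n * cnj (\<Sum>k\<le>n. \<Sum>j\<le>m. coeff2 p (m - j) (n - k) * z1 ^ (m - j) * z2 ^ (n - k))"
          by (simp add: sum_distrib_left)
        also have "(\<Sum>k\<le>n. \<Sum>j\<le>m. coeff2 p (m - j) (n - k) * z1 ^ (m - j) * z2 ^ (n - k)) = eval2 p z1 z2"
        proof -
          have rev: "(\<Sum>j\<le>N. f (N - j)) = (\<Sum>j\<le>N. f j)" for f :: "nat \<Rightarrow> complex" and N
            by (rule sum.reindex_bij_witness[where i = "\<lambda>j. N - j" and j = "\<lambda>j. N - j"]) auto
          have "(\<Sum>k\<le>n. \<Sum>j\<le>m. coeff2 p (m - j) (n - k) * z1 ^ (m - j) * z2 ^ (n - k))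
              = (\<Sum>k\<le>n. \<Sum>j\<le>m. coeff2 p (m - j) k * z1 ^ (m - j) * z2 ^ k)"
            by (rule rev)
          also have "\<dots> = (\<Sum>k\<le>n. \<Sum>j\<le>m. coeff2 p j k * z1 ^ j * z2 ^ k)"
            by (intro sum.cong refl rev)
          finally show ?thesis unfolding eval2_double_sum[OF deg] .
        qed
        finally show ?thesis .
      qed
      then have "norm E = norm (eval2 p z1 z2)" by (simp add: norm_mult norm_power)
      then show ?thesis unfolding A B using nz[OF z] by (simp add: norm_mult norm_divide)
    qed
    have "4 * pi\<^sup>2 * (\<Sum>\<^sub>\<infinity>u. (norm (a u))\<^sup>2) = 4 * pi\<^sup>2 * (\<Sum>\<^sub>\<infinity>u. (norm (b u))\<^sup>2)"
      unfolding torus_parseval(1)[OF a_abs, symmetric] torus_parseval(1)[OF b_abs, symmetric] eq ..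
    then have "(\<Sum>\<^sub>\<infinity>u. (norm (a u))\<^sup>2) = (\<Sum>\<^sub>\<infinity>u. (norm (b u))\<^sup>2)" by simp
    also have "\<dots> \<le> (\<Sum>\<^sub>\<infinity>u. (norm (ell2_coef x u))\<^sup>2)"
    proof (rule infsum_mono[OF torus_parseval(2)[OF b_abs] ell2_square_summable])
      fix u :: "nat \<times> nat"
      obtain j k where u: "u = (j, k)" by (cases u)
      have "b u = ell2_coef x u * of_real r ^ (j + k)" by (simp add: u b_def power_add mult.assoc)
      then show "(norm (b u))\<^sup>2 \<le> (norm (ell2_coef x u))\<^sup>2"
        using r norm_power_mult_le[of r "ell2_coef x u" "j + k"] by simp
    qed
    finally have "(\<Sum>\<^sub>\<infinity>u. (norm (a u))\<^sup>2) \<le> (norm x)\<^sup>2" by (simp add: norm_ell2_square)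
    moreover have "(\<Sum>u\<in>A. (norm (a u))\<^sup>2) \<le> (\<Sum>\<^sub>\<infinity>u. (norm (a u))\<^sup>2)"
      by (rule finite_sum_le_infsum[OF torus_parseval(2)[OF a_abs] \<open>finite A\<close>]) auto
    ultimately show ?thesis by (simp add: a_def h_def)
  qed
  \<comment> \<open>Each coefficient of the product is a finite sum and so converges as r tends to
    1; the bound over a finite index set passes to the limit.\<close>
  have fin: "(\<Sum>u\<in>A. (norm (\<alpha> u))\<^sup>2) \<le> (norm x)\<^sup>2" if "finite A" for A
  proof (rule LIMSEQ_le_const2)
    define \<rho> where "\<rho> n = 1 - inverse (real (Suc n))" for n
    have \<rho>: "0 \<le> \<rho> n" "\<rho> n < 1" for n by (auto simp: \<rho>_def field_simps)
    have lim: "\<rho> \<longlonglongrightarrow> 1" unfolding \<rho>_def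
      using tendsto_diff[OF tendsto_const LIMSEQ_inverse_real_of_nat, of 1] by simp
    have e_lim: "(\<lambda>i. e (\<rho> i) u) \<longlonglongrightarrow> e 1 u" for u
    proof (cases u)
      case (Pair j k)
      have "(\<lambda>i. cnj (coeff2 p (m - j) (n - k)) * of_real (\<rho> i) ^ (m - j) * of_real (\<rho> i) ^ (n - k))
          \<longlonglongrightarrow> cnj (coeff2 p (m - j) (n - k)) * of_real 1 ^ (m - j) * of_real 1 ^ (n - k)"
        by (intro tendsto_intros lim)
      then show ?thesis unfolding e_def Pair by auto
    qed
    have \<eta>_lim: "(\<lambda>i. (case u of (j, k) \<Rightarrow> \<eta> (j, k) * of_real (\<rho> i) ^ j * of_real (\<rho> i) ^ k)) \<longlonglongrightarrow> \<eta> u" for u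
    proof (cases u)
      case (Pair j k)
      have "(\<lambda>i. \<eta> (j, k) * of_real (\<rho> i) ^ j * of_real (\<rho> i) ^ k) \<longlonglongrightarrow> \<eta> (j, k) * of_real 1 ^ j * of_real 1 ^ k"
        by (intro tendsto_intros lim)
      then show ?thesis using Pair by simp
    qed
    show "(\<lambda>i. \<Sum>u\<in>A. (norm (conv2 (e (\<rho> i)) (\<lambda>(j, k). \<eta> (j, k) * of_real (\<rho> i) ^ j * of_real (\<rho> i) ^ k) u))\<^sup>2)
        \<longlonglongrightarrow> (\<Sum>u\<in>A. (norm (\<alpha> u))\<^sup>2)"
      unfolding \<alpha>_def conv2_def by (intro tendsto_sum tendsto_power tendsto_norm tendsto_mult e_lim \<eta>_lim)
    show "\<exists>N. \<forall>i\<ge>N. (\<Sum>u\<in>A. (norm (conv2 (e (\<rho> i)) (\<lambda>(j, k). \<eta> (j, k) * of_real (\<rho> i) ^ j * of_real (\<rho> i) ^ k) u))\<^sup>2) \<le> (norm x)\<^sup>2"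
      using bound[OF that \<rho>] by blast
  qed
  have "(\<lambda>u. (norm (\<alpha> u))\<^sup>2) summable_on UNIV"
    by (rule nonneg_bdd_above_summable_on) (use fin in \<open>auto simp: bdd_above_def\<close>)
  then obtain y where y: "ell2_coef y = \<alpha>" by (rule ell2_of_square_summable)
  show ?thesis
  proof (rule that[of y], rule ext)
    fix z :: "complex \<times> complex"
    obtain z1 z2 where zz: "z = (z1, z2)" by (cases z)
    show "fn2 y z = restr2 (\<lambda>(z1, z2). eval2 (ptilde m n p) z1 z2 / eval2 p z1 z2 * fn2 x (z1, z2)) z"
    proof (cases "z \<in> bidisk")
      case True
      then have z: "norm z1 < 1" "norm z2 < 1" by (auto simp: zz)
      have yz: "(\<lambda>(j, k). ell2_coef y (j, k) * z1 ^ j * z2 ^ k)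
          = conv2 (\<lambda>(j, k). e 1 (j, k) * z1 ^ j * z2 ^ k) (\<lambda>(j, k). \<eta> (j, k) * z1 ^ j * z2 ^ k)"
        by (auto simp: fun_eq_iff conv2_scale y \<alpha>_def)
      have "(\<lambda>u. norm (case u of (j, k) \<Rightarrow> \<eta> (j, k) * z1 ^ j * z2 ^ k)) summable_on UNIV"
        using \<eta>(2)[OF z] by (simp add: case_prod_unfold)
      then have "((\<lambda>(j, k). ell2_coef y (j, k) * z1 ^ j * z2 ^ k) has_sum
          ((\<Sum>k\<le>n. \<Sum>j\<le>m. e 1 (j, k) * z1 ^ j * z2 ^ k) * (1 / eval2 p z1 z2 * fn2 x (z1, z2)))) UNIV"
        unfolding yz by (intro conv2_has_sum(1) e_sum \<eta>(1)[OF z])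
      moreover have "(\<Sum>k\<le>n. \<Sum>j\<le>m. e 1 (j, k) * z1 ^ j * z2 ^ k) = eval2 (ptilde m n p) z1 z2"
        unfolding eval2_ptilde by (intro sum.cong refl) (simp add: e_def)
      ultimately have "fn2 y (z1, z2) = eval2 (ptilde m n p) z1 z2 * (1 / eval2 p z1 z2 * fn2 x (z1, z2))"
        using fn2_eqI[OF z] by simp
      then show ?thesis using z by (simp add: zz restr2_def)
    qed (simp add: fn2_def restr2_def)
  qed
qed

section \<open>Rationality of the symbol\<close>

text \<open>Gaussian elimination over the ring of polynomials.\<close>
lemma rational_solution:
  fixes Q :: "nat \<Rightarrow> nat \<Rightarrow> complex poly" and R :: "nat \<Rightarrow> complex poly" and \<Phi> :: "nat \<Rightarrow> complex \<Rightarrow> complex"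
  assumes "\<And>g. (\<And>t. (\<Sum>j<m. Q t j * g j) = 0) \<Longrightarrow> \<forall>j<m. g j = 0"
    and "\<And>t z. z \<in> S \<Longrightarrow> (\<Sum>j<m. poly (Q t j) z * \<Phi> j z) = poly (R t) z"
  shows "\<forall>j<m. \<exists>D N. D \<noteq> 0 \<and> (\<forall>z\<in>S. poly D z * \<Phi> j z = poly N z)"
  using assms
proof (induction m arbitrary: Q R)
  case (Suc m)
  note indep = Suc.prems(1) and eqs = Suc.prems(2)
  obtain t0 where t0: "Q t0 m \<noteq> 0"
  proof (rule ccontr)
    assume "\<not> thesis"
    then have "Q t m = 0" for t using that by blast
    then have "(\<Sum>j<Suc m. Q t j * (if j = m then 1 else 0)) = 0" for t by (simp add: if_distrib cong: if_cong)
    from indep[of "\<lambda>j. if j = m then 1 else 0", OF this] show False by auto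
  qed
  \<comment> \<open>The pivot. Cross-multiplying with it instead of dividing keeps the reduced
    system over the polynomials.\<close>
  define a where "a = Q t0 m"
  define Q' where "Q' t j = a * Q t j - Q t m * Q t0 j" for t j
  define R' where "R' t = a * R t - Q t m * R t0" for t
  have IH: "\<forall>j<m. \<exists>D N. D \<noteq> 0 \<and> (\<forall>z\<in>S. poly D z * \<Phi> j z = poly N z)"
  proof (rule Suc.IH[of Q' R'])
    fix g assume g: "\<And>t. (\<Sum>j<m. Q' t j * g j) = 0"
    \<comment> \<open>A relation among the reduced columns, multiplied by the pivot, lifts to the
      original columns; the pivot row dictates the last entry.\<close>
    define h where "h j = (if j = m then - (\<Sum>j<m. Q t0 j * g j) else a * g j)" for j
    have "(\<Sum>j<Suc m. Q t j * h j) = 0" for t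
    proof -
      have "(\<Sum>j<Suc m. Q t j * h j) = (\<Sum>j<m. Q t j * (a * g j)) - Q t m * (\<Sum>j<m. Q t0 j * g j)"
        by (simp add: h_def)
      also have "\<dots> = (\<Sum>j<m. Q' t j * g j)"
        by (simp add: Q'_def sum_distrib_left sum_subtractf[symmetric] algebra_simps)
      finally show ?thesis using g by simp
    qed
    from indep[of h, OF this] have "a * g j = 0" if "j < m" for j
      using that by (metis h_def less_SucI less_irrefl)
    then show "\<forall>j<m. g j = 0" using t0 by (simp add: a_def)
  next
    fix t z assume z: "z \<in> S"
    have full: "(\<Sum>j<m. poly (Q t j) z * \<Phi> j z) = poly (R t) z - poly (Q t m) z * \<Phi> m z" for t
      using eqs[OF z, of t] by (simp add: algebra_simps)
    have "(\<Sum>j<m. poly (Q' t j) z * \<Phi> j z)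
        = poly a z * (\<Sum>j<m. poly (Q t j) z * \<Phi> j z) - poly (Q t m) z * (\<Sum>j<m. poly (Q t0 j) z * \<Phi> j z)"
      by (simp add: Q'_def sum_distrib_left sum_subtractf[symmetric] algebra_simps)
    also have "\<dots> = poly (R' t) z"
      unfolding full by (simp add: R'_def a_def algebra_simps)
    finally show "(\<Sum>j<m. poly (Q' t j) z * \<Phi> j z) = poly (R' t) z" .
  qed
  then obtain D N where DN: "\<And>j. j < m \<Longrightarrow> D j \<noteq> 0" "\<And>j z. j < m \<Longrightarrow> z \<in> S \<Longrightarrow> poly (D j) z * \<Phi> j z = poly (N j) z"
    by metis
  define DD where "DD = (\<Prod>j<m. D j)"
  define E where "E j = (\<Prod>i\<in>{..<m} - {j}. D i)" for j
  have DE: "DD = D j * E j" if "j < m" for j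
    unfolding DD_def E_def using that by (subst prod.remove[of _ j]) auto
  have "\<exists>D N. D \<noteq> 0 \<and> (\<forall>z\<in>S. poly D z * \<Phi> m z = poly N z)"
  proof (intro exI conjI ballI)
    show "a * DD \<noteq> 0" using t0 DN(1) by (simp add: a_def DD_def)
    fix z assume z: "z \<in> S"
    have "poly DD z * (poly (Q t0 j) z * \<Phi> j z) = poly (Q t0 j * E j * N j) z" if "j < m" for j
      using DN(2)[OF that z] by (simp add: DE[OF that] mult_ac)
    then have "poly DD z * (\<Sum>j<m. poly (Q t0 j) z * \<Phi> j z) = poly (\<Sum>j<m. Q t0 j * E j * N j) z"
      unfolding sum_distrib_left poly_sum by (intro sum.cong) auto
    moreover have "poly a z * \<Phi> m z = poly (R t0) z - (\<Sum>j<m. poly (Q t0 j) z * \<Phi> j z)"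
      using eqs[OF z, of t0] by (simp add: a_def algebra_simps)
    ultimately show "poly (a * DD) z * \<Phi> m z = poly (DD * R t0 - (\<Sum>j<m. Q t0 j * E j * N j)) z"
      by (simp add: algebra_simps) (metis (no_types, lifting) add_diff_cancel_right' diff_add_cancel mult.commute mult.left_commute right_diff_distrib)
  qed
  with IH show ?case by (auto simp: less_Suc_eq)
qed simp

text \<open>A rational function in \<open>H\<^sup>2\<close> has no poles on the closed disk, since functions in \<open>H\<^sup>2\<close> grow at most like \<open>(1 - \<bar>z\<bar>)\<^sup>-\<^sup>1\<^sup>/\<^sup>2\<close>.\<close>
lemma rational_H2_pole_free:
  fixes x :: "nat ell2"
  assumes "D \<noteq> 0" "\<And>z. norm z < 1 \<Longrightarrow> poly D z * fn1 x z = poly N z"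
  shows "\<exists>A B. (\<forall>w\<in>cball 0 1. poly B w \<noteq> 0) \<and> (\<forall>z. norm z < 1 \<longrightarrow> fn1 x z = poly A z / poly B z)"
  using assms
proof (induction "degree D" arbitrary: D N rule: less_induct)
  case less
  show ?case
  proof (cases "\<forall>w\<in>cball 0 1. poly D w \<noteq> 0")
    case True
    have "fn1 x z = poly N z / poly D z" if "norm z < 1" for z
    proof -
      have "poly D z \<noteq> 0" using True that by auto
      then show ?thesis using less.prems(2)[OF that] by (simp add: field_simps)
    qed
    with True show ?thesis by blast
  next
    case False
    then obtain w where w: "norm w \<le> 1" "poly D w = 0" by auto
    then obtain D' where D': "D = [:- w, 1:] * D'" by (auto simp: poly_eq_0_iff_dvd elim: dvdE)
    have "D' \<noteq> 0" using less.prems(1) D' by auto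
    \<comment> \<open>D and N share the factor z - w: inside the disk because the equation holds at
      w, on the circle because N is bounded along the radius by a multiple of sqrt(1 - \<rho>).
      Cancelling the factor lowers the degree.\<close>
    have "poly N w = 0"
    proof (cases "norm w < 1")
      case True
      then show ?thesis using less.prems(2)[OF True] w by simp
    next
      case False
      with w have nw: "norm w = 1" by simp
      have "bounded (poly D' ` cball 0 1)"
        by (intro compact_imp_bounded compact_continuous_image continuous_intros) auto
      then obtain K where K: "K > 0" "\<And>z. z \<in> cball 0 1 \<Longrightarrow> norm (poly D' z) \<le> K"
        unfolding bounded_pos by auto
      define \<rho> where "\<rho> n = 1 - inverse (real (Suc n))" for n
      have \<rho>: "0 \<le> \<rho> n" "\<rho> n < 1" for n by (auto simp: \<rho>_def field_simps)
      have lim: "\<rho> \<longlonglongrightarrow> 1" unfolding \<rho>_def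
        using tendsto_diff[OF tendsto_const LIMSEQ_inverse_real_of_nat, of 1] by simp
      have bound: "norm (poly N (of_real (\<rho> n) * w)) \<le> K * norm x * sqrt (1 - \<rho> n)" for n
      proof -
        define r where "r = \<rho> n"
        have r: "0 \<le> r" "r < 1" using \<rho>[of n] by (auto simp: r_def)
        define z where "z = of_real r * w"
        have nz: "norm z = r" using r nw by (simp add: z_def norm_mult)
        have "norm (z - w) = 1 - r"
        proof -
          have "z - w = of_real (r - 1) * w" by (simp add: z_def algebra_simps)
          then show ?thesis using r nw by (simp only: norm_mult norm_of_real) simp
        qed
        have "poly N z = (z - w) * poly D' z * fn1 x z"
          using less.prems(2)[of z] nz r by (auto simp: D' algebra_simps)
        then have "norm (poly N z) = (1 - r) * norm (poly D' z) * norm (fn1 x z)"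
          using \<open>norm (z - w) = 1 - r\<close> by (simp add: norm_mult)
        also have "\<dots> \<le> (1 - r) * K * (norm x / sqrt (1 - r\<^sup>2))"
          using K(2)[of z] norm_fn1_le[of z x] nz r K(1) by (intro mult_mono) auto
        also have "\<dots> \<le> (1 - r) * K * (norm x / sqrt (1 - r))"
        proof -
          have "1 - r \<le> 1 - r\<^sup>2" using r by (simp add: power2_eq_square mult_left_le)
          then show ?thesis using r K(1) by (intro mult_left_mono divide_left_mono) auto
        qed
        also have "\<dots> = K * norm x * sqrt (1 - r)"
        proof -
          have "(1 - r) / sqrt (1 - r) = sqrt (1 - r)" using r by (intro real_div_sqrt) simp
          then show ?thesis by (metis (no_types, opaque_lifting) mult.assoc mult.commute times_divide_eq_right)
        qed
        finally show ?thesis by (simp add: r_def z_def)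
      qed
      have "(\<lambda>n. K * norm x * sqrt (1 - \<rho> n)) \<longlonglongrightarrow> K * norm x * sqrt (1 - 1)"
        by (intro tendsto_intros lim)
      then have "(\<lambda>n. K * norm x * sqrt (1 - \<rho> n)) \<longlonglongrightarrow> 0" by simp
      from Lim_null_comparison[OF always_eventually[OF allI[OF bound]] this]
      have "(\<lambda>n. poly N (of_real (\<rho> n) * w)) \<longlonglongrightarrow> 0" .
      moreover have "(\<lambda>n. poly N (of_real (\<rho> n) * w)) \<longlonglongrightarrow> poly N (of_real 1 * w)"
        by (intro tendsto_intros lim)
      ultimately have "poly N (of_real 1 * w) = 0" using LIMSEQ_unique by blast
      then show ?thesis by simp
    qed
    then obtain N' where N': "N = [:- w, 1:] * N'" by (auto simp: poly_eq_0_iff_dvd elim: dvdE)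
    have off: "poly D' z * fn1 x z = poly N' z" if "norm z < 1" "z \<noteq> w" for z
    proof -
      have "(z - w) * (poly D' z * fn1 x z) = (z - w) * poly N' z"
        using less.prems(2)[OF that(1)] by (simp add: D' N' algebra_simps)
      then show ?thesis using that(2) by simp
    qed
    \<comment> \<open>Cancellation is immediate away from w; at w itself, when it lies in the open
      disk, the equation follows by continuity.\<close>
    have "poly D' z * fn1 x z = poly N' z" if "norm z < 1" for z
    proof (cases "z = w")
      case True
      have "isCont (fn1 x) w"
        using fn1_holomorphic[of x] that True
        by (metis at_within_ball continuous_on_eq_continuous_at centre_in_ball dist_0_norm holomorphic_on_imp_continuous_on mem_ball open_ball)
      then have "((\<lambda>z. poly D' z * fn1 x z) \<longlongrightarrow> poly D' w * fn1 x w) (at w)"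
        by (intro tendsto_intros) (auto simp: isCont_def)
      moreover have "((\<lambda>z. poly D' z * fn1 x z) \<longlongrightarrow> poly N' w) (at w)"
      proof (rule Lim_transform_eventually)
        show "(poly N' \<longlongrightarrow> poly N' w) (at w)" by (intro tendsto_intros)
        have "\<forall>\<^sub>F z in at w. z \<in> ball 0 1 - {w}"
          using that True by (intro eventually_at_in_open) auto
        then show "\<forall>\<^sub>F z in at w. poly N' z = poly D' z * fn1 x z"
          by eventually_elim (use off in auto)
      qed
      ultimately show ?thesis using True by (metis tendsto_unique trivial_limit_at)
    qed (use off that in blast)
    moreover have "degree D' < degree D"
      unfolding D' using \<open>D' \<noteq> 0\<close> by (subst degree_mult_eq) auto
    ultimately show ?thesis using less.hyps \<open>D' \<noteq> 0\<close> by blast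
  qed
qed

section \<open>The compressed shift as a Toeplitz operator\<close>

lemma shift2_linear: "shift2 (x + y) = shift2 x + shift2 y" "shift2 (sc c x) = sc c (shift2 x)"
  by (auto intro!: ell2_eqI)

lemma bounded_linear_shift2_power: "bounded_linear (shift2 ^^ k)"
proof (induction k)
  case (Suc k)
  have "norm (shift2 x) = norm x" for x
    using ip_shift2[of x x] unfolding ip_self_norm of_real_eq_iff by (simp add: power2_eq_iff_nonneg)
  then have "bounded_linear shift2"
    by (intro bounded_linear_intro[where K = 1]) (auto simp: shift2_linear scaleR_eq_sc)
  from bounded_linear_compose[OF this Suc.IH] show ?case by (simp add: o_def)
qed (simp add: id_def)

lemma fn2_shift2_power: "fn2 ((shift2 ^^ k) x) z = snd z ^ k * fn2 x z"
  by (induction k) (auto simp: fn2_shift2 Mz2_def)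

lemma bshift1_shift2_power: "bshift1 ((shift2 ^^ k) x) = (shift2 ^^ k) (bshift1 x)"
  by (induction k) (auto simp: bshift1_shift2)

lemma shift2_power_sc: "(shift2 ^^ k) (sc c x) = sc c ((shift2 ^^ k) x)"
  by (induction k) (auto simp: shift2_linear)

lemma nat_ell2_of_square_summable:
  fixes c :: "nat \<Rightarrow> complex"
  assumes "summable (\<lambda>k. (norm (c k))\<^sup>2)"
  obtains x where "ell2_coef x = c"
  using ell2_of_square_summable[of c] assms by (auto simp: summable_on_UNIV_nonneg_real_iff)

lemma ip_suminf: "ip x y = (\<Sum>k. ell2_coef x k * cnj (ell2_coef y k))"
  unfolding ip_def using has_sum_imp_sums[OF has_sum_infsum[OF ell2_ip_summable]] by (rule sums_unique)

lemma fn1_zero: "fn1 0 = (\<lambda>_. 0)"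
  by (auto simp: fn1_def)

text \<open>Components from index m on are 0 in \<open>H2vec\<close>, so the coefficient vectors are
  normalised likewise and equality needs to be tested only below m.\<close>

lemma H2vec_iff: "F \<in> H2vec m \<longleftrightarrow> (\<exists>c. F = (\<lambda>i. fn1 (c i)) \<and> (\<forall>i\<ge>m. c i = 0))"
proof
  assume F: "F \<in> H2vec m"
  have "\<exists>x. F i = fn1 x \<and> (i \<ge> m \<longrightarrow> x = 0)" for i
  proof (cases "i < m")
    case True
    then have "F i \<in> range fn1" using F by (simp add: H2vec_def H2one_eq)
    then show ?thesis using True by auto
  next
    case False
    then have "F i = fn1 0" using F by (simp add: H2vec_def fn1_zero)
    then show ?thesis by blast
  qed
  then obtain c where "\<And>i. F i = fn1 (c i) \<and> (i \<ge> m \<longrightarrow> c i = 0)" by metis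
  then show "\<exists>c. F = (\<lambda>i. fn1 (c i)) \<and> (\<forall>i\<ge>m. c i = 0)" by (intro exI[of _ c]) auto
qed (auto simp: H2vec_def H2one_eq fn1_zero)

text \<open>\<open>zcol t q\<close> is the coefficient of \<open>z\<^sub>1\<^sup>t\<close> in \<open>q\<close>, a polynomial in \<open>z\<^sub>2\<close>.\<close>
definition zcol :: "nat \<Rightarrow> complex poly poly \<Rightarrow> complex poly" where
  "zcol t q = map_poly (\<lambda>c. coeff c t) q"

text \<open>The encoding orders a polynomial by powers of z_2, whereas the linear system compares
  powers of z_1. Stating the reordering as an infinite series lets polynomials of different degrees
  be compared uniformly.\<close>

lemma zcol_sums: "(\<lambda>t. poly (zcol t q) z2 * z1 ^ t) sums eval2 q z1 z2"
proof -
  have zc: "poly (zcol t q) z2 = (\<Sum>k\<le>degree q. coeff2 q t k * z2 ^ k)" for t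
  proof -
    have c: "coeff (zcol t q) k = coeff2 q t k" for k by (simp add: zcol_def coeff_map_poly coeff2_def)
    have "degree (zcol t q) \<le> degree q"
      by (intro degree_le) (simp add: c coeff2_def coeff_eq_0)
    then show ?thesis by (simp add: poly_sum_le[of _ "degree q"] c)
  qed
  have "(\<lambda>t. poly (zcol t q) z2 * z1 ^ t) sums (\<Sum>t\<le>deg1 q. poly (zcol t q) z2 * z1 ^ t)"
  proof (rule sums_finite)
    fix t assume "t \<notin> {..deg1 q}"
    then have "coeff2 q t k = 0" for k
      unfolding coeff2_def using degree_coeff_le_deg1[of q k] by (intro coeff_eq_0) auto
    then show "poly (zcol t q) z2 * z1 ^ t = 0" by (simp add: zc)
  qed simp
  also have "(\<Sum>t\<le>deg1 q. poly (zcol t q) z2 * z1 ^ t)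
      = (\<Sum>t\<le>deg1 q. \<Sum>k\<le>degree q. coeff2 q t k * z1 ^ t * z2 ^ k)"
    by (simp add: zc sum_distrib_left sum_distrib_right mult_ac)
  also have "\<dots> = eval2 q z1 z2"
    unfolding eval2_double_sum[of q "deg1 q" "degree q", OF order_refl, simplified deg2_def, OF order_refl]
    by (rule sum.swap)
  finally show ?thesis .
qed

theorem theorem3p2:
  fixes p :: "complex poly poly" and m n :: nat
    and S1 S2 :: "(complex \<times> complex \<Rightarrow> complex) set"
    and q :: "nat \<Rightarrow> complex poly poly"
  assumes nozero: "\<forall>z1 z2. (z1, z2) \<in> bidisk \<longrightarrow> eval2 p z1 z2 \<noteq> 0"
    and degp: "deg1 p \<le> m" "deg2 p \<le> n"
    and degm: "max (deg1 p) (deg1 (ptilde m n p)) = m"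
    and degn: "max (deg2 p) (deg2 (ptilde m n p)) = n"
    and cop: "coprime p (ptilde m n p)"
    and S1: "closed_subspace S1" "invariant Mz1 S1"
    and S2: "closed_subspace S2" "invariant Mz2 S2"
    and orth: "\<forall>f\<in>S1. \<forall>g\<in>S2. h2inner f g = 0"
    and decomp: "Kspace m n p = {(\<lambda>z. f z + g z) |f g. f \<in> S1 \<and> g \<in> S2}"
    and qmem: "\<forall>i<m. restr2 (\<lambda>(z1, z2). eval2 (q i) z1 z2 / eval2 p z1 z2) \<in> ominus S2 (Mz2 ` S2)"
    and qon: "\<forall>i<m. \<forall>j<m. h2inner (restr2 (\<lambda>(z1, z2). eval2 (q i) z1 z2 / eval2 p z1 z2))
                         (restr2 (\<lambda>(z1, z2). eval2 (q j) z1 z2 / eval2 p z1 z2)) = (if i = j then 1 else 0)"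
    and qspan: "\<forall>f\<in>ominus S2 (Mz2 ` S2). \<exists>c::nat \<Rightarrow> complex.
                  f = (\<lambda>z. \<Sum>i<m. c i * restr2 (\<lambda>(z1, z2). eval2 (q i) z1 z2 / eval2 p z1 z2) z)"
  shows "\<exists>M\<Theta> :: complex \<Rightarrow> nat \<Rightarrow> nat \<Rightarrow> complex.
           (\<exists>A B :: nat \<Rightarrow> nat \<Rightarrow> complex poly. \<forall>i<m. \<forall>j<m.
               (\<forall>w\<in>cball 0 1. poly (B i j) w \<noteq> 0) \<and>
               (\<forall>\<zeta>. M\<Theta> \<zeta> i j = poly (A i j) (cnj \<zeta>) / poly (B i j) (cnj \<zeta>))) \<and>
           (\<forall>g\<in>S2. proj S2 (Mz1 g) = Umap m p q (toeplitz m M\<Theta> (Uadj m p q g)))"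
proof -
  define V1 where "V1 = {x. fn2 x \<in> S1}"
  define V2 where "V2 = {x. fn2 x \<in> S2}"
  note V1 = closed_subspace_preimage[OF S1(1), folded V1_def]
  note V2 = closed_subspace_preimage[OF S2(1), folded V2_def]
  have nz: "eval2 p z1 z2 \<noteq> 0" if "norm z1 < 1" "norm z2 < 1" for z1 z2
    using nozero that by simp
  have V1_shift: "shift1 x \<in> V1" if "x \<in> V1" for x
    using that S1(2) by (simp add: V1_def invariant_def fn2_shift1)
  have V2_shift: "shift2 x \<in> V2" if "x \<in> V2" for x
    using that S2(2) by (simp add: V2_def invariant_def fn2_shift2)
  have V12: "ip x y = 0" if "x \<in> V1" "y \<in> V2" for x y
    using that orth by (simp add: V1_def V2_def flip: h2inner_fn2)

  \<comment> \<open>\<open>S\<^sub>2\<close> is invariant under the backward shift in \<open>z\<^sub>1\<close>, which is the adjoint of the compression.\<close>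
  have V2_bshift: "bshift1 x \<in> V2" if x: "x \<in> V2" for x
  proof -
    define \<Theta> where "\<Theta> g = restr2 (\<lambda>(z1, z2). eval2 (ptilde m n p) z1 z2 / eval2 p z1 z2 * g (z1, z2))"
      for g :: "complex \<times> complex \<Rightarrow> complex"
    have K_iff: "fn2 y \<in> Kspace m n p \<longleftrightarrow> (\<forall>u. h2inner (fn2 y) (\<Theta> (fn2 u)) = 0)" for y
      unfolding Kspace_def ominus_def H2_eq \<Theta>_def by auto
    have "0 \<in> V1" using V1(1) by (simp add: csubspace_def)
    have "fn2 x \<in> Kspace m n p"
    proof -
      have "fn2 x = (\<lambda>z. fn2 0 z + fn2 x z)" unfolding fn2_linear by simp
      then show ?thesis using x \<open>0 \<in> V1\<close> unfolding decomp V1_def V2_def by blast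
    qed
    have "fn2 (bshift1 x) \<in> Kspace m n p"
      unfolding K_iff
    proof
      fix u
      \<comment> \<open>Since \<Theta> maps H^2 into H^2, the function \<Theta> g is given by a
        coefficient vector, and \<open>h2inner\<close> with it is a genuine inner product.\<close>
      obtain y where y: "fn2 y = \<Theta> (fn2 u)"
        using inner_function_multiplies_H2[OF nz degp] unfolding \<Theta>_def by blast
      \<comment> \<open>Multiplication by z_1 commutes with \<Theta>, so the range of \<Theta> is
        invariant under it and the orthogonal complement under the adjoint.\<close>
      have "fn2 (shift1 y) = \<Theta> (fn2 (shift1 u))"
        unfolding fn2_shift1 y by (auto simp: \<Theta>_def Mz1_def restr2_def fun_eq_iff)
      then have "ip x (shift1 y) = 0"
        using \<open>fn2 x \<in> Kspace m n p\<close> unfolding K_iff by (metis h2inner_fn2)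
      then have "ip (bshift1 x) y = 0"
        using ip_shift1_bshift1[of y x] ip_commute[of x "shift1 y"] ip_commute[of "bshift1 x" y] by simp
      then show "h2inner (fn2 (bshift1 x)) (\<Theta> (fn2 u)) = 0"
        by (simp add: h2inner_fn2 flip: y)
    qed
    then obtain f g where fg: "fn2 (bshift1 x) = (\<lambda>z. f z + g z)" "f \<in> S1" "g \<in> S2"
      unfolding decomp by blast
    obtain a b where ab: "f = fn2 a" "a \<in> V1" "g = fn2 b" "b \<in> V2"
      using fg V1(3) V2(3) by blast
    have sum: "bshift1 x = a + b"
      using fg(1) unfolding ab fn2_linear fn2_inject .
    \<comment> \<open>Moving L to the other side turns a into z_1 a, which is still in S_1 and hence
      orthogonal to x in S_2. So the S_1 component a of L x vanishes.\<close>
    have "ip a (bshift1 x) = 0"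
      using V12[OF V1_shift[OF ab(2)] x] by (simp add: ip_shift1_bshift1)
    then have "ip a a = 0" using V12[OF ab(2,4)] by (simp add: sum ip_add_right)
    then have "a = 0" by (simp add: ip_self_norm)
    then show ?thesis using sum ab by simp
  qed

  \<comment> \<open>Coordinates with respect to the orthonormal basis z_2^k q_i/p\<close>
  define \<phi> where "\<phi> i = restr2 (\<lambda>(z1, z2). eval2 (q i) z1 z2 / eval2 p z1 z2)" for i
  have \<phi>_apply: "\<phi> i (z1, z2) = eval2 (q i) z1 z2 / eval2 p z1 z2" if "norm z1 < 1" "norm z2 < 1" for i z1 z2
    using that by (simp add: \<phi>_def restr2_def)
  have "\<exists>w. fn2 w = \<phi> i \<and> w \<in> V2" if "i < m" for i
  proof -
    have "\<phi> i \<in> S2" using qmem that by (simp add: ominus_def \<phi>_def)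
    then have "\<phi> i \<in> fn2 ` V2" unfolding V2(3)[symmetric] .
    then show ?thesis by auto
  qed
  then obtain w where w: "\<And>i. i < m \<Longrightarrow> fn2 (w i) = \<phi> i" "\<And>i. i < m \<Longrightarrow> w i \<in> V2" by metis
  have w_orth: "ip (w i) (shift2 x) = 0" if "i < m" "x \<in> V2" for i x
  proof -
    have "h2inner (\<phi> i) (Mz2 (fn2 x)) = 0"
      using qmem that unfolding ominus_def \<phi>_def V2_def by blast
    then show ?thesis by (simp add: h2inner_fn2 flip: w(1)[OF that(1)] fn2_shift2)
  qed
  have w_on: "ip (w i) (w j) = (if i = j then 1 else 0)" if "i < m" "j < m" for i j
    using qon that by (simp add: w(1) flip: h2inner_fn2 \<phi>_def)
  have w_span: "\<exists>c. x = (\<Sum>i<m. sc (c i) (w i))" if "x \<in> V2" "\<And>y. y \<in> V2 \<Longrightarrow> ip x (shift2 y) = 0" for x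
  proof -
    have "h2inner (fn2 x) g = 0" if g: "g \<in> Mz2 ` S2" for g
    proof -
      obtain f where "f \<in> S2" "g = Mz2 f" using g by blast
      moreover obtain y where "y \<in> V2" "f = fn2 y" using \<open>f \<in> S2\<close> V2(3) by blast
      ultimately have "y \<in> V2" "g = fn2 (shift2 y)" by (simp_all add: fn2_shift2)
      then show ?thesis using \<open>\<And>y. y \<in> V2 \<Longrightarrow> ip x (shift2 y) = 0\<close> by (simp add: h2inner_fn2)
    qed
    then have "fn2 x \<in> ominus S2 (Mz2 ` S2)"
      using \<open>x \<in> V2\<close> by (simp add: ominus_def V2_def)
    then obtain c where "fn2 x = (\<lambda>z. \<Sum>i<m. c i * \<phi> i z)"
      using qspan unfolding \<phi>_def by blast
    also have "\<dots> = (\<lambda>z. \<Sum>i<m. fn2 (sc (c i) (w i)) z)"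
      by (intro ext sum.cong refl) (simp add: w(1) flip: fn2_linear(3))
    also have "\<dots> = fn2 (\<Sum>i<m. sc (c i) (w i))" by (rule fn2_sum)
    finally show ?thesis unfolding fn2_inject by blast
  qed
  define e where "e = (\<lambda>i k. (shift2 ^^ k) (w i))"
  note wold = wold_decomposition[of V2 shift2 m w]
  have on: "onfamily m e"
    unfolding e_def
    by (rule wold(1), rule V2(1), rule V2(2), erule V2_shift, rule shift2_linear, rule shift2_linear,
        rule ip_shift2, rule shift2_pure, blast, erule w(2), erule w_orth, assumption, erule w_on, assumption,
        erule w_span, blast)
  have eV: "e i k \<in> V2" if "i < m" for i k
    unfolding e_def
    by (rule wold(2), rule V2(1), rule V2(2), erule V2_shift, rule shift2_linear, rule shift2_linear,
        rule ip_shift2, rule shift2_pure, blast, erule w(2), erule w_orth, assumption, erule w_on, assumption,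
        erule w_span, blast,
        rule that)
  have expand: "v = onseries m e (\<lambda>i k. ip v (e i k))" if "v \<in> V2" for v
    unfolding e_def
    by (rule wold(3), rule V2(1), rule V2(2), erule V2_shift, rule shift2_linear, rule shift2_linear,
        rule ip_shift2, rule shift2_pure, blast, erule w(2), erule w_orth, assumption, erule w_on, assumption,
        erule w_span, blast,
        rule that)
  have sq: "summable (\<lambda>k. (norm (ell2_coef x k))\<^sup>2)" for x :: "nat ell2"
    by (rule sums_summable[OF norm_ell2_sums])
  have co_ex: "\<exists>x. (i < m \<longrightarrow> ell2_coef x = (\<lambda>k. ip v (e i k))) \<and> (i \<ge> m \<longrightarrow> x = 0)" for v i
  proof (cases "i < m")
    case True
    have "summable (\<lambda>k. (norm (ip v (e i k)))\<^sup>2)"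
      by (rule bessel_summable) (use on True in \<open>auto simp: onfamily_row\<close>)
    then obtain x where "ell2_coef x = (\<lambda>k. ip v (e i k))" by (rule nat_ell2_of_square_summable)
    then show ?thesis using True by (intro exI[of _ x]) simp
  qed auto
  \<comment> \<open>\<open>co v\<close> collects the coordinates of v row by row. For v in S_2 this
    is U^* v; for other v it is U^* of the projection of v onto S_2.\<close>
  define co where "co v i = (SOME x. (i < m \<longrightarrow> ell2_coef x = (\<lambda>k. ip v (e i k))) \<and> (i \<ge> m \<longrightarrow> x = 0))" for v i
  have co: "i < m \<Longrightarrow> ell2_coef (co v i) = (\<lambda>k. ip v (e i k))" "i \<ge> m \<Longrightarrow> co v i = 0" for v i
    using someI_ex[OF co_ex[of i v], folded co_def] by auto
  \<comment> \<open>This is U on the level of coefficients.\<close>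
  define ser where "ser c = onseries m e (\<lambda>i k. ell2_coef (c i) k)" for c :: "nat \<Rightarrow> nat ell2"
  have ser_basis: "ip (ser c) (e i k) = ell2_coef (c i) k" if "i < m" for c i k
    unfolding ser_def by (rule ip_onseries_basis[OF on sq that])
  have ip_ser: "ip (ser c) (ser d) = (\<Sum>i<m. ip (c i) (d i))" for c d
    unfolding ser_def[of d] ip_onseries_right[OF on sq]
    by (intro sum.cong refl) (simp add: ser_basis ip_suminf mult.commute)
  have ser_V2: "ser c \<in> V2" for c
    unfolding ser_def by (rule onseries_mem[OF on sq V2(1,2) eV])
  have ser_co: "ser (co v) = v" if "v \<in> V2" for v
  proof -
    have "ser (co v) = onseries m e (\<lambda>i k. ip v (e i k))"
      unfolding ser_def onseries_def by (intro sum.cong refl) (simp add: co(1))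
    then show ?thesis using expand[OF that] by simp
  qed
  have ser_apply: "fn2 (ser c) (z1, z2) = (\<Sum>i<m. \<phi> i (z1, z2) * fn1 (c i) z2)" if z: "norm z1 < 1" "norm z2 < 1" for c z1 z2
  proof -
    have "ip (\<Sum>k. sc (ell2_coef (c i) k) (e i k)) (kern2 (z1, z2)) = \<phi> i (z1, z2) * fn1 (c i) z2" if "i < m" for i
    proof -
      have eik: "ip (e i k) (kern2 (z1, z2)) = z2 ^ k * \<phi> i (z1, z2)" for k
        using fn2_shift2_power[of k "w i" "(z1, z2)"] z w(1)[OF that] by (simp add: fn2_def e_def)
      \<comment> \<open>Evaluation at a point is a bounded functional, so it may be applied to the
        series term by term.\<close>
      have "(\<lambda>k. ip (sc (ell2_coef (c i) k) (e i k)) (kern2 (z1, z2)))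
          sums ip (\<Sum>k. sc (ell2_coef (c i) k) (e i k)) (kern2 (z1, z2))"
        by (rule bounded_linear.sums[OF bounded_linear_ip_left summable_sums[OF onfamily_summable[OF on that sq]]])
      moreover have "(\<lambda>k. ip (sc (ell2_coef (c i) k) (e i k)) (kern2 (z1, z2))) sums (\<phi> i (z1, z2) * fn1 (c i) z2)"
        using sums_mult[OF fn1_sums[OF z(2), of "c i"], of "\<phi> i (z1, z2)"] by (simp add: ip_sc_left eik mult_ac)
      ultimately show ?thesis by (rule sums_unique2)
    qed
    then show ?thesis using z by (simp add: fn2_def ser_def onseries_def ip_sum_left)
  qed
  have Umap_ser: "Umap m p q (\<lambda>i. fn1 (c i)) = fn2 (ser c)" for c
  proof
    fix z :: "complex \<times> complex"
    obtain z1 z2 where z: "z = (z1, z2)" by (cases z)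
    show "Umap m p q (\<lambda>i. fn1 (c i)) z = fn2 (ser c) z"
    proof (cases "z \<in> bidisk")
      case True
      then show ?thesis unfolding z by (simp add: Umap_def restr2_def ser_apply \<phi>_apply)
    qed (simp add: Umap_def restr2_def fn2_def)
  qed
  have vinner_fn1: "vinner m (\<lambda>i. fn1 (c i)) (\<lambda>i. fn1 (d i)) = ip (ser c) (ser d)" for c d
    unfolding ip_ser vinner_def h2inner1_fn1 ..
  have Uadj_eq: "Uadj m p q (fn2 v) = (\<lambda>i. fn1 (co v i))" if v: "v \<in> V2" for v
    unfolding Uadj_def
  proof (rule the_equality)
    show "(\<lambda>i. fn1 (co v i)) \<in> H2vec m \<and>
        (\<forall>G\<in>H2vec m. h2inner (Umap m p q G) (fn2 v) = vinner m G (\<lambda>i. fn1 (co v i)))"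
    proof (intro conjI ballI)
      show "(\<lambda>i. fn1 (co v i)) \<in> H2vec m" unfolding H2vec_iff using co(2) by blast
      fix G assume "G \<in> H2vec m"
      then obtain c where "G = (\<lambda>i. fn1 (c i))" unfolding H2vec_iff by blast
      then show "h2inner (Umap m p q G) (fn2 v) = vinner m G (\<lambda>i. fn1 (co v i))"
        by (simp add: Umap_ser h2inner_fn2 vinner_fn1 ser_co[OF v])
    qed
  next
    fix F assume F: "F \<in> H2vec m \<and> (\<forall>G\<in>H2vec m. h2inner (Umap m p q G) (fn2 v) = vinner m G F)"
    then obtain d where d: "F = (\<lambda>i. fn1 (d i))" "\<And>i. i \<ge> m \<Longrightarrow> d i = 0" unfolding H2vec_iff by blast
    \<comment> \<open>Uniqueness of the adjoint: the defining identity is tested on the difference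
      of the two candidates, which makes its squared norm vanish.\<close>
    have "(\<lambda>i. fn1 (co v i - d i)) \<in> H2vec m"
      unfolding H2vec_iff by (rule exI[of _ "\<lambda>i. co v i - d i"]) (simp add: co(2) d(2))
    then have "h2inner (Umap m p q (\<lambda>i. fn1 (co v i - d i))) (fn2 v) = vinner m (\<lambda>i. fn1 (co v i - d i)) F"
      using F by blast
    then have "ip (ser (\<lambda>i. co v i - d i)) v = ip (ser (\<lambda>i. co v i - d i)) (ser d)"
      unfolding Umap_ser h2inner_fn2 d(1) vinner_fn1 .
    then have "ip (ser (\<lambda>i. co v i - d i)) (ser (co v)) - ip (ser (\<lambda>i. co v i - d i)) (ser d) = 0"
      by (simp add: ser_co[OF v])
    then have "(\<Sum>i<m. ip (co v i - d i) (co v i - d i)) = 0"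
      unfolding ip_ser sum_subtractf[symmetric] ip_diff_right[symmetric] .
    then have "complex_of_real (\<Sum>i<m. (norm (co v i - d i))\<^sup>2) = 0"
      unfolding ip_self_norm of_real_sum .
    then have "(\<Sum>i<m. (norm (co v i - d i))\<^sup>2) = 0" by (simp only: of_real_eq_0_iff)
    then have "co v i = d i" if "i < m" for i
      using that by (subst (asm) sum_nonneg_eq_0_iff) auto
    then have "co v i = d i" for i using co(2) d(2) by (cases "i < m") auto
    then show "F = (\<lambda>i. fn1 (co v i))" using d(1) by simp
  qed

  \<comment> \<open>\<open>y l i\<close> holds the Taylor coefficients of \<Phi>_{li}, the l-th
    coordinate function of L(q_i/p).\<close>
  define y where "y l i = co (bshift1 (w i)) l" for l i
  have "\<exists>A B. (\<forall>z\<in>cball 0 1. poly B z \<noteq> 0) \<and> (\<forall>z. norm z < 1 \<longrightarrow> fn1 (y l i) z = poly A z / poly B z)"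
    if "l < m" and i: "i < m" for l i
  proof -
    \<comment> \<open>Multiplying z_1 L(q_i/p) = q_i/p - q_i(0, z_2)/p(0, z_2) by p and by p(0, z_2)
      gives p(0, z_2) z_1 sum_l q_l \<Phi>_{li} = q_i p(0, z_2) - q_i(0, z_2) p. \<open>R t\<close>
      is the coefficient of z_1^(t+1) on the right.\<close>
    define P0 where "P0 = zcol 0 p"
    define R where "R t = zcol (Suc t) (q i) * P0 - zcol 0 (q i) * zcol (Suc t) p" for t
    have at0: "eval2 r 0 z2 = poly (zcol 0 r) z2" for r z2
      using zcol_sums[of r z2 0] by simp
    have P0_nz: "poly P0 z2 \<noteq> 0" if "norm z2 < 1" for z2
      using nz[of 0 z2] that by (simp add: at0 P0_def)
    have row_sums: "(\<lambda>t. (\<Sum>l<m. poly (zcol t (q l)) z2 * c l) * z1 ^ t) sums (\<Sum>l<m. eval2 (q l) z1 z2 * c l)" for c z1 z2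
    proof -
      have "(\<lambda>t. \<Sum>l<m. (poly (zcol t (q l)) z2 * z1 ^ t) * c l) sums (\<Sum>l<m. eval2 (q l) z1 z2 * c l)"
        by (intro sums_sum sums_mult2 zcol_sums)
      moreover have "(\<Sum>l<m. (poly (zcol t (q l)) z2 * z1 ^ t) * c l) = (\<Sum>l<m. poly (zcol t (q l)) z2 * c l) * z1 ^ t" for t
        unfolding sum_distrib_right by (intro sum.cong refl) simp
      ultimately show ?thesis by simp
    qed
    have rows: "(\<Sum>l<m. poly (P0 * zcol t (q l)) z2 * fn1 (y l i) z2) = poly (R t) z2" if z2: "z2 \<in> ball 0 1" for t z2
    proof -
      have nz2: "norm z2 < 1" using z2 by simp
      define S where "S t = (\<Sum>l<m. poly (zcol t (q l)) z2 * fn1 (y l i) z2)" for t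
      \<comment> \<open>The coefficient of z_1^t in the difference of the two sides; the factor z_1
        on the left shifts the index, whence the exception at t = 0.\<close>
      define L where "L t = (if t = 0 then 0 else poly P0 z2 * S (t - 1))
          - (poly (zcol t (q i)) z2 * poly P0 z2 - poly (zcol 0 (q i)) z2 * poly (zcol t p) z2)" for t
      have "L (Suc t) = 0"
      proof (rule power_series_sums_zero_imp)
        fix z1 :: complex assume nz1: "norm z1 < 1"
        define s where "s = (\<Sum>l<m. eval2 (q l) z1 z2 * fn1 (y l i) z2)"
        have "(\<lambda>t. S t * z1 ^ t) sums s" unfolding S_def s_def by (rule row_sums)
        from sums_mult[OF this, of "poly P0 z2 * z1"]
        have "(\<lambda>t. (if Suc t = 0 then 0 else poly P0 z2 * S (Suc t - 1)) * z1 ^ Suc t) sums (poly P0 z2 * z1 * s)"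
          by (simp add: mult_ac)
        from sums_Suc[of "\<lambda>t. (if t = 0 then 0 else poly P0 z2 * S (t - 1)) * z1 ^ t", OF this]
        have a: "(\<lambda>t. (if t = 0 then 0 else poly P0 z2 * S (t - 1)) * z1 ^ t) sums (poly P0 z2 * z1 * s)" by simp
        have b: "(\<lambda>t. (poly (zcol t (q i)) z2 * poly P0 z2 - poly (zcol 0 (q i)) z2 * poly (zcol t p) z2) * z1 ^ t)
            sums (eval2 (q i) z1 z2 * poly P0 z2 - poly (zcol 0 (q i)) z2 * eval2 p z1 z2)"
          using sums_diff[OF sums_mult2[OF zcol_sums[of "q i" z2 z1], of "poly P0 z2"]
              sums_mult[OF zcol_sums[of p z2 z1], of "poly (zcol 0 (q i)) z2"]]
          by (simp add: algebra_simps)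
        have "(\<lambda>t. L t * z1 ^ t) sums (poly P0 z2 * z1 * s
            - (eval2 (q i) z1 z2 * poly P0 z2 - poly (zcol 0 (q i)) z2 * eval2 p z1 z2))"
          using sums_diff[OF a b] by (simp add: L_def left_diff_distrib)
        moreover have "poly P0 z2 * z1 * s = eval2 (q i) z1 z2 * poly P0 z2 - poly (zcol 0 (q i)) z2 * eval2 p z1 z2"
        proof -
          have "fn2 (bshift1 (w i)) (z1, z2) = s / eval2 p z1 z2"
            using ser_apply[OF nz1 nz2, of "\<lambda>l. y l i"] ser_co[OF V2_bshift[OF w(2)[OF i]]]
            by (simp add: y_def s_def \<phi>_apply[OF nz1 nz2] sum_divide_distrib)
          moreover have "z1 * fn2 (bshift1 (w i)) (z1, z2) = \<phi> i (z1, z2) - \<phi> i (0, z2)"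
            using fn2_bshift1[OF nz1 nz2, of "w i"] w(1)[OF i] by simp
          ultimately have "z1 * (s / eval2 p z1 z2) = eval2 (q i) z1 z2 / eval2 p z1 z2 - eval2 (q i) 0 z2 / eval2 p 0 z2"
            using \<phi>_apply[OF nz1 nz2, of i] \<phi>_apply[of 0 z2 i] nz2 by simp
          then show ?thesis
            using nz[OF nz1 nz2] P0_nz[OF nz2] by (simp add: at0 P0_def field_simps)
        qed
        ultimately show "(\<lambda>t. L t * z1 ^ t) sums 0" by simp
      qed
      then show ?thesis by (simp add: L_def S_def R_def sum_distrib_left mult.assoc)
    qed
    \<comment> \<open>A polynomial relation between the columns says sum_l q_l g_l = 0, that is U g
      = 0; reading off coordinates in the orthonormal family then gives g = 0.\<close>
    have indep: "\<forall>l<m. g l = 0" if g: "\<And>t. (\<Sum>l<m. P0 * zcol t (q l) * g l) = 0" for g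
    proof (intro allI impI)
      fix l assume "l < m"
      have "P0 \<noteq> 0" using P0_nz[of 0] by auto
      have "P0 * (\<Sum>l<m. zcol t (q l) * g l) = 0" for t
        using g[of t] by (simp add: sum_distrib_left mult.assoc)
      then have g0: "(\<Sum>l<m. zcol t (q l) * g l) = 0" for t using \<open>P0 \<noteq> 0\<close> by simp
      have "\<exists>x. ell2_coef x = coeff (g l)" for l
      proof -
        have "summable (\<lambda>k. (norm (coeff (g l) k))\<^sup>2)"
          by (rule summable_finite[of "{..degree (g l)}"]) (auto simp: coeff_eq_0)
        then show ?thesis using nat_ell2_of_square_summable by blast
      qed
      then obtain x where x: "\<And>l. ell2_coef (x l) = coeff (g l)" by metis
      have fx: "fn1 (x l) z = poly (g l) z" if "norm z < 1" for l z
      proof -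
        have "(\<lambda>k. coeff (g l) k * z ^ k) sums (\<Sum>k\<le>degree (g l). coeff (g l) k * z ^ k)"
          by (rule sums_finite) (auto simp: coeff_eq_0)
        then show ?thesis using fn1_sums[OF that, of "x l"] sums_unique2 unfolding x poly_altdef by blast
      qed
      have "fn2 (ser x) = fn2 0"
      proof
        fix z :: "complex \<times> complex"
        obtain z1 z2 where z: "z = (z1, z2)" by (cases z)
        show "fn2 (ser x) z = fn2 0 z"
        proof (cases "z \<in> bidisk")
          case True
          then have n: "norm z1 < 1" "norm z2 < 1" by (auto simp: z)
          have "(\<Sum>l<m. poly (zcol t (q l)) z2 * poly (g l) z2) = 0" for t
            using arg_cong[OF g0[of t], of "\<lambda>r. poly r z2"] by (simp add: poly_sum)
          then have "(\<lambda>t. 0) sums (\<Sum>l<m. eval2 (q l) z1 z2 * poly (g l) z2)"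
            using row_sums[of z2 "\<lambda>l. poly (g l) z2" z1] by simp
          then have "(\<Sum>l<m. eval2 (q l) z1 z2 * poly (g l) z2) = 0"
            using sums_zero sums_unique2 by blast
          moreover have "fn2 (ser x) (z1, z2) = (\<Sum>l<m. eval2 (q l) z1 z2 * poly (g l) z2) / eval2 p z1 z2"
            unfolding ser_apply[OF n] by (simp add: \<phi>_apply[OF n] fx[OF n(2)] sum_divide_distrib)
          ultimately show ?thesis by (simp add: z fn2_linear(4))
        qed (simp add: fn2_def)
      qed
      then have "ser x = 0" unfolding fn2_inject .
      then have "ell2_coef (x l) k = 0" for k using ser_basis[OF \<open>l < m\<close>, of x k] by simp
      then show "g l = 0" by (intro poly_eqI) (simp add: x)
    qed
    have "\<forall>l<m. \<exists>D N. D \<noteq> 0 \<and> (\<forall>z\<in>ball 0 1. poly D z * fn1 (y l i) z = poly N z)"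
    proof (rule rational_solution[where Q = "\<lambda>t l. P0 * zcol t (q l)" and R = R])
      show "\<forall>l<m. g l = 0" if "\<And>t. (\<Sum>l<m. P0 * zcol t (q l) * g l) = 0" for g
        using that by (rule indep)
    qed (rule rows)
    then obtain D N where "D \<noteq> 0" "\<And>z. norm z < 1 \<Longrightarrow> poly D z * fn1 (y l i) z = poly N z"
      using \<open>l < m\<close> by auto
    then show ?thesis by (rule rational_H2_pole_free)
  qed
  then obtain A B where AB: "\<And>l i z. l < m \<Longrightarrow> i < m \<Longrightarrow> z \<in> cball 0 1 \<Longrightarrow> poly (B l i) z \<noteq> 0"
    "\<And>l i z. l < m \<Longrightarrow> i < m \<Longrightarrow> norm z < 1 \<Longrightarrow> fn1 (y l i) z = poly (A l i) z / poly (B l i) z"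
    by metis
  define \<psi> where "\<psi> l i \<zeta> = poly (A l i) \<zeta> / poly (B l i) \<zeta>" for l i \<zeta>
  \<comment> \<open>The conjugate transpose of \<Phi>, because the compression is the adjoint of
    L.\<close>
  define M\<Theta> where "M\<Theta> \<zeta> i l = cnj (\<psi> l i \<zeta>)" for \<zeta> i l
  have \<psi>_cont: "continuous_on (cball 0 1) (\<psi> l i)" if "l < m" "i < m" for l i
    unfolding \<psi>_def using AB(1)[OF that] by (intro continuous_intros) auto
  have \<psi>_fn1: "\<psi> l i z = fn1 (y l i) z" if "l < m" "i < m" "norm z < 1" for l i z
    using AB(2)[OF that] by (simp add: \<psi>_def)

  \<comment> \<open>The adjoint relation moves the shift onto the basis vector: <z_1 v, z_2^k q_i/p>
    = <v, z_2^k L(q_i/p)>, and L(q_i/p) is expanded in the orthonormal family with coefficients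
    \<open>y l i\<close>.\<close>
  have coef_shift1: "ip (shift1 v) (e i k) = (\<Sum>l<m. \<Sum>j. ell2_coef (co v l) (j + k) * cnj (ell2_coef (y l i) j))"
    if i: "i < m" for v i k
  proof -
    define T where "T x = ip v ((shift2 ^^ k) x)" for x
    \<comment> \<open>\<open>T\<close> is conjugate-linear over the complex numbers, but bounded and
      real-linear, which is what termwise application to the series uses.\<close>
    have T: "bounded_linear T"
      unfolding T_def by (rule bounded_linear_compose[OF bounded_linear_ip_right bounded_linear_shift2_power])
    have T_sc: "T (sc c (e l j)) = ip v (e l (j + k)) * cnj c" for c l j
    proof -
      have "(shift2 ^^ k) (e l j) = e l (j + k)"
        by (simp add: e_def funpow_add[of k j, simplified o_def, THEN fun_cong, symmetric] add.commute)
      then show ?thesis by (simp add: T_def shift2_power_sc ip_sc_right mult.commute)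
    qed
    have "ip (shift1 v) (e i k) = T (bshift1 (w i))"
      unfolding T_def ip_shift1_bshift1 e_def bshift1_shift2_power ..
    also have "bshift1 (w i) = ser (\<lambda>l. y l i)"
      using ser_co[OF V2_bshift[OF w(2)[OF i]]] by (simp add: y_def)
    also have "T (ser (\<lambda>l. y l i)) = (\<Sum>l<m. T (\<Sum>j. sc (ell2_coef (y l i) j) (e l j)))"
      unfolding ser_def onseries_def using linear_sum[OF bounded_linear.linear[OF T]] .
    also have "\<dots> = (\<Sum>l<m. \<Sum>j. T (sc (ell2_coef (y l i) j) (e l j)))"
      by (intro sum.cong refl bounded_linear.suminf[OF T] onfamily_summable[OF on _ sq]) auto
    also have "\<dots> = (\<Sum>l<m. \<Sum>j. ell2_coef (co v l) (j + k) * cnj (ell2_coef (y l i) j))"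
      by (intro sum.cong refl) (simp add: T_sc co(1))
    finally show ?thesis .
  qed
  \<comment> \<open>The nonnegative Fourier coefficients of symbol times vector are the coordinates
    of z_1 v computed above, so the Toeplitz operator sends the coordinates of v to those of z_1
    v.\<close>
  have toep: "toeplitz m M\<Theta> (\<lambda>i. fn1 (co v i)) = (\<lambda>i. fn1 (co (shift1 v) i))" for v
  proof
    fix i
    show "toeplitz m M\<Theta> (\<lambda>i. fn1 (co v i)) i = fn1 (co (shift1 v) i)"
    proof (cases "i < m")
      case i: True
      define h where "h \<zeta> = (\<Sum>l<m. M\<Theta> \<zeta> i l * bv (fn1 (co v l)) \<zeta>)" for \<zeta>
      have four: "fourier h (int k) = ip (shift1 v) (e i k)" for k
      proof -
        let ?f = "\<lambda>l t. cnj (\<psi> l i (cis t)) * bv (fn1 (co v l)) (cis t) * cis (- (of_int (int k) * t))"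
        have int: "integrable (lebesgue_on {0..2*pi}) (?f l)"
          "integral\<^sup>L (lebesgue_on {0..2*pi}) (?f l) = 2 * pi * (\<Sum>j. ell2_coef (co v l) (j + k) * cnj (ell2_coef (y l i) j))"
          if "l < m" for l
          using fourier_coanalytic_mult[OF \<psi>_cont[OF that i], of "y l i" "co v l" k] \<psi>_fn1[OF that i] by auto
        have "integral\<^sup>L (lebesgue_on {0..2*pi}) (\<lambda>t. h (cis t) * cis (- (of_int (int k) * t)))
            = integral\<^sup>L (lebesgue_on {0..2*pi}) (\<lambda>t. \<Sum>l<m. ?f l t)"
          by (simp add: h_def M\<Theta>_def sum_distrib_right)
        also have "\<dots> = (\<Sum>l<m. integral\<^sup>L (lebesgue_on {0..2*pi}) (?f l))"
          by (rule Bochner_Integration.integral_sum) (use int(1) in simp)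
        also have "\<dots> = 2 * pi * (\<Sum>l<m. \<Sum>j. ell2_coef (co v l) (j + k) * cnj (ell2_coef (y l i) j))"
          unfolding sum_distrib_left by (intro sum.cong refl) (simp only: int(2) lessThan_iff)
        also have "\<dots> = 2 * pi * ip (shift1 v) (e i k)" by (simp add: coef_shift1[OF i])
        finally show ?thesis by (simp add: fourier_def)
      qed
      have "PH2 h z = fn1 (co (shift1 v) i) z" for z
      proof (cases "norm z < 1")
        case True
        then show ?thesis
          using fn1_sums[OF True, of "co (shift1 v) i"] by (simp add: PH2_def four co(1)[OF i] sums_iff)
      qed (simp add: PH2_def fn1_def)
      then show ?thesis using i by (simp add: toeplitz_def h_def[abs_def] fun_eq_iff)
    qed (simp add: toeplitz_def co(2) fn1_zero)
  qed
  have proj_eq: "proj S2 (Mz1 (fn2 v)) = fn2 (ser (co (shift1 v)))" for v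
    unfolding proj_def
  proof (rule the_equality)
    define u where "u = ser (co (shift1 v))"
    \<comment> \<open>\<open>u\<close> and z_1 v have the same coordinates against every basis
      vector, and each element of S_2 is a series in these vectors.\<close>
    have orthu: "ip (shift1 v - u) x = 0" if "x \<in> V2" for x
    proof -
      have "ip (shift1 v - u) (ser (co x)) = 0"
        unfolding ser_def[of "co x"] ip_onseries_right[OF on sq]
        by (rule sum.neutral) (simp add: ip_diff_left u_def ser_basis co(1))
      then show ?thesis by (simp add: ser_co[OF that])
    qed
    have diff: "(\<lambda>z. Mz1 (fn2 v) z - fn2 x z) = fn2 (shift1 v - x)" for x
      unfolding fn2_shift1[symmetric] by (rule fn2_linear(2))
    have S2_all: "(\<forall>h\<in>S2. P h) \<longleftrightarrow> (\<forall>x\<in>V2. P (fn2 x))" for P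
      by (subst V2(3)) blast
    show "fn2 (ser (co (shift1 v))) \<in> S2 \<and>
        (\<forall>h\<in>S2. h2inner (\<lambda>z. Mz1 (fn2 v) z - fn2 (ser (co (shift1 v))) z) h = 0)"
      unfolding S2_all diff h2inner_fn2 using ser_V2[of "co (shift1 v)"] orthu by (simp add: V2_def u_def)
    fix g assume g: "g \<in> S2 \<and> (\<forall>h\<in>S2. h2inner (\<lambda>z. Mz1 (fn2 v) z - g z) h = 0)"
    then obtain x where x: "x \<in> V2" "g = fn2 x" using V2(3) by blast
    have "ip (shift1 v - x) t = 0" if "t \<in> V2" for t
      using g that unfolding S2_all x(2) diff h2inner_fn2 by blast
    then have "ip (u - x) t = 0" if "t \<in> V2" for t
      using orthu[OF that] that by (simp add: ip_diff_left)
    moreover have "u - x \<in> V2"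
      using csubspace_imp_subspace[OF V2(1)] ser_V2 x(1) unfolding u_def by (intro subspace_diff)
    ultimately have "ip (u - x) (u - x) = 0" by blast
    then have "u = x" by (simp add: ip_self_norm)
    then show "g = fn2 (ser (co (shift1 v)))" by (simp add: x(2) u_def)
  qed
  show ?thesis
  proof (intro exI conjI)
    \<comment> \<open>Conjugating a rational function of \<zeta> gives the one with conjugated
      coefficients at the conjugate point; the swapped indices come from the transposition. The
      closed disk is stable under conjugation, so the denominators keep having no zeros
      there.\<close>
    show "\<forall>i<m. \<forall>j<m. (\<forall>w\<in>cball 0 1. poly (map_poly cnj (B j i)) w \<noteq> 0) \<and>
        (\<forall>\<zeta>. M\<Theta> \<zeta> i j = poly (map_poly cnj (A j i)) (cnj \<zeta>) / poly (map_poly cnj (B j i)) (cnj \<zeta>))"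
      using AB(1) by (auto simp: M\<Theta>_def \<psi>_def)
    show "\<forall>g\<in>S2. proj S2 (Mz1 g) = Umap m p q (toeplitz m M\<Theta> (Uadj m p q g))"
    proof
      fix g assume "g \<in> S2"
      then obtain v where "v \<in> V2" "g = fn2 v" using V2(3) by blast
      then show "proj S2 (Mz1 g) = Umap m p q (toeplitz m M\<Theta> (Uadj m p q g))"
        by (simp add: Uadj_eq toep Umap_ser proj_eq)
    qed
  qed
qed

end
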